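(* For a prime $p$, consider the proportion of isomorphism classes of $2$-generated groups of order $p^6$ which are Beauville groups, i.e. the number of isomorphism classes of Beauville groups of order $p^6$ divided by the number of isomorphism classes of $2$-generated groups of order $p^6$. This proportion does not tend to $1$ as $p$ tends to infinity through the primes.
   Context: Let $G$ be a finite group with identity $e$. For $x,y\in G$ put $$\Sigma(x,y):=\bigcup_{i=1}^{|G|}\bigcup_{g\in G}\{(x^i)^g,(y^i)^g,((xy)^i)^g\},$$ where $a^g$ denotes the conjugate $g^{-1}ag$. A Beauville structure for $G$ is a pair of generating sets $\{x_1,y_1\},\{x_2,y_2\}$ of $G$ (i.e. $\langle x_1,y_1\rangle=\langle x_2,y_2\rangle=G$) such that $\Sigma(x_1,y_1)\cap\Sigma(x_2,y_2)=\{e\}$. $G$ is a Beauville group if there exists a Beauville structure for $G$. In particular every Beauville group is $2$-generated. A group is $2$-generated if it can be generated by two elements. *)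

theory Defs
  imports Complex_Main "HOL-Computational_Algebra.Primes" "HOL-Algebra.Generated_Groups"
begin

definition conjugate :: "('a, 'b) monoid_scheme \<Rightarrow> 'a \<Rightarrow> 'a \<Rightarrow> 'a" where
  "conjugate G a g = inv\<^bsub>G\<^esub> g \<otimes>\<^bsub>G\<^esub> a \<otimes>\<^bsub>G\<^esub> g"

definition beauville_Sigma :: "('a, 'b) monoid_scheme \<Rightarrow> 'a \<Rightarrow> 'a \<Rightarrow> 'a set" where
  "beauville_Sigma G x y =
     (\<Union>i\<in>{1..order G}. \<Union>g\<in>carrier G.
        {conjugate G (x [^]\<^bsub>G\<^esub> i) g,
         conjugate G (y [^]\<^bsub>G\<^esub> i) g,
         conjugate G ((x \<otimes>\<^bsub>G\<^esub> y) [^]\<^bsub>G\<^esub> i) g})"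

definition generating_pair :: "('a, 'b) monoid_scheme \<Rightarrow> 'a \<Rightarrow> 'a \<Rightarrow> bool" where
  "generating_pair G x y \<longleftrightarrow>
     x \<in> carrier G \<and> y \<in> carrier G \<and> generate G {x, y} = carrier G"

definition two_generated :: "('a, 'b) monoid_scheme \<Rightarrow> bool" where
  "two_generated G \<longleftrightarrow> (\<exists>x y. generating_pair G x y)"

definition beauville_structure ::
    "('a, 'b) monoid_scheme \<Rightarrow> 'a \<Rightarrow> 'a \<Rightarrow> 'a \<Rightarrow> 'a \<Rightarrow> bool" where
  "beauville_structure G x1 y1 x2 y2 \<longleftrightarrow>
     generating_pair G x1 y1 \<and> generating_pair G x2 y2 \<and>
     beauville_Sigma G x1 y1 \<inter> beauville_Sigma G x2 y2 = {\<one>\<^bsub>G\<^esub>}"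

definition beauville_group :: "('a, 'b) monoid_scheme \<Rightarrow> bool" where
  "beauville_group G \<longleftrightarrow>
     group G \<and> finite (carrier G) \<and> (\<exists>x1 y1 x2 y2. beauville_structure G x1 y1 x2 y2)"

text \<open>
  Every finite group is isomorphic to one whose carrier is a set of natural numbers, so
  isomorphism classes of finite groups are counted among groups of type \<^typ>\<open>nat monoid\<close>.
  There are infinitely many such groups of a given order \<open>n > 0\<close>, but only finitely many
  classes, so the cardinality below is the true number of classes.  For \<open>n = 0\<close> the
  convention \<open>order G = 0\<close> for infinite carriers makes the notion meaningless.
\<close>

definition groups_of_order :: "nat \<Rightarrow> nat monoid set" where
  "groups_of_order n = {G. group G \<and> order G = n}"

definition num_iso_classes :: "nat monoid set \<Rightarrow> nat" where
  "num_iso_classes S = card (S // {(G, H). G \<in> S \<and> H \<in> S \<and> G \<cong> H})"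

definition beauville_proportion :: "nat \<Rightarrow> real" where
  "beauville_proportion n =
     real (num_iso_classes {G \<in> groups_of_order n. beauville_group G}) /
     real (num_iso_classes {G \<in> groups_of_order n. two_generated G})"

end

theory Submission imports Defs "HOL-Algebra.Group_Action" "HOL-Algebra.Multiplicative_Group" "HOL-Number_Theory.Number_Theory"
begin

text \<open>
  Let \<open>p \<ge> 7\<close>, so that groups of order \<open>p ^ 6\<close> are regular \<open>p\<close>-groups. In a Beauville group \<open>G\<close> of exponent
  \<open>p ^ (e + 1)\<close> the group of \<open>p ^ e\<close>-th powers cannot have order \<open>p\<close>, since otherwise both generating
  pairs would contain an element with a power generating it. Regularity then leaves \<open>e \<le> 2\<close>.
  For \<open>e = 1\<close> and \<open>e = 2\<close> the group is determined by a presentation with a few integer parameters,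
  and changes of generators bring these to at most \<open>15 p\<close> normal forms.

  For \<open>e = 0\<close> choose a homomorphism \<open>\<chi>\<close> from \<open>G\<close> onto the integers modulo \<open>p\<close> and a central
  \<open>t \<noteq> 1\<close> in its kernel, and twist the product to \<open>g * h * t ^ carry (\<chi> g) (\<chi> h)\<close>. All nontrivial
  \<open>p\<close>-th powers of the twisted group generate \<open>\<langle>t\<rangle>\<close>, so it is 2-generated but not a Beauville group, and its
  isomorphism class determines that of \<open>G\<close>. Finally there are at least \<open>p\<close> classes of 2-generated groups that
  are not Beauville groups: a one-parameter family with cyclic \<open>p\<^sup>2\<close>-th powers. So with \<open>N\<close> such classes
  there are at most \<open>N + 15 p \<le> 16 N\<close> classes of Beauville groups, and the proportion is at most \<open>16 / 17\<close>.
\<close>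

text \<open>In a group of exponent \<open>p\<close> the power maps carry no information, so these
  groups are compared with non-Beauville groups instead of being listed. All others are bounded by
  lists of length linear in \<open>p\<close>.

  The bound on \<open>e\<close>: by regularity, passing from \<open>p ^ (i + 1)\<close>-th to
  \<open>p ^ i\<close>-th powers multiplies the order by at least the order of the group of
  \<open>p ^ e\<close>-th powers, so \<open>p ^ (2 * (e + 1)) \<le> p ^ 6\<close>. For
  \<open>e = 1\<close> the same estimate leaves \<open>p ^ 2\<close> or \<open>p ^ 3\<close> many
  \<open>p\<close>-th powers. The number 15 is 6 and 7 one-parameter families in these two cases,
  and 2 for \<open>e = 2\<close>.

  A presentation determines the group for this reason: if two groups of order \<open>p ^ 6\<close>
  satisfy the same relations, then so does the subgroup of their product generated by the pairs of
  generators. The relations bound its order by \<open>p ^ 6\<close>, so both projections are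
  bijective.

  Regularity comes from the Hall--Petrescu formula, obtained through polynomial sequences in the
  lower central series. Words are computed in the type class \<open>grp\<close>, with subgroups as
  sets; Cayley's theorem moves the groups of type \<open>nat monoid\<close> there.\<close>

class grp = monoid_mult + inverse +
  assumes grp_left_inverse [simp]: "inverse a * a = 1"
begin

lemma grp_left_inverse2 [simp]: "inverse a * (a * b) = b"
  by (simp flip: mult.assoc)

lemma grp_right_inverse [simp]: "a * inverse a = 1"
proof -
  have "a * inverse a = inverse (inverse a) * inverse a * (a * inverse a)"
    by simp
  also have "\<dots> = inverse (inverse a) * (inverse a * a) * inverse a"
    unfolding mult.assoc ..
  finally show ?thesis by simp
qed

lemma grp_right_inverse2 [simp]: "a * (inverse a * b) = b"
  by (simp flip: mult.assoc)

lemma grp_left_cancel [simp]: "a * b = a * c \<longleftrightarrow> b = c"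
  by (metis grp_left_inverse2)

lemma grp_right_cancel [simp]: "b * a = c * a \<longleftrightarrow> b = c"
  by (metis mult.assoc grp_right_inverse mult_1_right)

lemma grp_inverse_unique: "a * b = 1 \<Longrightarrow> inverse a = b"
  by (metis grp_left_inverse2 mult_1_right)

lemma grp_inverse_inverse [simp]: "inverse (inverse a) = a"
  by (rule grp_inverse_unique) simp

lemma grp_inverse_one [simp]: "inverse 1 = 1"
  by (rule grp_inverse_unique) simp

lemma grp_inverse_mult [simp]: "inverse (a * b) = inverse b * inverse a"
  by (rule grp_inverse_unique) (simp add: mult.assoc)

lemma grp_inverse_eq_iff [simp]: "inverse a = inverse b \<longleftrightarrow> a = b"
  by (metis grp_inverse_inverse)

lemma grp_eq_1_right [simp]: "a * b = a \<longleftrightarrow> b = 1"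
  by (metis grp_left_cancel mult_1_right)

lemma grp_eq_1_right' [simp]: "a = a * b \<longleftrightarrow> b = 1"
  unfolding eq_commute[of a "a * b"] by simp

end

lemma grp_power_inverse: "inverse (a :: 'a :: grp) ^ n = inverse (a ^ n)"
proof (induction n)
  case (Suc n)
  have "inverse a ^ Suc n = inverse a * inverse a ^ n" by simp
  also have "\<dots> = inverse (a ^ n * a)" using Suc by simp
  finally show ?case by (simp add: power_commutes)
qed simp

section \<open>Conjugates and commutators\<close>

definition cj :: "'a::grp \<Rightarrow> 'a \<Rightarrow> 'a" where
  "cj g a = inverse g * a * g"

definition cm :: "'a::grp \<Rightarrow> 'a \<Rightarrow> 'a" where
  "cm a b = inverse a * inverse b * a * b"

lemma cj_mult [simp]: "cj g (a * b) = cj g a * cj g b"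
  by (simp add: cj_def mult.assoc)

lemma cj_one [simp]: "cj g 1 = 1" "cj 1 a = a"
  by (simp_all add: cj_def)

lemma cj_inverse: "cj g (inverse a) = inverse (cj g a)"
  by (simp add: cj_def mult.assoc)

lemma cj_power: "cj g (a ^ n) = cj g a ^ n"
  by (induction n) simp_all

text \<open>Conjugation is a right action, hence the reversed order of the factors.\<close>

lemma cj_cj: "cj g (cj h a) = cj (h * g) a"
  by (simp add: cj_def mult.assoc)

lemma cj_cm: "cj g (cm a b) = cm (cj g a) (cj g b)"
  by (simp add: cj_def cm_def mult.assoc)

lemma cj_eq_cm: "cj g a = a * cm a g"
  by (simp add: cj_def cm_def mult.assoc)

lemma cj_inject [simp]: "cj g a = cj g b \<longleftrightarrow> a = b"
  by (simp add: cj_def mult.assoc)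

lemma cm_one [simp]: "cm 1 a = 1" "cm a 1 = 1" "cm a a = 1"
  by (simp_all add: cm_def mult.assoc)

lemma cm_eq_one_iff: "cm a b = 1 \<longleftrightarrow> a * b = b * a"
proof
  assume "cm a b = 1"
  then have "b * a * cm a b = b * a" by simp
  then show "a * b = b * a" by (simp add: cm_def mult.assoc)
qed (simp add: cm_def mult.assoc)

lemma cj_eq_iff_commute: "cj g a = a \<longleftrightarrow> a * g = g * a"
  by (simp add: cj_eq_cm cm_eq_one_iff)

lemma inverse_cm: "inverse (cm a b) = cm b a"
  by (simp add: cm_def mult.assoc)

lemma mult_eq_cm: "a * b = b * a * cm a b"
  by (simp add: cm_def mult.assoc)

lemma cm_mult_left: "cm (a * b) c = cj b (cm a c) * cm b c"
  by (simp add: cm_def cj_def mult.assoc)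

lemma cm_mult_right: "cm a (b * c) = cm a c * cj c (cm a b)"
  by (simp add: cm_def cj_def mult.assoc)

section \<open>Subgroups, generated subgroups and normal subgroups as sets\<close>

definition sgp :: "'a::grp set \<Rightarrow> bool" where
  "sgp H \<longleftrightarrow> 1 \<in> H \<and> (\<forall>a\<in>H. \<forall>b\<in>H. a * b \<in> H) \<and> (\<forall>a\<in>H. inverse a \<in> H)"

lemma sgpI:
  "1 \<in> H \<Longrightarrow> (\<And>a b. a \<in> H \<Longrightarrow> b \<in> H \<Longrightarrow> a * b \<in> H) \<Longrightarrow> (\<And>a. a \<in> H \<Longrightarrow> inverse a \<in> H) \<Longrightarrow> sgp H"
  by (auto simp: sgp_def)

lemma sgp_one: "sgp H \<Longrightarrow> 1 \<in> H"
  and sgp_mult: "sgp H \<Longrightarrow> a \<in> H \<Longrightarrow> b \<in> H \<Longrightarrow> a * b \<in> H"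
  and sgp_inverse: "sgp H \<Longrightarrow> a \<in> H \<Longrightarrow> inverse a \<in> H"
  by (auto simp: sgp_def)

lemma sgp_power: "sgp H \<Longrightarrow> a \<in> H \<Longrightarrow> a ^ n \<in> H"
  by (induction n) (auto simp: sgp_one sgp_mult)

lemma sgp_cj: "sgp H \<Longrightarrow> g \<in> H \<Longrightarrow> a \<in> H \<Longrightarrow> cj g a \<in> H"
  by (simp add: cj_def sgp_mult sgp_inverse)

lemma sgp_cm: "sgp H \<Longrightarrow> a \<in> H \<Longrightarrow> b \<in> H \<Longrightarrow> cm a b \<in> H"
  by (simp add: cm_def sgp_mult sgp_inverse)

lemmas sgp_closed = sgp_one sgp_mult sgp_inverse sgp_power sgp_cj sgp_cm

lemma sgp_mult_left_iff: "sgp H \<Longrightarrow> a \<in> H \<Longrightarrow> a * b \<in> H \<longleftrightarrow> b \<in> H"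
  using sgp_mult[of H "inverse a" "a * b"] by (auto simp: sgp_inverse sgp_mult)

lemma sgp_mult_right_iff: "sgp H \<Longrightarrow> a \<in> H \<Longrightarrow> b * a \<in> H \<longleftrightarrow> b \<in> H"
  using sgp_mult[of H "b * a" "inverse a"] by (auto simp: sgp_inverse sgp_mult mult.assoc)

lemma sgp_trivial [simp]: "sgp {1}"
  by (simp add: sgp_def)

inductive_set gen :: "'a::grp set \<Rightarrow> 'a set" for A where
  gen_one: "1 \<in> gen A"
| gen_base: "a \<in> A \<Longrightarrow> a \<in> gen A"
| gen_mult: "a \<in> gen A \<Longrightarrow> b \<in> gen A \<Longrightarrow> a * b \<in> gen A"
| gen_inverse: "a \<in> gen A \<Longrightarrow> inverse a \<in> gen A"

lemma sgp_gen [simp]: "sgp (gen A)"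
  by (rule sgpI) (auto intro: gen.intros)

lemma gen_subset: "A \<subseteq> H \<Longrightarrow> sgp H \<Longrightarrow> gen A \<subseteq> H"
proof
  fix x assume "A \<subseteq> H" "sgp H" "x \<in> gen A"
  from this(3,1,2) show "x \<in> H"
    by (induction) (auto simp: sgp_closed)
qed

lemma gen_superset: "A \<subseteq> gen A"
  by (auto intro: gen_base)

lemma gen_mono: "A \<subseteq> B \<Longrightarrow> gen A \<subseteq> gen B"
  by (meson gen_subset gen_superset order_trans sgp_gen)

lemma gen_sgp: "sgp H \<Longrightarrow> gen H = H"
  by (simp add: gen_subset gen_superset subset_antisym)

lemma gen_cj_closed:
  assumes "\<And>a. a \<in> A \<Longrightarrow> cj g a \<in> gen A" "x \<in> gen A"
  shows "cj g x \<in> gen A"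
  using assms(2)
  by induction (auto simp: assms(1) cj_inverse intro: gen.intros)

definition nrm :: "'a::grp set \<Rightarrow> 'a set \<Rightarrow> bool" where
  "nrm N H \<longleftrightarrow> sgp N \<and> N \<subseteq> H \<and> (\<forall>h\<in>H. \<forall>n\<in>N. cj h n \<in> N)"

lemma nrm_sgp: "nrm N H \<Longrightarrow> sgp N" and nrm_subset: "nrm N H \<Longrightarrow> N \<subseteq> H"
  and nrm_cj: "nrm N H \<Longrightarrow> h \<in> H \<Longrightarrow> n \<in> N \<Longrightarrow> cj h n \<in> N"
  by (auto simp: nrm_def)

lemma nrm_cm: "nrm N H \<Longrightarrow> n \<in> N \<Longrightarrow> h \<in> H \<Longrightarrow> cm n h \<in> N"
  by (metis cj_eq_cm nrm_cj nrm_sgp sgp_mult_left_iff)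

lemma nrm_cm': "nrm N H \<Longrightarrow> n \<in> N \<Longrightarrow> h \<in> H \<Longrightarrow> cm h n \<in> N"
  by (metis inverse_cm nrm_cm nrm_sgp sgp_inverse)

lemma nrm_self: "sgp H \<Longrightarrow> nrm H H"
  by (auto simp: nrm_def sgp_closed)

subsection \<open>Polynomial sequences and the Hall--Petrescu formula\<close>

text \<open>The model is the lower central series with its first term repeated at index 0, for which
  commutators add the indices.\<close>

locale filtration =
  fixes F :: "nat \<Rightarrow> 'a::grp set"
  assumes F_sgp: "sgp (F i)"
    and F_Suc: "F (Suc i) \<subseteq> F i"
    and F_cm: "a \<in> F i \<Longrightarrow> b \<in> F j \<Longrightarrow> cm a b \<in> F (i + j)"

lemma (in filtration) F_antimono: "i \<le> j \<Longrightarrow> F j \<subseteq> F i"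
  using F_Suc by (rule lift_Suc_antimono_le)

definition seqD :: "(nat \<Rightarrow> 'a::grp) \<Rightarrow> nat \<Rightarrow> 'a" where
  "seqD g n = inverse (g n) * g (Suc n)"

context filtration
begin

text \<open>All derivatives of \<open>g\<close> of order \<open>k \<le> d\<close> take values in \<open>F (i + k)\<close>.  Induction on
  \<open>d\<close> lets every closure property be derived from the others one derivative lower.\<close>

primrec pd :: "nat \<Rightarrow> nat \<Rightarrow> (nat \<Rightarrow> 'a) \<Rightarrow> bool" where
  "pd 0 i g \<longleftrightarrow> (\<forall>n. g n \<in> F i)"
| "pd (Suc d) i g \<longleftrightarrow> (\<forall>n. g n \<in> F i) \<and> pd d (Suc i) (seqD g)"

lemma pd_less: "pd (Suc d) i g \<Longrightarrow> pd d i g"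
  by (induction d arbitrary: i g) auto

lemma pd_antimono: "i \<le> j \<Longrightarrow> pd d j g \<Longrightarrow> pd d i g"
proof (induction d arbitrary: i j g)
  case (Suc d)
  then show ?case using F_antimono[of i j] by (auto intro: Suc.IH[of "Suc i" "Suc j"])
qed (use F_antimono in auto)

text \<open>The Lazard--Leibman theorem that polynomial sequences form a group. The three properties
  are proved together, since the derivative of a product or an inverse involves a commutator and the
  derivative of a commutator involves products.\<close>

lemma pd_closed:
  shows pd_mult: "pd d i f \<Longrightarrow> pd d i g \<Longrightarrow> pd d i (\<lambda>n. f n * g n)"
    and pd_inverse: "pd d i f \<Longrightarrow> pd d i (\<lambda>n. inverse (f n))"
    and pd_cm: "pd d i f \<Longrightarrow> pd d j g \<Longrightarrow> pd d (i + j) (\<lambda>n. cm (f n) (g n))"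
proof (induction d arbitrary: i j f g)
  case 0
  { case 1 then show ?case using F_sgp by (auto intro: sgp_mult) }
  { case 2 then show ?case using F_sgp by (auto intro: sgp_inverse) }
  { case 3 then show ?case using F_cm by auto }
next
  case (Suc d)
  have low: "pd d i f" if "pd (Suc d) i f" for i f using pd_less[OF that] .
  have der: "pd d (Suc i) (seqD f)" if "pd (Suc d) i f" for i f using that by simp
  { case 1
    note fg = low[OF 1(1)] low[OF 1(2)] der[OF 1(1)] der[OF 1(2)]
    have "seqD (\<lambda>n. f n * g n) = (\<lambda>n. seqD f n * cm (seqD f n) (g n) * seqD g n)"
      by (auto simp: seqD_def cm_def mult.assoc)
    moreover have "pd d (Suc i) (\<lambda>n. cm (seqD f n) (g n))"
      by (rule pd_antimono[OF _ Suc(3)[OF fg(3) fg(2)]]) simp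
    ultimately have "pd d (Suc i) (seqD (\<lambda>n. f n * g n))"
      using Suc(1) fg(3,4) by simp
    then show ?case using 1 F_sgp by (auto intro: sgp_mult) }
  { case 2
    note f = low[OF 2] der[OF 2]
    have "seqD (\<lambda>n. inverse (f n)) =
      (\<lambda>n. inverse (seqD f n) * cm (inverse (seqD f n)) (inverse (f n)))"
      by (auto simp: seqD_def cm_def mult.assoc)
    moreover have "pd d (Suc i) (\<lambda>n. cm (inverse (seqD f n)) (inverse (f n)))"
      by (rule pd_antimono[OF _ Suc(3)[OF Suc(2)[OF f(2)] Suc(2)[OF f(1)]]]) simp
    ultimately have "pd d (Suc i) (seqD (\<lambda>n. inverse (f n)))"
      using Suc(1)[OF Suc(2)[OF f(2)]] by simp
    then show ?case using 2 F_sgp by (auto intro: sgp_inverse) }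
  { case 3
    let ?a = "seqD f" and ?b = "seqD g" and ?u = "\<lambda>n. cm (f n) (g n)" and ?m = "Suc (i + j)"
    let ?s = "\<lambda>n. cm (f n * ?a n) (?b n)" and ?r = "\<lambda>n. cm (?u n) (?a n) * cm (?a n) (g n)"
    note fg = low[OF 3(1)] low[OF 3(2)] der[OF 3(1)] der[OF 3(2)]
    have u: "pd d (i + j) ?u" by (rule Suc(3)[OF fg(1,2)])
    have fa: "pd d i (\<lambda>n. f n * ?a n)"
      by (rule Suc(1)[OF fg(1) pd_antimono[OF _ fg(3)]]) simp
    have s: "pd d ?m ?s"
      by (rule pd_antimono[OF _ Suc(3)[OF fa fg(4)]]) simp
    have ua: "pd d ?m (\<lambda>n. cm (?u n) (?a n))"
      by (rule pd_antimono[OF _ Suc(3)[OF u fg(3)]]) simp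
    have ag: "pd d ?m (\<lambda>n. cm (?a n) (g n))"
      by (rule pd_antimono[OF _ Suc(3)[OF fg(3) fg(2)]]) simp
    have r: "pd d ?m ?r" by (rule Suc(1)[OF ua ag])
    have su: "pd d ?m (\<lambda>n. cm (?s n) (?u n))"
      by (rule pd_antimono[OF _ Suc(3)[OF s u]]) simp
    have ub: "pd d ?m (\<lambda>n. cm (?u n) (?b n))"
      by (rule pd_antimono[OF _ Suc(3)[OF u fg(4)]]) simp
    have rb: "pd d ?m (\<lambda>n. cm (?r n) (?b n))"
      by (rule pd_antimono[OF _ Suc(3)[OF r fg(4)]]) simp
    \<comment> \<open>Expanding \<open>cm (f n * a) (g n * b)\<close>, where \<open>a\<close> and
      \<open>b\<close> are the derivatives, and moving the inverse of \<open>?u n\<close> across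
      gives exactly these five factors, all of filtration degree at least
      \<open>i + j + 1\<close>.\<close>
    have "pd d ?m (\<lambda>n. ?s n * cm (?s n) (?u n) * cm (?u n) (?b n) * ?r n * cm (?r n) (?b n))"
      by (intro Suc(1) s su ub r rb)
    also have "(\<lambda>n. ?s n * cm (?s n) (?u n) * cm (?u n) (?b n) * ?r n * cm (?r n) (?b n)) = seqD ?u"
      by (auto simp: seqD_def cm_def mult.assoc)
    finally show ?case using 3 F_cm by auto }
qed

lemma pd_one: "pd d i (\<lambda>_. 1)"
proof (induction d arbitrary: i)
  case (Suc d)
  have "seqD (\<lambda>_. 1 :: 'a) = (\<lambda>_. 1)" by (auto simp: seqD_def)
  with Suc show ?case by (simp add: sgp_one F_sgp)
qed (simp add: sgp_one F_sgp)

text \<open>By Pascal's rule the derivative of \<open>c ^ (n choose k)\<close> is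
  \<open>c ^ (n choose (k - 1))\<close>: each derivative lowers \<open>k\<close> by one while the
  index of \<open>F\<close> rises by one.\<close>

lemma pd_binomial: "c \<in> F (i + k) \<Longrightarrow> pd d i (\<lambda>n. c ^ (n choose k))"
proof (induction d arbitrary: i k)
  case 0
  then show ?case using F_antimono[of i "i + k"] F_sgp by (auto intro: sgp_power)
next
  case (Suc d)
  have "c \<in> F i" using Suc.prems F_antimono[of i "i + k"] by auto
  then have v: "\<forall>n. c ^ (n choose k) \<in> F i" using F_sgp by (auto intro: sgp_power)
  show ?case
  proof (cases k)
    case 0
    then have "seqD (\<lambda>n. c ^ (n choose k)) = (\<lambda>_. 1)" by (auto simp: seqD_def)
    then show ?thesis using v pd_one by simp
  next
    case (Suc k')
    have "seqD (\<lambda>n. c ^ (n choose k)) = (\<lambda>n. c ^ (n choose k'))"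
    proof
      fix n
      have "c ^ (Suc n choose k) = c ^ (n choose k) * c ^ (n choose k')"
        by (simp add: Suc add.commute flip: power_add)
      then show "seqD (\<lambda>n. c ^ (n choose k)) n = c ^ (n choose k')"
        by (simp add: seqD_def)
    qed
    then show ?thesis using v Suc.IH[of "Suc i" k'] Suc.prems Suc by simp
  qed
qed

text \<open>If \<open>h\<close> is trivial before \<open>k\<close>, then its \<open>k\<close>-th
  derivative at 0 is \<open>h k\<close>.\<close>

lemma pd_vanishing_value:
  "pd k i h \<Longrightarrow> (\<And>n. n < k \<Longrightarrow> h n = 1) \<Longrightarrow> h k \<in> F (i + k)"
proof (induction k arbitrary: i h)
  case (Suc k)
  have "seqD h k \<in> F (Suc i + k)"
  proof (rule Suc.IH)
    show "pd k (Suc i) (seqD h)" using Suc.prems(1) by simp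
    show "seqD h n = 1" if "n < k" for n using that Suc.prems(2) by (simp add: seqD_def)
  qed
  moreover have "seqD h k = h (Suc k)" using Suc.prems(2)[of k] by (simp add: seqD_def)
  ultimately show ?case by simp
qed auto

text \<open>A Newton expansion of \<open>h\<close>: factors \<open>e ^ (n choose k)\<close> with
  \<open>e = h k\<close> in \<open>F k\<close> are split off one at a time, until the remainder is
  trivial up to index \<open>c\<close> and hence everywhere. At \<open>n = q\<close> each factor is
  a \<open>q\<close>-th power, because \<open>q\<close> divides the binomial coefficient.\<close>

lemma polynomial_power_value:
  assumes "F (Suc c) = {1}" and q: "\<And>k. 1 \<le> k \<Longrightarrow> k \<le> c \<Longrightarrow> q dvd (q choose k)"
    and "\<And>d. pd d 0 h" and "\<And>n. n < k \<Longrightarrow> h n = 1" and "1 \<le> k" "m \<le> k"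
  shows "h q \<in> gen {g ^ q |g. g \<in> F m}"
  using assms(3-6)
proof (induction "Suc c - k" arbitrary: h k)
  case 0
  have "h n = 1" for n
  proof (induction n rule: less_induct)
    case (less n)
    show ?case
    proof (cases "n < k")
      case False
      then have "Suc c \<le> n" using 0 by simp
      moreover have "h n \<in> F (0 + n)"
        by (rule pd_vanishing_value) (use 0 less in auto)
      ultimately show ?thesis using F_antimono[of "Suc c" n] assms(1) by auto
    qed (use 0 in auto)
  qed
  then show ?case by (simp add: gen_one)
next
  case (Suc x)
  define e where "e = h k"
  \<comment> \<open>Dividing by the \<open>k\<close>-th Newton term leaves a sequence that is
    trivial at \<open>k\<close> as well.\<close>
  define h' where "h' = (\<lambda>n. inverse e ^ (n choose k) * h n)"
  have e: "e \<in> F k"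
    using pd_vanishing_value[of k 0 h] Suc.prems by (simp add: e_def)
  have h': "h' q \<in> gen {g ^ q |g. g \<in> F m}"
  proof (rule Suc.hyps(1))
    show "pd d 0 h'" for d
      unfolding h'_def using e F_sgp Suc.prems(1)
      by (intro pd_mult pd_binomial) (auto intro: sgp_inverse)
    show "h' n = 1" if "n < Suc k" for n
      using that Suc.prems(2)[of n] by (cases "n = k") (auto simp: h'_def e_def binomial_eq_0)
  qed (use Suc in auto)
  have "q dvd (q choose k)"
    by (rule q) (use Suc.hyps(2) Suc.prems(3) in auto)
  then obtain l where l: "q choose k = l * q"
    by (auto simp: dvd_def mult.commute)
  have "e ^ l \<in> F m"
    using e F_antimono[of m k] Suc.prems(4) F_sgp by (auto intro: sgp_power)
  then have "(e ^ l) ^ q \<in> gen {g ^ q |g. g \<in> F m}"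
    by (auto intro: gen_base)
  then have "e ^ (q choose k) \<in> gen {g ^ q |g. g \<in> F m}"
    by (simp add: l power_mult)
  from gen_mult[OF this h']
  show ?case
    by (simp add: h'_def grp_power_inverse)
qed

text \<open>The defect \<open>inverse y ^ n * inverse x ^ n * (x * y) ^ n\<close> is polynomial and
  trivial at 0 and 1, so its Newton expansion starts in \<open>F 2\<close>.\<close>

lemma hall_petrescu:
  assumes "F (Suc c) = {1}" and "\<And>k. 1 \<le> k \<Longrightarrow> k \<le> c \<Longrightarrow> q dvd (q choose k)"
    and "x \<in> F 1" "y \<in> F 1"
  shows "\<exists>s \<in> gen {g ^ q |g. g \<in> F 2}. (x * y) ^ q = x ^ q * y ^ q * s"
proof -
  have lin: "pd d 0 (\<lambda>n. a ^ n)" if "a \<in> F 1" for a d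
    using pd_binomial[of a 0 1 d] that by simp
  define h where "h = (\<lambda>n. inverse y ^ n * inverse x ^ n * (x * y) ^ n)"
  have "pd d 0 h" for d
    unfolding h_def using assms(3,4) F_sgp
    by (intro pd_mult lin) (auto intro: sgp_mult sgp_inverse)
  moreover have "h n = 1" if "n < 2" for n
    using that by (cases n) (auto simp: h_def mult.assoc less_Suc_eq)
  ultimately have "h q \<in> gen {g ^ q |g. g \<in> F 2}"
    using polynomial_power_value[OF assms(1,2), where k = 2 and m = 2] by simp
  moreover have "(x * y) ^ q = x ^ q * y ^ q * h q"
    by (simp add: h_def grp_power_inverse mult.assoc)
  ultimately show ?thesis by blast
qed

text \<open>The quadratic Newton coefficient of the same defect is its value at 2, namely
  \<open>cj y (cm y x)\<close>; splitting it off leaves an error from \<open>F 3\<close>. This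
  serves groups in which \<open>gam H 3\<close>, but not \<open>gam H 2\<close>, has exponent
  \<open>p\<close>.\<close>

lemma hall_petrescu_2:
  assumes "F (Suc c) = {1}" and "\<And>k. 1 \<le> k \<Longrightarrow> k \<le> c \<Longrightarrow> q dvd (q choose k)"
    and "x \<in> F 1" "y \<in> F 1"
  shows "\<exists>s \<in> gen {g ^ q |g. g \<in> F 3}.
    (x * y) ^ q = x ^ q * y ^ q * cj y (cm y x) ^ (q choose 2) * s"
proof -
  have lin: "pd d 0 (\<lambda>n. a ^ n)" if "a \<in> F 1" for a d
    using pd_binomial[of a 0 1 d] that by simp
  define e where "e = cj y (cm y x)"
  define h where "h = (\<lambda>n. inverse e ^ (n choose 2) * (inverse y ^ n * inverse x ^ n * (x * y) ^ n))"
  have "cm y x \<in> F 2" using F_cm[OF assms(4,3)] by (simp add: numeral_2_eq_2)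
  moreover have "cm (cm y x) y \<in> F 2"
    using F_cm[OF calculation assms(4)] F_Suc[of 2] by auto
  ultimately have "e \<in> F 2"
    using sgp_mult[OF F_sgp, of "cm y x" 2 "cm (cm y x) y"] by (simp add: e_def cj_eq_cm)
  then have e: "inverse e \<in> F (0 + 2)"
    using sgp_inverse[OF F_sgp, of e 2] by (simp only: add_0)
  have "pd d 0 h" for d
    unfolding h_def using assms(3,4) F_sgp
    by (intro pd_mult lin pd_binomial[OF e]) (auto intro: sgp_mult sgp_inverse)
  moreover have "h n = 1" if n: "n < 3" for n
  proof -
    consider "n = 0" | "n = 1" | "n = 2" using n by linarith
    then show ?thesis
      by cases (simp_all add: h_def e_def cj_def cm_def mult.assoc power2_eq_square binomial_eq_0)
  qed
  ultimately have "h q \<in> gen {g ^ q |g. g \<in> F 3}"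
    using polynomial_power_value[OF assms(1,2), where k = 3 and m = 3] by simp
  moreover have "(x * y) ^ q = x ^ q * y ^ q * e ^ (q choose 2) * h q"
    by (simp add: h_def grp_power_inverse mult.assoc)
  ultimately show ?thesis unfolding e_def by blast
qed

end

subsection \<open>The lower central series\<close>

text \<open>Indices 0 and 1 both give \<open>K\<close>, so that the series is a
  \<open>filtration\<close> indexed from 0.\<close>

fun gam :: "'a::grp set \<Rightarrow> nat \<Rightarrow> 'a set" where
  "gam K 0 = K"
| "gam K (Suc 0) = K"
| "gam K (Suc (Suc n)) = gen {cm a b |a b. a \<in> gam K (Suc n) \<and> b \<in> K}"

lemma gam_normal: "sgp K \<Longrightarrow> nrm (gam K n) K"
proof (induction K n rule: gam.induct)
  case (3 K n)
  have "cj h (cm a b) \<in> gam K (Suc (Suc n))" if "a \<in> gam K (Suc n)" "b \<in> K" "h \<in> K" for a b h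
    unfolding cj_cm gam.simps(3)
    by (rule gen_base) (use that 3 in \<open>blast intro: nrm_cj sgp_cj\<close>)
  then have "cj h x \<in> gam K (Suc (Suc n))" if "x \<in> gam K (Suc (Suc n))" "h \<in> K" for x h
    using that gen_cj_closed[of "{cm a b |a b. a \<in> gam K (Suc n) \<and> b \<in> K}" h x] by auto
  moreover have "gam K (Suc (Suc n)) \<subseteq> K"
    unfolding gam.simps(3)
    by (rule gen_subset) (use 3 nrm_subset[of "gam K (Suc n)" K] in \<open>auto intro!: sgp_cm\<close>)
  ultimately show ?case by (auto simp: nrm_def)
qed (auto intro: nrm_self)

lemma gam_cm_self: "sgp K \<Longrightarrow> a \<in> gam K n \<Longrightarrow> b \<in> K \<Longrightarrow> cm a b \<in> gam K (Suc n)"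
  by (cases n) (auto intro: sgp_cm gen_base)

lemma gam_Suc: "sgp K \<Longrightarrow> gam K (Suc n) \<subseteq> gam K n"
proof (cases n)
  case (Suc m)
  assume K: "sgp K"
  have "cm a b \<in> gam K n" if "a \<in> gam K n" "b \<in> K" for a b
    using nrm_cm[OF gam_normal[OF K] that] .
  then have "gen {cm a b |a b. a \<in> gam K n \<and> b \<in> K} \<subseteq> gam K n"
    by (intro gen_subset nrm_sgp[OF gam_normal[OF K]]) auto
  then show ?thesis using Suc by simp
qed auto

lemma hall_witt:
  "cj y (cm (cm x (inverse y)) z) * cj z (cm (cm y (inverse z)) x) * cj x (cm (cm z (inverse x)) y) = 1"
  by (simp add: cj_def cm_def mult.assoc)

lemma nrm_cj_iff:
  assumes "nrm N K" "sgp K" "h \<in> K"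
  shows "cj h n \<in> N \<longleftrightarrow> n \<in> N"
proof
  assume "cj h n \<in> N"
  then have "cj (inverse h) (cj h n) \<in> N"
    by (rule nrm_cj[OF assms(1) sgp_inverse[OF assms(2,3)]])
  then show "n \<in> N" by (simp add: cj_cj)
qed (use assms nrm_cj in blast)

text \<open>Induction on \<open>j\<close> by the three subgroups argument: \<open>hall_witt\<close>
  trades a commutator with \<open>cm y z\<close> for two others in which \<open>y\<close> comes from
  an earlier term of the series.\<close>

lemma gam_cm: "sgp K \<Longrightarrow> a \<in> gam K i \<Longrightarrow> b \<in> gam K j \<Longrightarrow> cm a b \<in> gam K (i + j)"
proof (induction j arbitrary: a b i)
  case 0
  then show ?case using nrm_cm[OF gam_normal] by simp
next
  case (Suc j)
  note K = Suc.prems(1)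
  show ?case
  proof (cases j)
    case 0
    then show ?thesis using gam_cm_self[OF K] Suc.prems by simp
  next
    case (Suc j')
    let ?N = "gam K (i + Suc j)"
    have N: "nrm ?N K" by (rule gam_normal[OF K])
    have aK: "a \<in> K" using Suc.prems nrm_subset[OF gam_normal[OF K]] by auto
    have "b \<in> gen {cm y z |y z. y \<in> gam K j \<and> z \<in> K}"
      using Suc.prems(3) Suc by simp
    then have "b \<in> K \<and> cm a b \<in> ?N"
    proof (induction)
      case gen_one
      then show ?case using N K by (simp add: sgp_one nrm_sgp)
    next
      case (gen_base b)
      then obtain y z where b: "b = cm y z" and y: "y \<in> gam K j" and z: "z \<in> K" by auto
      have yK: "y \<in> K" using y nrm_subset[OF gam_normal[OF K]] by auto
      have "cm a (inverse y) \<in> gam K (i + j)"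
        using Suc.IH[OF K Suc.prems(2)] y by (simp add: sgp_inverse nrm_sgp[OF gam_normal[OF K]])
      then have 1: "cm (cm a (inverse y)) (inverse z) \<in> ?N"
        using gam_cm_self[OF K] sgp_inverse[OF K z] by simp
      have "cm (inverse a) (inverse z) \<in> gam K (Suc i)"
        using gam_cm_self[OF K] Suc.prems(2) K z by (simp add: sgp_inverse nrm_sgp[OF gam_normal])
      then have "cm (inverse z) (inverse a) \<in> gam K (Suc i)"
        using K by (metis inverse_cm sgp_inverse nrm_sgp gam_normal)
      then have 2: "cm (cm (inverse z) (inverse a)) y \<in> ?N"
        using Suc.IH[OF K _ y, of _ "Suc i"] by simp
      \<comment> \<open>The outer two of the three Hall--Witt factors lie in \<open>?N\<close>,
        hence so does the middle one, a conjugate of \<open>cm (cm y z) a\<close>.\<close>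
      have "cj y (cm (cm a (inverse y)) (inverse z)) *
          (cj (inverse z) (cm (cm y z) a) * cj a (cm (cm (inverse z) (inverse a)) y)) \<in> ?N"
        using hall_witt[of y a "inverse z"] sgp_one[OF nrm_sgp[OF N]] by (simp add: mult.assoc)
      then have "cm (cm y z) a \<in> ?N"
        using N K aK yK z 1 2
        by (simp add: sgp_mult_left_iff sgp_mult_right_iff nrm_sgp nrm_cj nrm_cj_iff sgp_inverse)
      then have "cm a b \<in> ?N"
        unfolding b using N by (metis inverse_cm sgp_inverse nrm_sgp)
      then show ?case using b K yK z by (simp add: sgp_cm)
    next
      case (gen_mult b c)
      then have "cm a c * cj c (cm a b) \<in> ?N"
        by (intro sgp_mult[OF nrm_sgp[OF N]] nrm_cj[OF N]) auto
      then show ?case using gen_mult K by (auto simp: cm_mult_right sgp_mult)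
    next
      case (gen_inverse b)
      have "cm a (inverse b) = cj (inverse b) (inverse (cm a b))"
        by (simp add: cm_def cj_def mult.assoc)
      then show ?case using gen_inverse N K by (simp add: nrm_cj nrm_sgp sgp_inverse)
    qed
    then show ?thesis ..
  qed
qed

lemma gam_filtration: "sgp K \<Longrightarrow> filtration (gam K)"
  by unfold_locales (use gam_Suc gam_cm gam_normal nrm_sgp in blast)+

text \<open>From \<open>k * (q choose k) = q * ((q - 1) choose (k - 1))\<close> with
  \<open>q = p ^ e\<close> and \<open>k\<close> prime to \<open>p\<close>.\<close>

lemma dvd_binomial_prime_power:
  fixes p :: nat
  assumes "prime p" "1 \<le> k" "k < p"
  shows "p ^ e dvd (p ^ e choose k)"
proof -
  obtain k' where k: "k = Suc k'" using assms(2) by (cases k) auto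
  obtain q where q: "p ^ e = Suc q" using assms(1) by (metis not0_implies_Suc power_not_zero not_prime_0)
  have "k * (p ^ e choose k) = p ^ e * (q choose k')"
    unfolding k q by (rule Suc_times_binomial)
  moreover have "coprime (p ^ e) k"
    using assms by (simp add: prime_imp_coprime nat_dvd_not_less)
  ultimately show ?thesis by (metis coprime_dvd_mult_right_iff dvd_triv_left)
qed

text \<open>The bound \<open>c < p\<close> on the class makes all binomial coefficients of the
  Newton expansion divisible by \<open>p ^ e\<close>.\<close>

theorem hall_petrescu_gam:
  fixes K :: "'a::grp set"
  assumes "sgp K" "gam K (Suc c) = {1}" "prime p" "c < p" "x \<in> K" "y \<in> K"
  shows "\<exists>s \<in> gen {g ^ (p ^ e) |g. g \<in> gam K 2}. (x * y) ^ (p ^ e) = x ^ (p ^ e) * y ^ (p ^ e) * s"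
  by (rule filtration.hall_petrescu[OF gam_filtration[OF assms(1)] assms(2)])
     (use assms in \<open>auto intro: dvd_binomial_prime_power\<close>)

theorem hall_petrescu_gam_2:
  fixes K :: "'a::grp set"
  assumes "sgp K" "gam K (Suc c) = {1}" "prime p" "c < p" "x \<in> K" "y \<in> K"
  shows "\<exists>s \<in> gen {g ^ (p ^ e) |g. g \<in> gam K 3}.
    (x * y) ^ (p ^ e) = x ^ (p ^ e) * y ^ (p ^ e) * cj y (cm y x) ^ (p ^ e choose 2) * s"
  by (rule filtration.hall_petrescu_2[OF gam_filtration[OF assms(1)] assms(2)])
     (use assms in \<open>auto intro: dvd_binomial_prime_power\<close>)

subsection \<open>Finite p-groups\<close>

text \<open>The class equation: were 1 the only central element, every conjugacy class except that
  of 1 would have size divisible by \<open>p\<close>, making \<open>p ^ k\<close> congruent to 1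
  modulo \<open>p\<close>.\<close>

lemma (in group) p_group_center:
  assumes "prime p" and ord: "order G = p ^ k" and "k > 0"
  shows "\<exists>z\<in>carrier G. z \<noteq> \<one> \<and> (\<forall>g\<in>carrier G. g \<otimes> z = z \<otimes> g)"
proof (rule ccontr)
  assume neg: "\<not> ?thesis"
  let ?f = "\<lambda>g. \<lambda>h\<in>carrier G. g \<otimes> h \<otimes> inv g"
  interpret A: group_action G "carrier G" ?f by (rule action_by_conjugation)
  have fin: "finite (carrier G)"
    using assms(1) ord order_gt_0_iff_finite prime_gt_0_nat[of p] by simp
  let ?O = "orbits G (carrier G) ?f"
  have cov: "\<Union> ?O = carrier G" by (rule A.orbits_coverture)
  have fO: "finite ?O" unfolding orbits_def using fin by simp
  have one: "orbit G ?f \<one> = {\<one>}"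
  proof -
    have "?f g \<one> = \<one>" if "g \<in> carrier G" for g using that by simp
    then show ?thesis unfolding orbit_def by (auto intro!: exI[of _ \<one>])
  qed
  have p: "p dvd card X" if X: "X \<in> ?O" "X \<noteq> {\<one>}" for X
  proof -
    obtain x where x: "x \<in> carrier G" "X = orbit G ?f x" using X by (auto simp: orbits_def)
    have "card X * card (stabilizer G ?f x) = p ^ k"
      using A.orbit_stabilizer_theorem[OF x(1)] by (simp only: x(2) ord)
    then have "card X dvd p ^ k" by (rule dvdI[OF sym])
    then obtain i where i: "card X = p ^ i"
      by (auto simp: divides_primepow_nat[OF assms(1)])
    have "i \<noteq> 0"
    proof
      assume "i = 0"
      then obtain y where "X = {y}" using i by (auto simp: card_Suc_eq)
      moreover have "x \<in> X" unfolding x(2) by (rule A.orbit_refl[OF x(1)])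
      ultimately have "X = {x}" by simp
      have "g \<otimes> x = x \<otimes> g" if "g \<in> carrier G" for g
      proof -
        have "g \<otimes> x \<otimes> inv g \<in> X" using that x by (auto simp: orbit_def)
        then have "g \<otimes> x \<otimes> inv g = x" using \<open>X = {x}\<close> by simp
        then show ?thesis using that x(1) inv_solve_right[of x "g \<otimes> x" g] by simp
      qed
      then have "x = \<one>" using neg x by auto
      then show False using \<open>X = {x}\<close> X by simp
    qed
    then show ?thesis using i by simp
  qed
  have "order G = (\<Sum>X\<in>?O. card X)"
    using A.disjoint_sum[OF fin, of "\<lambda>_. 1 :: nat"] by (simp add: order_def)
  also have "\<dots> = card {\<one>} + (\<Sum>X\<in>?O - {{\<one>}}. card X)"
    by (rule sum.remove[OF fO]) (use one in \<open>auto simp: orbits_def\<close>)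
  finally have "p ^ k = 1 + (\<Sum>X\<in>?O - {{\<one>}}. card X)" using ord by simp
  moreover have "p dvd (\<Sum>X\<in>?O - {{\<one>}}. card X)" by (intro dvd_sum) (use p in auto)
  moreover have "p dvd p ^ k" using \<open>k > 0\<close> by simp
  ultimately have "p dvd 1" using dvd_add_left_iff[of p _ 1] by simp
  then show False using assms(1) by auto
qed

text \<open>The bridge between the two views of a group: cosets, quotients and isomorphisms are
  taken in \<open>mon H\<close>, word computations in the type class.\<close>

definition mon :: "'a::grp set \<Rightarrow> 'a monoid" where
  "mon H = \<lparr>carrier = H, monoid.mult = (*), one = 1\<rparr>"

lemma mon_simps [simp]: "carrier (mon H) = H" "monoid.mult (mon H) = (*)" "one (mon H) = 1"
  by (simp_all add: mon_def)

lemma order_mon [simp]: "order (mon H) = card H"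
  by (simp add: order_def)

lemma group_mon:
  assumes "sgp H" shows "group (mon H)"
proof (rule groupI)
  show "\<exists>y\<in>carrier (mon H). y \<otimes>\<^bsub>mon H\<^esub> x = \<one>\<^bsub>mon H\<^esub>" if "x \<in> carrier (mon H)" for x
    using that sgp_inverse[OF assms, of x] by (intro bexI[of _ "inverse x"]) simp_all
qed (simp_all add: sgp_one sgp_mult mult.assoc assms)

lemma inv_mon: "sgp H \<Longrightarrow> a \<in> H \<Longrightarrow> inv\<^bsub>mon H\<^esub> a = inverse a"
  by (rule group.inv_equality[OF group_mon]) (auto simp: sgp_inverse)

lemma subgroup_mon: "sgp H \<Longrightarrow> sgp K \<Longrightarrow> K \<subseteq> H \<Longrightarrow> subgroup K (mon H)"
  by (rule group.subgroupI[OF group_mon]) (auto simp: inv_mon subset_iff sgp_closed dest: sgp_one)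

lemma card_sgp_dvd: "sgp H \<Longrightarrow> sgp K \<Longrightarrow> K \<subseteq> H \<Longrightarrow> card K dvd card H"
  using group.lagrange[OF group_mon subgroup_mon, of H K] by (intro dvdI[of _ _ "card (rcosets\<^bsub>mon H\<^esub> K)"]) (simp add: mult.commute)

lemma normal_mon: "sgp H \<Longrightarrow> nrm N H \<Longrightarrow> N \<lhd> mon H"
proof -
  assume H: "sgp H" and N: "nrm N H"
  have "subgroup N (mon H)" using H N by (simp add: subgroup_mon nrm_sgp nrm_subset)
  moreover have "x * n * inverse x \<in> N" if "x \<in> H" "n \<in> N" for x n
    using nrm_cj[OF N sgp_inverse[OF H that(1)] that(2)] by (simp add: cj_def)
  ultimately show ?thesis
    using group.normal_inv_iff[OF group_mon[OF H]] by (simp add: inv_mon[OF H])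
qed

definition pgrp :: "nat \<Rightarrow> nat \<Rightarrow> 'a::grp set \<Rightarrow> bool" where
  "pgrp p k H \<longleftrightarrow> prime p \<and> sgp H \<and> card H = p ^ k"

lemma pgrp_prime: "pgrp p k H \<Longrightarrow> prime p" and pgrp_sgp: "pgrp p k H \<Longrightarrow> sgp H"
  and pgrp_card: "pgrp p k H \<Longrightarrow> card H = p ^ k"
  by (auto simp: pgrp_def)

lemma pgrp_finite: "pgrp p k H \<Longrightarrow> finite H"
  using card_gt_0_iff[of H] by (simp add: pgrp_def prime_gt_0_nat)

lemma pgrp_subgroup:
  assumes "pgrp p k H" "sgp K" "K \<subseteq> H"
  obtains j where "j \<le> k" "pgrp p j K"
proof -
  have "card K dvd p ^ k" using card_sgp_dvd[of H K] assms by (simp add: pgrp_def)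
  then obtain j where "j \<le> k" "card K = p ^ j"
    using assms(1) divides_primepow_nat by (auto simp: pgrp_def)
  then show ?thesis using that assms by (auto simp: pgrp_def)
qed

lemma pgrp_subset_eq:
  assumes H: "pgrp p k H" and K: "pgrp p j K" "K \<subseteq> H" "k \<le> j"
  shows "K = H"
proof (rule card_seteq[OF pgrp_finite[OF H] K(2)])
  show "card H \<le> card K"
    using power_increasing[OF K(3) prime_ge_1_nat[OF pgrp_prime[OF H]]] H K(1) by (simp add: pgrp_def)
qed

text \<open>The preimage in \<open>H\<close> of the centre of \<open>H / N\<close>.\<close>

definition ucen :: "'a::grp set \<Rightarrow> 'a set \<Rightarrow> 'a set" where
  "ucen H N = {h \<in> H. \<forall>k\<in>H. cm h k \<in> N}"

lemma ucen_normal: 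
  assumes H: "sgp H" and N: "nrm N H"
  shows "nrm (ucen H N) H" "N \<subseteq> ucen H N"
proof -
  show "N \<subseteq> ucen H N" using nrm_subset[OF N] nrm_cm[OF N] by (auto simp: ucen_def)
  have "cm (inverse h) k = cj (inverse h) (inverse (cm h k))" for h k :: 'a
    by (simp add: cm_def cj_def mult.assoc)
  then have "sgp (ucen H N)"
    unfolding ucen_def
    by (intro sgpI)
       (simp_all add: cm_mult_left sgp_closed[OF H] nrm_cj[OF N] sgp_closed[OF nrm_sgp[OF N]])
  moreover have "cj g h \<in> ucen H N" if "h \<in> ucen H N" "g \<in> H" for g h
  proof -
    have "cm (cj g h) k = cj g (cm h (cj (inverse g) k))" if "k \<in> H" for k
      by (simp add: cj_cm cj_cj)
    then show ?thesis using that unfolding ucen_def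
      by (auto simp: sgp_cj[OF H] sgp_inverse[OF H] intro!: nrm_cj[OF N])
  qed
  ultimately show "nrm (ucen H N) H" by (auto simp: nrm_def ucen_def)
qed

text \<open>\<open>H / N\<close> is a nontrivial \<open>p\<close>-group and so has a nontrivial
  centre.\<close>

lemma ucen_proper:
  assumes H: "pgrp p k H" and N: "nrm N H" "N \<noteq> H"
  shows "ucen H N \<noteq> N"
proof -
  note sH = pgrp_sgp[OF H]
  interpret G: group "mon H" by (rule group_mon[OF sH])
  interpret N: normal N "mon H" by (rule normal_mon[OF sH N(1)])
  interpret Q: group "mon H Mod N" by (rule N.factorgroup_is_group)
  have "order (mon H Mod N) * card N = p ^ k"
    using G.lagrange[OF N.subgroup_axioms] H by (simp add: FactGroup_def order_def pgrp_def)
  moreover have "card N \<noteq> p ^ k"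
  proof
    assume "card N = p ^ k"
    then have "card N = card H" using H by (simp add: pgrp_def)
    then show False
      using card_subset_eq[OF pgrp_finite[OF H] nrm_subset[OF N(1)]] N(2) by simp
  qed
  moreover obtain j where j: "order (mon H Mod N) = p ^ j"
    using divides_primepow_nat[OF pgrp_prime[OF H], of "order (mon H Mod N)" k] dvdI[OF calculation(1)[symmetric]]
    by auto
  ultimately have "j \<noteq> 0" by (intro notI) simp
  then obtain z where z: "z \<in> carrier (mon H Mod N)" "z \<noteq> \<one>\<^bsub>mon H Mod N\<^esub>"
    "\<And>g. g \<in> carrier (mon H Mod N) \<Longrightarrow> g \<otimes>\<^bsub>mon H Mod N\<^esub> z = z \<otimes>\<^bsub>mon H Mod N\<^esub> g"
    using Q.p_group_center[OF pgrp_prime[OF H] j] by auto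
  obtain h where h: "h \<in> H" "z = N #>\<^bsub>mon H\<^esub> h" using z(1) by (auto simp: carrier_FactGroup)
  have "h \<notin> N" using z(2) h by (auto simp: N.rcos_const)
  moreover have "h \<in> ucen H N"
  proof -
    have "cm h k \<in> N" if k: "k \<in> H" for k
    proof -
      have "(N #>\<^bsub>mon H\<^esub> k) <#>\<^bsub>mon H\<^esub> (N #>\<^bsub>mon H\<^esub> h) = (N #>\<^bsub>mon H\<^esub> h) <#>\<^bsub>mon H\<^esub> (N #>\<^bsub>mon H\<^esub> k)"
        using z(3)[of "N #>\<^bsub>mon H\<^esub> k"] h k by (auto simp: carrier_FactGroup)
      then have "N #>\<^bsub>mon H\<^esub> (k * h) = N #>\<^bsub>mon H\<^esub> (h * k)"
        using h k by (simp add: N.rcos_sum)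
      then have "h * k \<in> N #>\<^bsub>mon H\<^esub> (k * h)"
        using G.rcos_self[of "h * k" N] N.subgroup_axioms sgp_mult[OF sH] h k by simp
      then obtain n where n: "n \<in> N" "h * k = n * (k * h)" by (auto simp: r_coset_def)
      have "cm h k = cj (k * h) n"
        using n(2) by (simp add: cm_def cj_def mult.assoc)
      then show ?thesis using nrm_cj[OF N(1) _ n(1)] h k sgp_mult[OF sH] by simp
    qed
    then show ?thesis using h by (simp add: ucen_def)
  qed
  ultimately show ?thesis by blast
qed

text \<open>The upper central series gains a factor \<open>p\<close> at each step until it reaches
  \<open>H\<close>, and \<open>gam H (i + 1)\<close> lies in its term of index \<open>k - i\<close>.
  So the class is at most \<open>k\<close>, which for \<open>k < p\<close> is what Hall--Petrescu
  asks for.\<close>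

lemma gam_pgrp_trivial:
  assumes H: "pgrp p k H"
  shows "gam H (Suc k) = {1}"
proof -
  note sH = pgrp_sgp[OF H]
  define Z where "Z i = (ucen H ^^ i) {1}" for i
  have nZ: "nrm (Z i) H" for i
  proof (induction i)
    case 0
    show ?case using sH by (simp add: Z_def nrm_def sgp_one)
  next
    case (Suc i)
    then show ?case using ucen_normal(1)[OF sH, of "Z i"] by (simp add: Z_def)
  qed
  have card: "p ^ i dvd card (Z i) \<or> Z i = H" for i
  proof (induction i)
    case (Suc i)
    have sub: "Z i \<subseteq> Z (Suc i)" using ucen_normal(2)[OF sH nZ] by (simp add: Z_def)
    show ?case
    proof (cases "Z i = H")
      case True
      then show ?thesis using sub nrm_subset[OF nZ[of "Suc i"]] by auto
    next
      case False
      then have ne: "Z (Suc i) \<noteq> Z i" using ucen_proper[OF H nZ] by (simp add: Z_def)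
      obtain a where a: "pgrp p a (Z i)" using pgrp_subgroup[OF H nrm_sgp[OF nZ] nrm_subset[OF nZ]] .
      obtain b where b: "pgrp p b (Z (Suc i))" using pgrp_subgroup[OF H nrm_sgp[OF nZ] nrm_subset[OF nZ]] .
      have "a < b" using pgrp_subset_eq[OF b a sub] ne by force
      moreover have "i \<le> a"
        using Suc False power_dvd_imp_le[OF _ prime_gt_1_nat[OF pgrp_prime[OF H]], of i a]
        by (simp add: pgrp_card[OF a])
      ultimately have "p ^ Suc i dvd p ^ b" by (intro le_imp_power_dvd) simp
      then show ?thesis using b by (simp add: pgrp_def)
    qed
  qed (simp add: Z_def)
  have "Z k = H"
  proof (cases "Z k = H")
    case False
    then have "p ^ k dvd card (Z k)" using card by blast
    moreover obtain a where a: "a \<le> k" "pgrp p a (Z k)"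
      using pgrp_subgroup[OF H nrm_sgp[OF nZ] nrm_subset[OF nZ]] .
    ultimately have "k \<le> a" 
      using power_dvd_imp_le[OF _ prime_gt_1_nat[OF pgrp_prime[OF H]], of k a] by (simp add: pgrp_card)
    then show ?thesis using pgrp_subset_eq[OF H a(2) nrm_subset[OF nZ]] by simp
  qed
  have "gam H (Suc i) \<subseteq> Z (k - i)" if "i \<le> k" for i
    using that
  proof (induction i)
    case (Suc i)
    then have sub: "gam H (Suc i) \<subseteq> Z (k - i)" by simp
    have "k - i = Suc (k - Suc i)" using Suc by simp
    then have *: "Z (k - i) = ucen H (Z (k - Suc i))" by (simp add: Z_def)
    show ?case unfolding gam.simps(3)
      by (rule gen_subset[OF _ nrm_sgp[OF nZ]]) (use sub * in \<open>auto simp: ucen_def\<close>)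
  qed (simp add: \<open>Z k = H\<close>)
  from this[of k] have "gam H (Suc k) \<subseteq> {1}" by (simp add: Z_def)
  then show ?thesis using sgp_one[OF nrm_sgp[OF gam_normal[OF sH]]] by blast
qed

text \<open>Normal form for the extension of \<open>S\<close> by an element normalising it. As
  \<open>k ^ n\<close> lies in \<open>S\<close>, the inverse of \<open>k\<close> is a positive power
  of \<open>k\<close> modulo \<open>S\<close>, so closure under \<open>cj k\<close> is
  enough.\<close>

lemma gen_insert_normal:
  assumes S: "sgp S" and k: "\<And>s. s \<in> S \<Longrightarrow> cj k s \<in> S" and n: "k ^ n \<in> S" "n > 0"
  shows "gen (insert k S) = (\<lambda>(i, s). k ^ i * s) ` ({..<n} \<times> S)"
proof -
  let ?T = "(\<lambda>(i, s). k ^ i * s) ` ({..<n} \<times> S)"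
  have ki: "cj (k ^ i) s \<in> S" if "s \<in> S" for i s
    using that by (induction i) (simp_all add: k power_Suc2 flip: cj_cj power_Suc)
  have T: "k ^ i * s \<in> ?T" if "s \<in> S" for i s
  proof -
    have "k ^ i = k ^ (i mod n) * (k ^ n) ^ (i div n)"
      by (simp flip: power_add power_mult)
    then have "k ^ i * s = k ^ (i mod n) * ((k ^ n) ^ (i div n) * s)" by (simp add: mult.assoc)
    moreover have "(k ^ n) ^ (i div n) * s \<in> S" using S n that by (simp add: sgp_closed)
    ultimately show ?thesis using n by force
  qed
  have "sgp ?T"
  proof (rule sgpI)
    show "1 \<in> ?T" using T[of 1 0] S by (simp add: sgp_one)
  next
    fix a b assume "a \<in> ?T" "b \<in> ?T"
    then obtain i s j t where *: "a = k ^ i * s" "b = k ^ j * t" "s \<in> S" "t \<in> S" by auto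
    have "a * b = k ^ (i + j) * (cj (k ^ j) s * t)"
      by (simp add: * cj_def mult.assoc power_add)
    then show "a * b \<in> ?T" using T[of "cj (k ^ j) s * t"] ki S * by (simp add: sgp_closed)
  next
    fix a assume "a \<in> ?T"
    then obtain i s where *: "a = k ^ i * s" "s \<in> S" "i < n" by auto
    have "k ^ n = k ^ i * k ^ (n - i)" using * by (simp flip: power_add)
    then have "inverse a = k ^ (n - i) * (cj (k ^ (n - i)) (inverse s) * inverse (k ^ n))"
      by (simp add: * cj_def mult.assoc)
    then show "inverse a \<in> ?T"
      using T[of "cj (k ^ (n - i)) (inverse s) * inverse (k ^ n)"] ki S * n by (simp add: sgp_closed)
  qed
  moreover have "insert k S \<subseteq> ?T"
  proof
    fix a assume "a \<in> insert k S"
    then show "a \<in> ?T" using T[of 1 1] T[of a 0] S by (auto simp only: insert_iff power_one_right mult_1_right power_0 mult_1_left sgp_one)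
  qed
  moreover have "?T \<subseteq> gen (insert k S)"
    by (force intro: gen_mult gen_base sgp_power[OF sgp_gen, OF gen_base])
  ultimately show ?thesis using gen_subset by blast
qed

lemma card_gen_insert_le:
  assumes "sgp S" "\<And>s. s \<in> S \<Longrightarrow> cj k s \<in> S" "k ^ n \<in> S" "n > 0" "finite S"
  shows "finite (gen (insert k S))" "card (gen (insert k S)) \<le> n * card S"
proof -
  have eq: "gen (insert k S) = (\<lambda>(i, s). k ^ i * s) ` ({..<n} \<times> S)"
    by (rule gen_insert_normal) (use assms in auto)
  show "finite (gen (insert k S))" by (subst eq) (intro finite_imageI finite_cartesian_product finite_lessThan assms(5))
  show "card (gen (insert k S)) \<le> n * card S"
    using card_image_le[of "{..<n} \<times> S" "\<lambda>(i, s). k ^ i * s"] assms(5)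
    by (subst eq) (simp add: card_cartesian_product)
qed

lemma cm_closed_gen:
  assumes H: "sgp H" "H = gen A" and N: "nrm N H" and A: "\<And>a b. a \<in> A \<Longrightarrow> b \<in> A \<Longrightarrow> cm a b \<in> N"
    and gh: "g \<in> H" "h \<in> H"
  shows "cm g h \<in> N"
proof -
  note sN = nrm_sgp[OF N]
  have inv1: "cm (inverse g) h = cj (inverse g) (inverse (cm g h))" for g h :: 'a
    by (simp add: cm_def cj_def mult.assoc)
  have inv2: "cm g (inverse h) = cj (inverse h) (inverse (cm g h))" for g h :: 'a
    by (simp add: cm_def cj_def mult.assoc)
  have 1: "g \<in> H \<and> cm g b \<in> N" if "g \<in> gen A" "b \<in> A" for g b
    using that
  proof (induction)
    case (gen_base a) then show ?case using A H by (auto intro: gen.gen_base)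
  qed (auto simp: cm_mult_left inv1 sgp_closed[OF H(1)] sgp_closed[OF sN] nrm_cj[OF N])
  have "h \<in> H \<and> cm g h \<in> N" if "h \<in> gen A" "g \<in> gen A" for g h
    using that
  proof (induction)
    case (gen_base a) then show ?case using 1 H by (auto intro: gen.gen_base)
  qed (auto simp: cm_mult_right inv2 sgp_closed[OF H(1)] sgp_closed[OF sN] nrm_cj[OF N])
  then show ?thesis using gh H by blast
qed

lemma gam_2_subset:
  assumes "sgp H" "nrm N H" "\<And>g h. g \<in> H \<Longrightarrow> h \<in> H \<Longrightarrow> cm g h \<in> N"
  shows "gam H 2 \<subseteq> N"
  unfolding numeral_2_eq_2 gam.simps by (rule gen_subset) (use assms nrm_sgp in auto)

lemma cm_in_gam_2: "g \<in> H \<Longrightarrow> h \<in> H \<Longrightarrow> cm g h \<in> gam H 2"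
  unfolding numeral_2_eq_2 gam.simps by (auto intro: gen_base)

lemma nrm_of_gam_2:
  assumes "sgp H" "sgp N" "N \<subseteq> H" "gam H 2 \<subseteq> N"
  shows "nrm N H"
  using assms cm_in_gam_2[of _ H] by (auto simp: nrm_def cj_eq_cm sgp_mult subset_iff)

lemma nrm_power_mult:
  assumes N: "nrm N H" and "a \<in> H" "s \<in> N"
  shows "\<exists>t\<in>N. (a * s) ^ m = a ^ m * t"
proof (induction m)
  case 0 then show ?case using sgp_one[OF nrm_sgp[OF N]] by auto
next
  case (Suc m)
  then obtain t where t: "t \<in> N" "(a * s) ^ m = a ^ m * t" by blast
  have "(a * s) ^ Suc m = (a ^ m * t) * (a * s)" unfolding t(2)[symmetric] by (rule power_Suc2)
  also have "\<dots> = a ^ Suc m * (cj a t * s)"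
    by (simp add: cj_def mult.assoc power_Suc2 del: power_Suc)
  finally show ?case using t assms by (auto intro!: bexI[of _ "cj a t * s"] sgp_mult[OF nrm_sgp[OF N]] nrm_cj[OF N])
qed

lemma pow_mon: "x [^]\<^bsub>mon H\<^esub> (n::nat) = x ^ n"
  by (induction n) (simp_all add: nat_pow_def power_Suc2 del: power_Suc)

lemma sgp_power_card: "sgp H \<Longrightarrow> g \<in> H \<Longrightarrow> g ^ card H = 1"
  using group.pow_order_eq_1[OF group_mon, of H g] by (simp add: pow_mon)

lemma pgrp_power_card: "pgrp p k H \<Longrightarrow> g \<in> H \<Longrightarrow> g ^ p ^ k = 1"
  using sgp_power_card[of H g] by (simp add: pgrp_def)

text \<open>In a nilpotent group some \<open>z\<close> outside \<open>M\<close> normalises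
  \<open>M\<close>. By maximality \<open>H\<close> consists of powers of \<open>z\<close> times
  elements of \<open>M\<close>, so \<open>M\<close> is normal with cyclic quotient and contains all
  commutators.\<close>

lemma maximal_subgroup_pgrp:
  assumes H: "pgrp p k H" and M: "sgp M" "M \<subseteq> H" "M \<noteq> H"
    and max: "\<And>L. sgp L \<Longrightarrow> M \<subseteq> L \<Longrightarrow> L \<subseteq> H \<Longrightarrow> L \<noteq> H \<Longrightarrow> L = M"
  shows "gam H 2 \<subseteq> M" "nrm M H" "\<And>g. g \<in> H \<Longrightarrow> g ^ p \<in> M"
proof -
  note sH = pgrp_sgp[OF H]
  \<comment> \<open>Term \<open>i\<close> is the last one of the lower central series not contained
    in \<open>M\<close>: an element \<open>z\<close> of it outside \<open>M\<close> has all its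
    commutators in \<open>M\<close> and therefore normalises \<open>M\<close>.\<close>
  define i where "i = (LEAST i. gam H (Suc i) \<subseteq> M)"
  have "gam H (Suc k) \<subseteq> M" using gam_pgrp_trivial[OF H] sgp_one[OF M(1)] by simp
  then have i: "gam H (Suc i) \<subseteq> M" unfolding i_def by (rule LeastI)
  have "i \<noteq> 0" using i M by (auto intro!: notI)
  then have "\<not> gam H (Suc (i - 1)) \<subseteq> M"
    using not_less_Least[of "i - 1" "\<lambda>i. gam H (Suc i) \<subseteq> M"] by (simp add: i_def)
  then obtain z where z: "z \<in> gam H i" "z \<notin> M" using \<open>i \<noteq> 0\<close> by auto
  have zH: "z \<in> H" using z(1) nrm_subset[OF gam_normal[OF sH]] by blast
  have cmz: "cm m z \<in> M" if "m \<in> H" for m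
  proof -
    have "cm z m \<in> gam H (Suc i)" using gam_cm_self[OF sH z(1) that] .
    then show ?thesis using i M(1) by (metis inverse_cm sgp_inverse subsetD)
  qed
  have cjz: "cj z m \<in> M" if "m \<in> M" for m
    using that M cmz[of m] by (auto simp: cj_eq_cm sgp_mult)
  have full: "gen (insert g M) = H" if "g \<in> H" "g \<notin> M" for g
  proof (rule ccontr)
    assume "gen (insert g M) \<noteq> H"
    moreover have "gen (insert g M) \<subseteq> H" using that M sH by (intro gen_subset) auto
    moreover have "M \<subseteq> gen (insert g M)" "g \<in> gen (insert g M)" by (auto intro: gen_base)
    ultimately show False using max[of "gen (insert g M)"] that by simp
  qed
  have zk: "z ^ p ^ k \<in> M" using pgrp_power_card[OF H zH] M by (simp add: sgp_one)
  have rep: "H = (\<lambda>(i, s). z ^ i * s) ` ({..<p ^ k} \<times> M)"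
    using gen_insert_normal[OF M(1) cjz zk] full[OF zH z(2)] prime_gt_0_nat[OF pgrp_prime[OF H]] by simp
  have cjM: "cj h m \<in> M" if "h \<in> H" "m \<in> M" for h m
  proof -
    have "h \<in> (\<lambda>(i, s). z ^ i * s) ` ({..<p ^ k} \<times> M)" using that(1) by (simp only: rep[symmetric])
    then obtain i s where h: "h = z ^ i * s" "s \<in> M" by auto
    have "cj (z ^ i) m \<in> M"
      using that by (induction i) (simp_all add: cjz power_Suc2 flip: cj_cj power_Suc)
    then show ?thesis using h M by (simp add: sgp_cj flip: cj_cj)
  qed
  then show N: "nrm M H" using M by (auto simp: nrm_def)
  have "cm g h \<in> M" if "g \<in> H" "h \<in> H" for g h
  proof (rule cm_closed_gen[OF sH _ N _ that])
    show "H = gen (insert z M)" using full[OF zH z(2)] by simp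
    show "cm a b \<in> M" if "a \<in> insert z M" "b \<in> insert z M" for a b
      using that M cmz zH nrm_cm[OF N] nrm_cm'[OF N] by (auto simp: subset_iff)
  qed
  then show g2: "gam H 2 \<subseteq> M" using gam_2_subset[OF sH N] by blast
  show "g ^ p \<in> M" if g: "g \<in> H" for g
  proof (rule ccontr)
    assume np: "g ^ p \<notin> M"
    have gpk: "(g ^ p) ^ p ^ k = 1" using pgrp_power_card[OF H sgp_power[OF sH g]] .
    have "cj (g ^ p) s \<in> M" if "s \<in> M" for s using cjM[OF sgp_power[OF sH g] that] .
    then have "H = (\<lambda>(i, s). (g ^ p) ^ i * s) ` ({..<p ^ k} \<times> M)"
      using gen_insert_normal[OF M(1), of "g ^ p" "p ^ k"] full[OF sgp_power[OF sH g] np] gpk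
        prime_gt_0_nat[OF pgrp_prime[OF H]] M by (simp add: sgp_one)
    then have "g \<in> (\<lambda>(i, s). (g ^ p) ^ i * s) ` ({..<p ^ k} \<times> M)" using g by simp
    then obtain i s where gi: "g = (g ^ p) ^ i * s" "s \<in> M" by auto
    \<comment> \<open>If \<open>g ^ p\<close> were outside \<open>M\<close>, then \<open>g\<close>
      would be congruent modulo \<open>M\<close> to a power of \<open>g ^ p\<close>. Iterating,
      \<open>g\<close> is congruent to \<open>g ^ ((p * i) ^ n)\<close>, which is 1 for
      \<open>n = k\<close>.\<close>
    have "\<exists>t\<in>M. g = g ^ ((p * i) ^ n) * t" for n
    proof (induction n)
      case 0 then show ?case using M by (intro bexI[of _ 1]) (simp_all add: sgp_one)
    next
      case (Suc n)
      then obtain t where t: "t \<in> M" "g = g ^ ((p * i) ^ n) * t" by blast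
      have "g = g ^ (p * i) * s" using gi by (simp add: power_mult)
      then obtain s' where "s' \<in> M" "g ^ ((p * i) ^ n) = (g ^ (p * i)) ^ ((p * i) ^ n) * s'"
        using nrm_power_mult[OF N sgp_power[OF sH g] gi(2), of "p * i" "(p * i) ^ n"] by metis
      then have "g = g ^ ((p * i) ^ Suc n) * (s' * t)"
        using t(2) by (simp add: mult.assoc flip: power_mult)
      then show ?case using t \<open>s' \<in> M\<close> M(1) by (auto simp: sgp_mult)
    qed
    from this[of k] obtain t where "t \<in> M" "g = (g ^ p ^ k) ^ (i ^ k) * t"
      by (auto simp: power_mult_distrib power_mult)
    then show False using pgrp_power_card[OF H g] np M by (simp add: sgp_power)
  qed
qed

lemma obtain_maximal_subgroup:
  assumes H: "pgrp p k H" and A: "A \<subseteq> H" "gen A \<noteq> H"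
  obtains M where "sgp M" "A \<subseteq> M" "M \<subseteq> H" "M \<noteq> H" "gam H 2 \<subseteq> M" "nrm M H"
    "\<And>g. g \<in> H \<Longrightarrow> g ^ p \<in> M"
    "\<And>g. g \<in> H \<Longrightarrow> g \<notin> M \<Longrightarrow> gen (insert g M) = H"
proof -
  note sH = pgrp_sgp[OF H] and fH = pgrp_finite[OF H]
  define S where "S = {M. sgp M \<and> A \<subseteq> M \<and> M \<subseteq> H \<and> M \<noteq> H}"
  have "finite S" unfolding S_def by (rule finite_subset[of _ "Pow H"]) (use fH in auto)
  moreover have "gen A \<in> S"
    using gen_subset[OF A(1) sH] gen_superset[of A] A by (simp add: S_def)
  ultimately obtain M where M: "M \<in> S" "\<forall>L\<in>S. M \<subseteq> L \<longrightarrow> M = L"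
    using finite_has_maximal[of S] by blast
  then have max: "L = M" if "sgp L" "M \<subseteq> L" "L \<subseteq> H" "L \<noteq> H" for L
    using that by (auto simp: S_def)
  have Ms: "sgp M" "A \<subseteq> M" "M \<subseteq> H" "M \<noteq> H" using M(1) by (auto simp: S_def)
  have "gen (insert g M) = H" if g: "g \<in> H" "g \<notin> M" for g
  proof (rule ccontr)
    assume ne: "gen (insert g M) \<noteq> H"
    have "gen (insert g M) \<subseteq> H" using g(1) Ms(3) sH by (intro gen_subset) simp_all
    moreover have "M \<subseteq> gen (insert g M)" "g \<in> gen (insert g M)" by (auto intro: gen_base)
    ultimately show False using max[of "gen (insert g M)"] ne g by simp
  qed
  then show ?thesis
    using that[OF Ms] maximal_subgroup_pgrp[OF H Ms(1,3,4) max] by simp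
qed

lemma frattini_generate:
  assumes H: "pgrp p k H" and A: "A \<subseteq> H" and "gen (A \<union> B) = H"
    and B: "\<And>b. b \<in> B \<Longrightarrow> b \<in> gam H 2 \<or> (\<exists>g\<in>H. b = g ^ p)"
  shows "gen A = H"
proof (rule ccontr)
  assume "gen A \<noteq> H"
  then obtain M where M: "sgp M" "A \<subseteq> M" "M \<subseteq> H" "M \<noteq> H" "gam H 2 \<subseteq> M"
    "\<And>g. g \<in> H \<Longrightarrow> g ^ p \<in> M"
    using obtain_maximal_subgroup[OF H A] by metis
  then have "A \<union> B \<subseteq> M" using B by fast
  then have "gen (A \<union> B) \<subseteq> M" using M(1) by (intro gen_subset)
  then show False using assms(3) M by blast
qed

subsection \<open>Regular p-groups\<close>

lemma gen_eq_iff_subset: "sgp H \<Longrightarrow> A \<subseteq> H \<Longrightarrow> H \<subseteq> gen A \<Longrightarrow> gen A = H"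
  using gen_subset by blast

lemma pgrp_power_mult:
  assumes H: "pgrp p k H" "k < p" and xy: "x \<in> H" "y \<in> H"
  shows "\<exists>s \<in> gen {g ^ (p ^ e) |g. g \<in> gam H 2}. (x * y) ^ (p ^ e) = x ^ (p ^ e) * y ^ (p ^ e) * s"
  using hall_petrescu_gam[OF pgrp_sgp gam_pgrp_trivial pgrp_prime] assms by blast

text \<open>In a nonabelian \<open>\<langle>x, y\<rangle>\<close> every \<open>\<langle>u, H'\<rangle>\<close> is a proper subgroup; this drives the
  induction on the order of the group.\<close>

lemma pgrp_regular:
  assumes "pgrp p k H" "k < p" and "x \<in> H" "y \<in> H" and q_def: "q = p ^ e"
  shows "(x ^ q = y ^ q \<longleftrightarrow> (inverse x * y) ^ q = 1) \<and> (\<exists>z\<in>H. x ^ q * y ^ q = z ^ q)"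
  using assms(1-4)
proof (induction k arbitrary: H x y rule: less_induct)
  case (less k)
  note H = less.prems(1,2) and sH = pgrp_sgp[OF less.prems(1)]
  have IH: "(a ^ q = b ^ q \<longleftrightarrow> (inverse a * b) ^ q = 1) \<and> (\<exists>z\<in>K. a ^ q * b ^ q = z ^ q)"
    if K: "sgp K" "K \<subseteq> H" "K \<noteq> H" "a \<in> K" "b \<in> K" for K a b
  proof -
    obtain j where j: "j \<le> k" "pgrp p j K" using pgrp_subgroup[OF H(1) K(1,2)] .
    have "j < k" using pgrp_subset_eq[OF H(1) j(2) K(2)] K(3) by force
    then show ?thesis using less.IH[OF _ j(2) _ K(4,5)] H(2) q_def by simp
  qed
  consider "gen {x, y} \<noteq> H" | "gen {x, y} = H" "gam H 2 = {1}" | "gen {x, y} = H" "gam H 2 \<noteq> {1}"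
    by blast
  then show ?case
  proof cases
    case 1
    have "gen {x, y} \<subseteq> H" using less.prems sH by (intro gen_subset) auto
    then show ?thesis using IH[OF sgp_gen _ 1, of x y] gen_superset[of "{x, y}"] by blast
  next
    case 2
    have mult: "(a * b) ^ q = a ^ q * b ^ q" if "a \<in> H" "b \<in> H" for a b
    proof -
      have "gen {g ^ (p ^ e) |g. g \<in> gam H 2} \<subseteq> {1}"
        unfolding 2(2) by (rule gen_subset) auto
      then show ?thesis using pgrp_power_mult[OF H that, of e] by (auto simp: q_def)
    qed
    have "(inverse x * y) ^ q = inverse (x ^ q) * y ^ q"
      using mult[of "inverse x" y] less.prems sH by (simp add: sgp_inverse grp_power_inverse)
    then have "x ^ q = y ^ q \<longleftrightarrow> (inverse x * y) ^ q = 1"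
      by (metis grp_left_cancel grp_left_inverse)
    then show ?thesis using mult less.prems sH by (metis sgp_mult)
  next
    case 3
    define T where "T u = gen (insert u (gam H 2))" for u
    have g2: "nrm (gam H 2) H" by (rule gam_normal[OF sH])
    have T: "T u \<noteq> H" "T u \<subseteq> H" if "u \<in> H" for u
    proof -
      show "T u \<subseteq> H" unfolding T_def using that nrm_subset[OF g2] sH by (intro gen_subset) auto
      show "T u \<noteq> H"
      proof
        assume *: "T u = H"
        have "gen {u} = H"
          by (rule frattini_generate[OF H(1), of _ "gam H 2"]) (use * that in \<open>auto simp: T_def\<close>)
        then have H': "H = gen {u}" by simp
        have "cm g h \<in> {1}" if "g \<in> H" "h \<in> H" for g h
          by (rule cm_closed_gen[OF sH H' _ _ that]) (use sH in \<open>auto simp: nrm_def sgp_one\<close>)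
        then have "gam H 2 \<subseteq> {1}"
          using gam_2_subset[OF sH, of "{1}"] sH by (auto simp: nrm_def sgp_one)
        then show False using 3 sgp_one[OF nrm_sgp[OF g2]] by blast
      qed
    qed
    have sT: "sgp (T u)" for u by (simp add: T_def)
    have TI: "u \<in> T u" "d \<in> gam H 2 \<Longrightarrow> d \<in> T u" "d \<in> gam H 2 \<Longrightarrow> u * d \<in> T u" for u d
      unfolding T_def by (auto intro: gen_base gen_mult)
    have g2p: "gam H 2 \<noteq> H" using T[of 1] TI(2)[of _ 1] nrm_subset[OF g2] sgp_one[OF sH] by blast
    \<comment> \<open>If the commutator of one generating pair is killed by \<open>q\<close>, so is
      the whole derived subgroup: by induction the elements of \<open>gam H 2\<close> killed by
      \<open>q\<close> form a subgroup. The Hall--Petrescu error then vanishes.\<close>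
    have ker: "gen {g ^ q |g. g \<in> gam H 2} \<subseteq> {1}"
      if uv: "H = gen {u, v}" "(cm u v) ^ q = 1" for u v
    proof -
      define N where "N = {g \<in> gam H 2. g ^ q = 1}"
      have uvH: "u \<in> H" "v \<in> H" using uv(1) gen_base[of _ "{u, v}"] by auto
      have "sgp N"
      proof (rule sgpI)
        fix a b assume ab: "a \<in> N" "b \<in> N"
        then have "(inverse (inverse a) * b) ^ q = 1"
          using IH[OF nrm_sgp[OF g2] nrm_subset[OF g2] g2p, of "inverse a" b] nrm_sgp[OF g2]
          by (simp add: N_def sgp_inverse grp_power_inverse)
        then show "a * b \<in> N" using ab nrm_sgp[OF g2] by (simp add: N_def sgp_mult)
      qed (use nrm_sgp[OF g2] in \<open>auto simp: N_def sgp_one sgp_inverse grp_power_inverse\<close>)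
      then have N: "nrm N H" using g2 by (auto simp: nrm_def N_def simp flip: cj_power)
      have "cm g h \<in> N" if "g \<in> H" "h \<in> H" for g h
      proof (rule cm_closed_gen[OF sH uv(1) N _ that])
        have *: "cm u v \<in> N" "1 \<in> N" using cm_in_gam_2[OF uvH] uv(2) sgp_one[OF nrm_sgp[OF N]] by (auto simp: N_def)
        have "cm v u \<in> N" using sgp_inverse[OF nrm_sgp[OF N] *(1)] by (simp add: inverse_cm)
        then show "cm a b \<in> N" if "a \<in> {u, v}" "b \<in> {u, v}" for a b
          using that * by auto
      qed
      then have "gam H 2 \<subseteq> N" by (rule gam_2_subset[OF sH N])
      then show ?thesis by (intro gen_subset) (auto simp: N_def)
    qed
    have xy: "H = gen {x, y}" using 3 by simp
    have gens: "gen {inverse x, y} = H" "gen {x, inverse x * y} = H"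
    proof -
      have "x \<in> gen {inverse x, y}" using gen_inverse[OF gen_base, of "inverse x" "{inverse x, y}"] by simp
      then have "H \<subseteq> gen {inverse x, y}"
        unfolding xy by (intro gen_subset) (auto intro: gen_base)
      then show "gen {inverse x, y} = H"
        using less.prems sH by (intro gen_eq_iff_subset) (auto simp: sgp_inverse)
      have "x * (inverse x * y) \<in> gen {x, inverse x * y}" by (intro gen_mult gen_base) auto
      then have "H \<subseteq> gen {x, inverse x * y}"
        unfolding xy by (intro gen_subset) (auto intro: gen_base)
      then show "gen {x, inverse x * y} = H"
        using less.prems sH by (intro gen_eq_iff_subset) (auto simp: sgp_inverse sgp_mult)
    qed
    have "(inverse x * y) ^ q = 1" if eq: "x ^ q = y ^ q"
    proof -
      \<comment> \<open>\<open>x\<close> commutes with \<open>x ^ q = y ^ q\<close>, so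
        \<open>y\<close> and its conjugate by \<open>x\<close> have the same \<open>q\<close>-th
        power; both lie in the proper subgroup \<open>T y\<close>, where the induction hypothesis
        applies.\<close>
      have "(cj x y) ^ q = y ^ q" 
        using eq by (simp flip: cj_power eq) (simp add: cj_eq_iff_commute power_commutes)
      then have "(inverse y * cj x y) ^ q = 1"
        using IH[OF sT T(2,1) TI(1), of y "cj x y"] less.prems TI(3)[of "cm y x" y] cm_in_gam_2[of y H x]
        by (simp add: cj_eq_cm[of x y])
      then have "(cm y x) ^ q = 1" by (simp add: cj_eq_cm)
      then have k: "gen {g ^ q |g. g \<in> gam H 2} \<subseteq> {1}" using ker[of y x] xy by (simp add: insert_commute)
      have "(inverse x * y) ^ q = inverse x ^ q * y ^ q"
        using pgrp_power_mult[OF H, of "inverse x" y e] k less.prems sH by (auto simp: q_def sgp_inverse)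
      then show ?thesis using eq by (simp add: grp_power_inverse)
    qed
    moreover have "x ^ q = y ^ q" if eq: "(inverse x * y) ^ q = 1"
    proof -
      define a where "a = inverse x * y"
      have aH: "a \<in> H" using less.prems sH by (simp add: a_def sgp_mult sgp_inverse)
      have aq: "a ^ q = 1" using eq by (simp add: a_def)
      \<comment> \<open>Conversely \<open>a\<close> and its conjugate by \<open>x\<close> have the
        same, trivial, \<open>q\<close>-th power, and both lie in the proper subgroup
        \<open>T a\<close>.\<close>
      then have "(cj x a) ^ q = a ^ q" by (simp flip: cj_power)
      then have "(inverse a * cj x a) ^ q = 1"
        using IH[OF sT T(2,1) TI(1), of a "cj x a"] less.prems TI(3)[of "cm a x" a] cm_in_gam_2[of a H x] aH
        by (simp add: cj_eq_cm[of x a])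
      then have "(cm a x) ^ q = 1" by (simp add: cj_eq_cm)
      then have k: "gen {g ^ q |g. g \<in> gam H 2} \<subseteq> {1}"
        using ker[of a x] gens(2) by (simp add: insert_commute a_def)
      have "(x * a) ^ q = x ^ q * a ^ q"
        using pgrp_power_mult[OF H, of x a e] k less.prems aH by (auto simp: q_def)
      then show ?thesis using eq by (simp add: a_def)
    qed
    moreover have "\<exists>z\<in>H. x ^ q * y ^ q = z ^ q"
    proof -
      \<comment> \<open>By induction the \<open>q\<close>-th powers of elements of
        \<open>gam H 2\<close> are closed under products. So the Hall--Petrescu error is a single
        power \<open>d ^ q\<close>, which is then absorbed inside \<open>T (x * y)\<close>.\<close>
      have sq: "s \<in> {d ^ q |d. d \<in> gam H 2}" if "s \<in> gen {g ^ q |g. g \<in> gam H 2}" for s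
        using that
      proof induction
        case gen_one
        then show ?case using sgp_one[OF nrm_sgp[OF g2]] by (auto intro!: exI[of _ 1])
      next
        case (gen_mult a b)
        then show ?case using IH[OF nrm_sgp[OF g2] nrm_subset[OF g2] g2p] by auto
      next
        case (gen_inverse a)
        then obtain d where "a = d ^ q" "d \<in> gam H 2" by auto
        then show ?case using nrm_sgp[OF g2]
          by (auto simp: sgp_inverse grp_power_inverse intro!: exI[of _ "inverse d"])
      qed auto
      obtain d where d: "d \<in> gam H 2" "(x * y) ^ q = x ^ q * y ^ q * d ^ q"
        using pgrp_power_mult[OF H less.prems(3,4), of e] sq unfolding q_def by blast
      have "x ^ q * y ^ q = (x * y) ^ q * inverse d ^ q"
        by (simp add: d grp_power_inverse mult.assoc)
      then show ?thesis
        using IH[OF sT T(2,1) TI(1), of "x * y" "inverse d"] TI(2)[of "inverse d" "x * y"] d less.prems(3,4)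
          sgp_mult[OF sH, of x y] sgp_inverse[OF nrm_sgp[OF g2], of d] T(2)[of "x * y"]
        by auto
    qed
    ultimately show ?thesis by blast
  qed
qed

text \<open>\<open>pw\<close> and \<open>om\<close> are the sets behind the agemo and omega
  subgroups; in a regular group these sets are already subgroups.\<close>

definition pw :: "nat \<Rightarrow> 'a::grp set \<Rightarrow> 'a set" where
  "pw q H = (\<lambda>g. g ^ q) ` H"

definition om :: "nat \<Rightarrow> 'a::grp set \<Rightarrow> 'a set" where
  "om q H = {g \<in> H. g ^ q = 1}"

text \<open>The condition \<open>k < p\<close> keeps the class below \<open>p\<close>, the classical
  sufficient condition for regularity.\<close>

locale regular_pgrp =
  fixes p k :: nat and H :: "'a::grp set"
  assumes pgrp: "pgrp p k H" and k: "k < p"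
begin

lemma prime: "prime p" using pgrp by (rule pgrp_prime)
lemma sgp: "sgp H" using pgrp by (rule pgrp_sgp)
lemma finite: "finite H" using pgrp by (rule pgrp_finite)
lemma card: "card H = p ^ k" using pgrp by (rule pgrp_card)

lemmas closed = sgp_closed[OF sgp]

lemma p_gt_1: "p > 1" using prime by (rule prime_gt_1_nat)

lemma power_eq_iff:
  "x \<in> H \<Longrightarrow> y \<in> H \<Longrightarrow> x ^ (p ^ e) = y ^ (p ^ e) \<longleftrightarrow> (inverse x * y) ^ (p ^ e) = 1"
  using pgrp_regular[OF pgrp k _ _ refl] by blast

lemma power_mult_power:
  "x \<in> H \<Longrightarrow> y \<in> H \<Longrightarrow> \<exists>z\<in>H. x ^ (p ^ e) * y ^ (p ^ e) = z ^ (p ^ e)"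
  using pgrp_regular[OF pgrp k _ _ refl] by blast

lemma mult_order:
  assumes "x \<in> H" "y \<in> H" "x ^ (p ^ e) = 1"
  shows "(x * y) ^ (p ^ e) = y ^ (p ^ e)"
proof -
  have "(inverse (x * y) * y) = cj y (inverse x)" by (simp add: cj_def mult.assoc)
  then show ?thesis
    using power_eq_iff[of "x * y" y e] assms closed by (simp add: grp_power_inverse flip: cj_power)
qed

lemma mult_order':
  assumes "x \<in> H" "y \<in> H" "y ^ (p ^ e) = 1"
  shows "(x * y) ^ (p ^ e) = x ^ (p ^ e)"
  using power_eq_iff[of x "x * y" e] assms closed by simp

lemma sgp_om: "sgp (om (p ^ e) H)"
  by (rule sgpI) (auto simp: om_def closed mult_order grp_power_inverse)

lemma nrm_om: "nrm (om (p ^ e) H) H"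
  using sgp_om by (auto simp: nrm_def om_def closed simp flip: cj_power)

lemma sgp_pw: "sgp (pw (p ^ e) H)"
proof (rule sgpI)
  show "1 \<in> pw (p ^ e) H" unfolding pw_def by (rule image_eqI[of _ _ 1]) (auto simp: closed)
  show "a * b \<in> pw (p ^ e) H" if "a \<in> pw (p ^ e) H" "b \<in> pw (p ^ e) H" for a b
  proof -
    obtain g h where gh: "g \<in> H" "h \<in> H" "a = g ^ p ^ e" "b = h ^ p ^ e" using \<open>a \<in> _\<close> \<open>b \<in> _\<close> by (auto simp: pw_def)
    obtain z where "z \<in> H" "a * b = z ^ p ^ e" using power_mult_power[OF gh(1,2)] gh by metis
    then show ?thesis by (auto simp: pw_def)
  qed
  show "inverse a \<in> pw (p ^ e) H" if "a \<in> pw (p ^ e) H" for a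
    using that closed by (auto simp: pw_def simp flip: grp_power_inverse)
qed

lemma pw_subset: "pw q H \<subseteq> H"
  by (auto simp: pw_def closed)

lemma nrm_pw: "nrm (pw (p ^ e) H) H"
  using sgp_pw pw_subset by (auto simp: nrm_def pw_def closed cj_power)

text \<open>By regularity the fibres of the \<open>p ^ e\<close>-th power map are the cosets of
  \<open>om (p ^ e) H\<close>.\<close>

lemma card_om_pw: "card H = card (om (p ^ e) H) * card (pw (p ^ e) H)"
proof -
  let ?q = "p ^ e"
  have fib: "card {x \<in> H. x ^ ?q = y} = card (om ?q H)" if "y \<in> pw ?q H" for y
  proof -
    obtain x where x: "x \<in> H" "y = x ^ ?q" using \<open>y \<in> _\<close> by (auto simp: pw_def)
    have "{x' \<in> H. x' ^ ?q = y} = (\<lambda>t. x * t) ` om ?q H"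
    proof (intro subset_antisym subsetI)
      fix x' assume "x' \<in> {x' \<in> H. x' ^ ?q = y}"
      then have "inverse x * x' \<in> om ?q H"
        using x power_eq_iff[of x x' e] by (auto simp: om_def closed)
      then show "x' \<in> (\<lambda>t. x * t) ` om ?q H" by (rule image_eqI[rotated]) simp
    qed (use x in \<open>auto simp: om_def closed mult_order'\<close>)
    then show ?thesis by (simp add: card_image inj_on_def)
  qed
  have "card H = (\<Sum>y\<in>pw ?q H. card {x \<in> H. x ^ ?q = y})"
    using sum.group[of H "pw ?q H" "\<lambda>x. x ^ ?q" "\<lambda>_. 1::nat"] finite by (simp add: pw_def)
  then show ?thesis using fib by simp
qed

text \<open>Regularity applied to \<open>x\<close> and its conjugate by \<open>y\<close>, whose
  quotient is \<open>cm x y\<close>.\<close>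

lemma power_commute_iff:
  assumes "x \<in> H" "y \<in> H"
  shows "x ^ (p ^ e) * y = y * x ^ (p ^ e) \<longleftrightarrow> (cm x y) ^ (p ^ e) = 1"
proof -
  have "x ^ (p ^ e) * y = y * x ^ (p ^ e) \<longleftrightarrow> x ^ (p ^ e) = (cj y x) ^ (p ^ e)"
    unfolding cj_eq_iff_commute[symmetric] by (auto simp: cj_power)
  also have "\<dots> \<longleftrightarrow> (cm x y) ^ (p ^ e) = 1"
    using power_eq_iff[of x "cj y x" e] assms closed by (simp add: cj_eq_cm)
  finally show ?thesis .
qed

lemma regular_subgroup:
  assumes "sgp K" "K \<subseteq> H"
  obtains j where "j \<le> k" "regular_pgrp p j K"
  using pgrp_subgroup[OF pgrp assms] k by (auto simp: regular_pgrp_def)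

lemma pw_pw: "pw q (pw r H) = pw (r * q) H"
  by (auto simp: pw_def image_image power_mult)

end

section \<open>Power subgroups of a Beauville group\<close>

lemma prime_card_generator:
  assumes "sgp B" "card B = p" "prime p" "a \<in> B" "a \<noteq> 1" "b \<in> B"
  shows "\<exists>i. b = a ^ i"
proof -
  have pw: "a ^ p = 1" using sgp_power_card[OF assms(1,4)] assms(2) by simp
  have eq: "gen (insert a {1}) = (\<lambda>(i, s). a ^ i * s) ` ({..<p} \<times> {1})"
    by (rule gen_insert_normal) (use pw prime_gt_0_nat[OF assms(3)] in auto)
  let ?C = "gen (insert a {1})"
  have C: "?C \<subseteq> B" using assms by (intro gen_subset) (auto simp: sgp_one)
  have fB: "finite B" using assms(2,3) by (metis card.infinite not_prime_0)
  have "card ?C dvd p" using card_sgp_dvd[OF assms(1) sgp_gen C] assms(2) by simp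
  then have "card ?C = 1 \<or> card ?C = p" using assms(3) by (simp add: prime_nat_iff)
  moreover have "card ?C \<noteq> 1"
  proof
    assume "card ?C = 1"
    then obtain c where "?C = {c}" by (auto simp: card_Suc_eq)
    moreover have "a \<in> ?C" "1 \<in> ?C" by (auto intro: gen_base)
    ultimately show False using assms(5) by auto
  qed
  ultimately have "?C = B" using card_subset_eq[OF fB C] assms(2) by simp
  then show ?thesis using assms(6) unfolding eq by auto
qed

text \<open>What a Beauville structure says about the powers of the four generators
  themselves.\<close>

definition weakly_beauville :: "'a::grp set \<Rightarrow> bool" where
  "weakly_beauville H \<longleftrightarrow> (\<exists>x1 y1 x2 y2. gen {x1, y1} = H \<and> gen {x2, y2} = H \<and>
     (\<forall>u\<in>{x1, y1}. \<forall>v\<in>{x2, y2}. \<forall>i j. u ^ i = v ^ j \<longrightarrow> u ^ i = 1))"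

context regular_pgrp
begin

text \<open>\<open>e\<close> is maximal with some \<open>p ^ e\<close>-th power nontrivial. Then
  \<open>om (p ^ e) H\<close> is a proper subgroup and each generating pair has a member outside it.
  If there were only \<open>p\<close> many \<open>p ^ e\<close>-th powers, powers of two such
  members would meet nontrivially.\<close>

lemma weakly_beauville_power_card:
  assumes wb: "weakly_beauville H" and "k > 0"
  obtains e where "\<And>g. g \<in> H \<Longrightarrow> g ^ p ^ Suc e = 1" "p\<^sup>2 \<le> card (pw (p ^ e) H)"
proof -
  define E where "E = (LEAST e. \<forall>g\<in>H. g ^ p ^ e = 1)"
  have E: "\<forall>g\<in>H. g ^ p ^ E = 1"
    unfolding E_def by (rule LeastI[of _ k]) (simp add: pgrp_power_card[OF pgrp])
  have "E \<noteq> 0"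
  proof
    assume "E = 0"
    then have "H \<subseteq> {1}" using E by auto
    then have "card H \<le> 1" using card_mono[of "{1}" H] by simp
    then show False using card one_less_power[OF p_gt_1 assms(2)] by simp
  qed
  then obtain e where e: "E = Suc e" by (cases E) auto
  let ?q = "p ^ e"
  have ex: "\<not> (\<forall>g\<in>H. g ^ ?q = 1)" 
    using not_less_Least[of e "\<lambda>e. \<forall>g\<in>H. g ^ p ^ e = 1"] e unfolding E_def by simp
  obtain j where j: "pgrp p j (pw ?q H)" using pgrp_subgroup[OF pgrp sgp_pw pw_subset] .
  have "j \<noteq> 0"
  proof
    assume "j = 0"
    then have "card (pw ?q H) = 1" using j by (simp add: pgrp_def)
    then obtain c where "pw ?q H = {c}" by (auto simp: card_Suc_eq)
    then have "pw ?q H = {1}" using sgp_one[OF sgp_pw[of e]] by simp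
    then show False using ex by (auto simp: pw_def)
  qed
  moreover have "j \<noteq> 1"
  proof
    assume "j = 1"
    then have cB: "card (pw ?q H) = p" using j by (simp add: pgrp_def)
    obtain x1 y1 x2 y2 where g: "gen {x1, y1} = H" "gen {x2, y2} = H"
      and b: "\<forall>u\<in>{x1, y1}. \<forall>v\<in>{x2, y2}. \<forall>i j. u ^ i = v ^ j \<longrightarrow> u ^ i = 1"
      using wb by (auto simp: weakly_beauville_def)
    have nt: "\<exists>u\<in>{x, y}. u \<in> H \<and> u ^ ?q \<noteq> 1" if "gen {x, y} = H" for x y
    proof (rule ccontr)
      assume neg: "\<not> ?thesis"
      have "{x, y} \<subseteq> H" using gen_superset[of "{x, y}"] that by simp
      then have "gen {x, y} \<subseteq> om ?q H" using neg by (intro gen_subset sgp_om) (auto simp: om_def)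
      then show False using that ex by (auto simp: om_def)
    qed
    obtain u where u: "u \<in> {x1, y1}" "u \<in> H" "u ^ ?q \<noteq> 1" using nt[OF g(1)] by blast
    obtain v where v: "v \<in> {x2, y2}" "v \<in> H" "v ^ ?q \<noteq> 1" using nt[OF g(2)] by blast
    have "\<exists>i. v ^ ?q = (u ^ ?q) ^ i"
      by (rule prime_card_generator[OF sgp_pw cB prime]) (use u v in \<open>auto simp: pw_def\<close>)
    then obtain i where "u ^ (?q * i) = v ^ ?q" by (auto simp: power_mult)
    then show False using b u v by metis
  qed
  ultimately have "p ^ 2 \<le> p ^ j" using p_gt_1 by (intro power_increasing) auto
  then show ?thesis using that[of e] E e j by (simp add: pgrp_def)
qed

text \<open>A \<open>p ^ e\<close>-th power is killed by \<open>p\<close> and is a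
  \<open>p ^ i\<close>-th power, so it lies in \<open>om p\<close> of the group of
  \<open>p ^ i\<close>-th powers; \<open>card_om_pw\<close> for that group gives the
  inequality.\<close>

lemma pw_card_growth:
  assumes e: "\<And>g. g \<in> H \<Longrightarrow> g ^ p ^ Suc e = 1" and "i \<le> e"
  shows "card (pw (p ^ e) H) * card (pw (p ^ Suc i) H) \<le> card (pw (p ^ i) H)"
    "pw (p ^ e) H \<subseteq> om p (pw (p ^ i) H)"
proof -
  obtain j where "regular_pgrp p j (pw (p ^ i) H)" using regular_subgroup[OF sgp_pw pw_subset] .
  then interpret P: regular_pgrp p j "pw (p ^ i) H" .
  have "x ^ p ^ e = (x ^ p ^ (e - i)) ^ p ^ i" for x :: 'a
    using assms(2) by (simp flip: power_mult power_add)
  then have "x ^ p ^ e \<in> pw (p ^ i) H" if "x \<in> H" for x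
    using that closed by (auto simp: pw_def)
  moreover have "(x ^ p ^ e) ^ p = 1" if "x \<in> H" for x
    using e[OF that] by (simp add: power_mult[symmetric] mult.commute)
  ultimately show *: "pw (p ^ e) H \<subseteq> om p (pw (p ^ i) H)"
    by (auto simp: pw_def[of "p ^ e"] om_def)
  have "finite (om p (pw (p ^ i) H))" using P.finite by (simp add: om_def)
  then have "card (pw (p ^ e) H) \<le> card (om p (pw (p ^ i) H))" using * by (intro card_mono)
  then show "card (pw (p ^ e) H) * card (pw (p ^ Suc i) H) \<le> card (pw (p ^ i) H)"
    using P.card_om_pw[of 1] pw_pw[of p "p ^ i"] by (simp add: mult.commute)
qed

text \<open>The growth estimate is iterated downwards from the trivial group of
  \<open>p ^ (e + 1)\<close>-th powers. With \<open>c = p ^ 2\<close> and \<open>i = Suc e\<close>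
  it bounds \<open>p ^ (2 * Suc e)\<close> by the order of \<open>H\<close>.\<close>

lemma pw_card_ge:
  assumes e: "\<And>g. g \<in> H \<Longrightarrow> g ^ p ^ Suc e = 1" and c: "c \<le> card (pw (p ^ e) H)" and "i \<le> Suc e"
  shows "c ^ i \<le> card (pw (p ^ (Suc e - i)) H)"
  using assms(3)
proof (induction i)
  case 0
  have "pw (p ^ Suc e) H = {1}" using e closed by (auto simp: pw_def image_iff)
  then show ?case by simp
next
  case (Suc i)
  have "c ^ Suc i \<le> card (pw (p ^ e) H) * card (pw (p ^ (Suc e - i)) H)"
    using Suc c by (simp add: mult_le_mono)
  also have "\<dots> \<le> card (pw (p ^ (Suc e - Suc i)) H)"
    using pw_card_growth(1)[OF e, of "e - i"] Suc.prems by (simp add: Suc_diff_le)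
  finally show ?case .
qed

end

subsection \<open>Isomorphisms from common relations\<close>

instantiation prod :: (grp, grp) grp
begin

definition times_prod where "x * y = (fst x * fst y, snd x * snd y)" for x y :: "'a \<times> 'b"
definition one_prod where "1 = (1 :: 'a, 1 :: 'b)"
definition inverse_prod where "inverse x = (inverse (fst x), inverse (snd x))" for x :: "'a \<times> 'b"
definition divide_prod where "divide x y = x * inverse y" for x y :: "'a \<times> 'b"

instance by standard (auto simp: times_prod_def one_prod_def inverse_prod_def mult.assoc)

end

lemma fst_times [simp]: "fst (x * y) = fst x * fst (y :: 'a::grp \<times> 'b::grp)"
  and snd_times [simp]: "snd (x * y) = snd x * snd (y :: 'a::grp \<times> 'b::grp)"
  and fst_one [simp]: "fst (1 :: 'a::grp \<times> 'b::grp) = 1"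
  and snd_one [simp]: "snd (1 :: 'a::grp \<times> 'b::grp) = 1"
  and fst_inverse [simp]: "fst (inverse x :: 'a::grp \<times> 'b::grp) = inverse (fst x)"
  and snd_inverse [simp]: "snd (inverse x :: 'a::grp \<times> 'b::grp) = inverse (snd x)"
  by (auto simp: times_prod_def one_prod_def inverse_prod_def)

lemma gen_image:
  fixes f :: "'a::grp \<Rightarrow> 'b::grp"
  assumes f: "\<And>a b. a \<in> gen A \<Longrightarrow> b \<in> gen A \<Longrightarrow> f (a * b) = f a * f b"
  shows "f ` gen A = gen (f ` A)"
proof
  have one: "f 1 = 1"
    using f[of 1 1] by (simp add: gen_one)
  have inv: "f (inverse a) = inverse (f a)" if "a \<in> gen A" for a
    using f[of a "inverse a"] that one by (intro grp_inverse_unique[symmetric]) (simp add: gen_inverse)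
  have "f a \<in> gen (f ` A)" if "a \<in> gen A" for a
    using that by induction (auto simp: one f inv intro: gen.intros)
  then show "f ` gen A \<subseteq> gen (f ` A)" by blast
  have "sgp (f ` gen A)"
  proof (rule sgpI)
    show "1 \<in> f ` gen A" using one gen_one by (intro image_eqI[of _ _ 1]) auto
    show "a * b \<in> f ` gen A" if "a \<in> f ` gen A" "b \<in> f ` gen A" for a b
      using that by (auto simp: gen_mult simp flip: f)
    show "inverse a \<in> f ` gen A" if "a \<in> f ` gen A" for a
      using that by (auto simp: gen_inverse simp flip: inv)
  qed
  then show "gen (f ` A) \<subseteq> f ` gen A" by (intro gen_subset) (auto intro: gen_base)
qed

text \<open>The subgroup of the product generated by \<open>(x, x')\<close> and
  \<open>(y, y')\<close> projects onto both groups. Having order at most \<open>n\<close>, it is the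
  graph of an isomorphism.\<close>

lemma iso_of_common_relations:
  fixes x y :: "'a::grp" and x' y' :: "'b::grp"
  assumes G: "gen {x, y} = G" "card G = n" and G': "gen {x', y'} = G'" "card G' = n"
    and K: "finite (gen {(x, x'), (y, y')})" "card (gen {(x, x'), (y, y')}) \<le> n"
  shows "mon G \<cong> mon G'"
proof -
  let ?K = "gen {(x, x'), (y, y')}"
  have img: "fst ` ?K = G" "snd ` ?K = G'"
    using gen_image[of "{(x, x'), (y, y')}" fst] gen_image[of "{(x, x'), (y, y')}" snd] G G' by simp_all
  have "card (fst ` ?K) = card ?K" "card (snd ` ?K) = card ?K"
    using card_image_le[OF K(1), of fst] card_image_le[OF K(1), of snd] K(2) G G' img by simp_all
  then have "inj_on fst ?K" "inj_on snd ?K"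
    using K(1) by (auto intro: eq_card_imp_inj_on)
  then have "fst \<in> iso (mon ?K) (mon G)" "snd \<in> iso (mon ?K) (mon G')"
    using img by (auto simp: iso_def hom_def bij_betw_def)
  then have "mon ?K \<cong> mon G" "mon ?K \<cong> mon G'" by (auto simp: is_iso_def)
  then show ?thesis
    using group.iso_sym[OF group_mon[OF sgp_gen]] iso_trans by blast
qed

subsection \<open>Every group is a subgroup of a symmetric group\<close>

typedef 'a symm = "{f :: 'a \<Rightarrow> 'a. bij f}" morphisms app Symm
  by (rule exI[of _ id]) simp

setup_lifting type_definition_symm

instantiation symm :: (type) grp
begin

lift_definition times_symm :: "'a symm \<Rightarrow> 'a symm \<Rightarrow> 'a symm" is "(\<circ>)" by (rule bij_comp)
lift_definition one_symm :: "'a symm" is id by simp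
lift_definition inverse_symm :: "'a symm \<Rightarrow> 'a symm" is "inv_into UNIV" by (rule bij_imp_bij_inv)
definition divide_symm :: "'a symm \<Rightarrow> 'a symm \<Rightarrow> 'a symm" where "divide_symm x y = x * inverse y"

instance
  by standard (transfer; auto simp: fun_eq_iff bij_is_inj inv_f_f)+

end

lemma (in group) cayley:
  obtains H :: "'a symm set" and f where "sgp H" "f \<in> iso G (mon H)"
proof -
  define f where "f g = Symm (\<lambda>a. if a \<in> carrier G then g \<otimes> a else a)" for g
  have bij: "bij (\<lambda>a. if a \<in> carrier G then g \<otimes> a else a)" if g: "g \<in> carrier G" for g
  proof (rule o_bij)
    let ?h = "\<lambda>a. if a \<in> carrier G then inv g \<otimes> a else a"
    show "?h \<circ> (\<lambda>a. if a \<in> carrier G then g \<otimes> a else a) = id"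
      using g by (auto simp: fun_eq_iff m_assoc[symmetric])
    show "(\<lambda>a. if a \<in> carrier G then g \<otimes> a else a) \<circ> ?h = id"
      using g by (auto simp: fun_eq_iff m_assoc[symmetric])
  qed
  have app: "app (f g) = (\<lambda>a. if a \<in> carrier G then g \<otimes> a else a)" if "g \<in> carrier G" for g
    unfolding f_def using bij[OF that] by (simp add: Symm_inverse)
  have mult: "f (g \<otimes> h) = f g * f h" if "g \<in> carrier G" "h \<in> carrier G" for g h
    using that by (auto simp: app_inject[symmetric] app times_symm.rep_eq fun_eq_iff m_assoc)
  have inj: "inj_on f (carrier G)"
  proof (rule inj_onI)
    fix g h assume gh: "g \<in> carrier G" "h \<in> carrier G" "f g = f h"
    have "app (f g) \<one> = app (f h) \<one>" by (simp only: gh(3))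
    then show "g = h" using gh(1,2) by (simp only: app[OF gh(1)] app[OF gh(2)]) simp
  qed
  have "f \<one> = 1" using mult[of \<one> \<one>] by simp
  moreover have "inverse (f g) = f (inv g)" if "g \<in> carrier G" for g
    using mult[of g "inv g"] that calculation by (intro grp_inverse_unique) simp
  ultimately have "sgp (f ` carrier G)"
    by (intro sgpI) (auto simp flip: mult intro: rev_image_eqI[of \<one>])
  moreover have "f \<in> iso G (mon (f ` carrier G))"
    using mult inj by (auto simp: iso_def hom_def bij_betw_def)
  ultimately show ?thesis using that by blast
qed

subsection \<open>Integer powers\<close>

definition zp :: "'a::grp \<Rightarrow> int \<Rightarrow> 'a" where
  "zp a i = a [^]\<^bsub>mon UNIV\<^esub> i"

interpretation U: group "mon (UNIV :: 'a::grp set)"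
  by (rule group_mon) (simp add: sgp_def)

lemma zp_of_nat [simp]: "zp a (int n) = a ^ n"
  by (simp add: zp_def int_pow_int pow_mon)

lemma zp_0 [simp]: "zp a 0 = 1" and zp_1 [simp]: "zp a 1 = a"
  by (simp_all add: zp_def)

lemma zp_add: "zp a (i + j) = zp a i * zp a j"
  by (simp add: zp_def U.int_pow_mult)

lemma zp_minus: "zp a (- i) = inverse (zp a i)"
  by (rule grp_inverse_unique[symmetric]) (simp flip: zp_add)

lemma zp_zp: "zp (zp a i) j = zp a (i * j)"
  by (simp add: zp_def U.int_pow_pow)

lemma zp_one [simp]: "zp 1 i = 1"
  using zp_zp[of 1 0 i] by simp

lemma zp_power: "zp a i ^ n = zp a (i * int n)"
  using zp_zp[of a i "int n"] by simp

lemma zp_commute_mult: "a * b = b * a \<Longrightarrow> zp (a * b) i = zp a i * zp b i"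
  unfolding zp_def by (rule U.int_pow_mult_distrib[unfolded mon_simps]) simp_all

lemma zp_cj: "zp (cj g a) i = cj g (zp a i)"
  by (cases i rule: int_cases2) (simp_all add: cj_power cj_inverse zp_minus)

lemma zp_commute1: "a * b = b * a \<Longrightarrow> zp a i * b = b * zp a i"
  using zp_cj[of b a i] cj_eq_iff_commute by metis

lemma zp_commute: "a * b = b * a \<Longrightarrow> zp a i * zp b j = zp b j * zp a i"
  by (metis zp_commute1)

lemma zp_cong:
  assumes "a ^ n = 1" "int n dvd i - j"
  shows "zp a i = zp a j"
proof -
  obtain m where "i = j + int n * m" using assms(2) by (auto simp: dvd_def algebra_simps)
  then show ?thesis using assms(1) by (simp add: zp_add flip: zp_zp)
qed

lemma sgp_zp: "sgp H \<Longrightarrow> a \<in> H \<Longrightarrow> zp a i \<in> H"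
  by (cases i rule: int_cases2) (simp_all add: zp_minus sgp_power sgp_inverse)

subsection \<open>Polycyclic relations\<close>

text \<open>Each member has its \<open>p\<close>-th power in the subgroup generated by the later
  ones and normalises that subgroup, so it contributes a factor of at most \<open>p\<close> to the
  order.\<close>

primrec polycyclic :: "nat \<Rightarrow> 'a::grp list \<Rightarrow> bool" where
  "polycyclic p [] \<longleftrightarrow> True"
| "polycyclic p (k # ks) \<longleftrightarrow>
    k ^ p \<in> gen (set ks) \<and> (\<forall>a\<in>set ks. cj k a \<in> gen (set ks)) \<and> polycyclic p ks"

lemma gen_empty: "gen {} = {1}"
  using gen_subset[of "{}" "{1}"] gen_one[of "{}"] by auto

lemma gen_insert_gen: "gen (insert a (gen A)) = gen (insert a A)"
proof
  show "gen (insert a (gen A)) \<subseteq> gen (insert a A)"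
    using gen_mono[of A "insert a A"] by (intro gen_subset) (auto intro: gen_base)
  show "gen (insert a A) \<subseteq> gen (insert a (gen A))"
    by (rule gen_mono) (auto intro: gen_base)
qed

lemma polycyclic_card:
  "polycyclic p ks \<Longrightarrow> p > 0 \<Longrightarrow> finite (gen (set ks)) \<and> card (gen (set ks)) \<le> p ^ length ks"
proof (induction ks)
  case (Cons k ks)
  have cj: "cj k s \<in> gen (set ks)" if "s \<in> gen (set ks)" for s
    using gen_cj_closed[OF _ that] Cons.prems by simp
  have "finite (gen (insert k (gen (set ks))))"
    "card (gen (insert k (gen (set ks)))) \<le> p * card (gen (set ks))"
    by (rule card_gen_insert_le; use Cons cj in simp)+
  moreover have "p * card (gen (set ks)) \<le> p * p ^ length ks" using Cons by (intro mult_le_mono) auto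
  ultimately show ?case by (simp add: gen_insert_gen order_trans)
qed (simp add: gen_empty)

lemma fst_power [simp]: "fst (x ^ n) = fst x ^ n" and snd_power [simp]: "snd (x ^ n) = snd x ^ n"
  for x :: "'a::grp \<times> 'b::grp"
  by (induction n) auto

lemma fst_zp [simp]: "fst (zp x i) = zp (fst x) i" and snd_zp [simp]: "snd (zp x i) = zp (snd x) i"
  for x :: "'a::grp \<times> 'b::grp"
  by (cases i rule: int_cases2; simp add: zp_minus)+

lemma fst_cm [simp]: "fst (cm x y) = cm (fst x) (fst y)" and snd_cm [simp]: "snd (cm x y) = cm (snd x) (snd y)"
  for x :: "'a::grp \<times> 'b::grp"
  by (auto simp: cm_def)

lemma coprime_power_generates:
  assumes "g ^ n = 1" "coprime i (int n)"
  shows "g \<in> gen {zp g i}"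
proof -
  obtain j where "[i * j = 1] (mod int n)" using cong_solve_coprime_int[OF assms(2)] by blast
  then have "zp g (i * j) = zp g 1"
    by (intro zp_cong[OF assms(1)]) (simp add: cong_iff_dvd_diff)
  then have "zp (zp g i) j = g" by (simp only: zp_zp zp_1)
  moreover have "zp (zp g i) j \<in> gen {zp g i}" by (rule sgp_zp[OF sgp_gen gen_base]) simp
  ultimately show ?thesis by simp
qed

lemma gen_pair_eqI:
  assumes "gen {x, y} = G" "x \<in> gen {x', y'}" "y \<in> gen {x', y'}" "x' \<in> G" "y' \<in> G"
  shows "gen {x', y'} = G"
  using assms gen_subset[of "{x, y}" "gen {x', y'}"] gen_subset[of "{x', y'}" G] sgp_gen[of "{x, y}"] by auto

text \<open>Coordinates on an abelian subgroup. In the first two presentations below, conjugation by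
  the generators is linear in such coordinates, which turns commutator identities into identities
  between integers.\<close>

locale commuting =
  fixes u1 u2 u3 u4 :: "'a::grp"
  assumes comm: "u2 * u1 = u1 * u2" "u3 * u1 = u1 * u3" "u4 * u1 = u1 * u4"
    "u3 * u2 = u2 * u3" "u4 * u2 = u2 * u4" "u4 * u3 = u3 * u4"
begin

definition E :: "int \<Rightarrow> int \<Rightarrow> int \<Rightarrow> int \<Rightarrow> 'a" where
  "E i j k l = zp u1 i * (zp u2 j * (zp u3 k * zp u4 l))"

lemma sort: 
  "zp u2 j * zp u1 i = zp u1 i * zp u2 j" "zp u2 j * (zp u1 i * t) = zp u1 i * (zp u2 j * t)"
  "zp u3 j * zp u1 i = zp u1 i * zp u3 j" "zp u3 j * (zp u1 i * t) = zp u1 i * (zp u3 j * t)"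
  "zp u4 j * zp u1 i = zp u1 i * zp u4 j" "zp u4 j * (zp u1 i * t) = zp u1 i * (zp u4 j * t)"
  "zp u3 j * zp u2 i = zp u2 i * zp u3 j" "zp u3 j * (zp u2 i * t) = zp u2 i * (zp u3 j * t)"
  "zp u4 j * zp u2 i = zp u2 i * zp u4 j" "zp u4 j * (zp u2 i * t) = zp u2 i * (zp u4 j * t)"
  "zp u4 j * zp u3 i = zp u3 i * zp u4 j" "zp u4 j * (zp u3 i * t) = zp u3 i * (zp u4 j * t)"
  using comm[THEN zp_commute, of j i] by (simp_all flip: mult.assoc)

lemma merge: "zp u i * (zp u j * t) = zp u (i + j) * t"
  by (simp add: zp_add mult.assoc)

lemma E_mult: "E i j k l * E i' j' k' l' = E (i + i') (j + j') (k + k') (l + l')"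
  by (simp add: E_def mult.assoc sort merge flip: zp_add)

lemma E_one: "E 0 0 0 0 = 1" by (simp add: E_def)

lemma E_gens: "u1 = E 1 0 0 0" "u2 = E 0 1 0 0" "u3 = E 0 0 1 0" "u4 = E 0 0 0 1"
  by (simp_all add: E_def)

lemma zp_gens: "zp u1 i = E i 0 0 0" "zp u2 i = E 0 i 0 0" "zp u3 i = E 0 0 i 0" "zp u4 i = E 0 0 0 i"
  by (simp_all add: E_def)

lemma E_inverse: "inverse (E i j k l) = E (- i) (- j) (- k) (- l)"
  by (rule grp_inverse_unique) (simp add: E_mult E_one)

lemma E_power: "E i j k l ^ n = E (int n * i) (int n * j) (int n * k) (int n * l)"
  by (induction n) (simp_all add: E_mult E_one algebra_simps)

lemma E_zp: "zp (E i j k l) n = E (n * i) (n * j) (n * k) (n * l)"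
  by (cases n rule: int_cases2) (simp_all add: E_power E_inverse zp_minus)

lemma E_commute: "E i j k l * E i' j' k' l' = E i' j' k' l' * E i j k l"
  by (simp add: E_mult add.commute)

lemma cj_E: "cj g (E i j k l) = zp (cj g u1) i * (zp (cj g u2) j * (zp (cj g u3) k * zp (cj g u4) l))"
  by (simp add: E_def zp_cj)

lemma cm_E: "cm (E i j k l) g = E (- i) (- j) (- k) (- l) * cj g (E i j k l)"
  by (simp add: cm_def cj_def mult.assoc flip: E_inverse)

lemma E_in: "sgp H \<Longrightarrow> u1 \<in> H \<Longrightarrow> u2 \<in> H \<Longrightarrow> u3 \<in> H \<Longrightarrow> u4 \<in> H \<Longrightarrow> E i j k l \<in> H"
  by (simp add: E_def sgp_mult sgp_zp)

end

subsection \<open>Groups of exponent $p^2$ with $p^2$ many $p$-th powers\<close>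

text \<open>\<open>z\<close>, \<open>w\<close>, \<open>x ^ p\<close>, \<open>y ^ p\<close> span an
  elementary abelian normal subgroup, and \<open>x ^ p\<close>, \<open>y ^ p\<close> are central.
  The pair is normalised so that \<open>cm z y\<close> is a product of \<open>p\<close>-th powers;
  what stays free is the value of \<open>cm w x\<close> and \<open>cm z y\<close>.\<close>

definition rel2 :: "nat \<Rightarrow> 'a::grp \<Rightarrow> 'a \<Rightarrow> int \<Rightarrow> int \<Rightarrow> int \<Rightarrow> int \<Rightarrow> bool" where
  "rel2 p x y a b c d \<longleftrightarrow> (let z = cm x y; w = cm z x in
     (x ^ p) ^ p = 1 \<and> (y ^ p) ^ p = 1 \<and> z ^ p = 1 \<and> w ^ p = 1 \<and>
     x ^ p * y = y * x ^ p \<and> y ^ p * x = x * y ^ p \<and> w * z = z * w \<and> w * y = y * w \<and>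
     cm w x = zp (x ^ p) a * zp (y ^ p) b \<and> cm z y = zp (x ^ p) c * zp (y ^ p) d)"

lemma rel2_pair:
  "rel2 p (x, x') (y, y') a b c d \<longleftrightarrow> rel2 p x y a b c d \<and> rel2 p x' y' a b c d"
  by (auto simp: rel2_def Let_def prod_eq_iff)

locale case2 =
  fixes p :: nat and x y :: "'a::grp" and a b c d :: int
  assumes rel: "rel2 p x y a b c d" and p: "p > 0"
begin

abbreviation "z \<equiv> cm x y"
abbreviation "w \<equiv> cm z x"

lemma rels: "(x ^ p) ^ p = 1" "(y ^ p) ^ p = 1" "z ^ p = 1" "w ^ p = 1"
  "x ^ p * y = y * x ^ p" "y ^ p * x = x * y ^ p" "w * z = z * w" "w * y = y * w"
  "cm w x = zp (x ^ p) a * zp (y ^ p) b" "cm z y = zp (x ^ p) c * zp (y ^ p) d"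
  using rel by (auto simp: rel2_def Let_def)

lemma fixed: "cj y (x ^ p) = x ^ p" "cj x (y ^ p) = y ^ p" "cj x (x ^ p) = x ^ p" "cj y (y ^ p) = y ^ p"
  "cj y w = w"
  using rels by (simp_all add: cj_eq_iff_commute power_commutes)

lemma central: "g \<in> gen {x, y} \<Longrightarrow> x ^ p * g = g * x ^ p" "g \<in> gen {x, y} \<Longrightarrow> y ^ p * g = g * y ^ p"
proof -
  have "cj g u = u" if u: "cj x u = u" "cj y u = u" and g: "g \<in> gen {x, y}" for u
    using g
  proof induction
    case (gen_inverse g)
    then have "cj (inverse g) (cj g u) = cj (inverse g) u" by simp
    then show ?case by (simp add: cj_cj)
  qed (use u in \<open>auto simp flip: cj_cj\<close>)
  then show "g \<in> gen {x, y} \<Longrightarrow> x ^ p * g = g * x ^ p" "g \<in> gen {x, y} \<Longrightarrow> y ^ p * g = g * y ^ p"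
    using fixed by (simp_all flip: cj_eq_iff_commute)
qed

lemma mem: "x \<in> gen {x, y}" "y \<in> gen {x, y}" "z \<in> gen {x, y}" "w \<in> gen {x, y}"
  "x ^ p \<in> gen {x, y}" "y ^ p \<in> gen {x, y}"
  by (auto intro!: sgp_cm[OF sgp_gen] sgp_power[OF sgp_gen] intro: gen_base)

sublocale commuting z w "x ^ p" "y ^ p"
  by (unfold_locales; (rule rels(7) central(1)[OF mem(3)] central(2)[OF mem(3)]
        central(1)[OF mem(4)] central(2)[OF mem(4)] central(2)[OF mem(5)]))

lemma cj_gens: "cj x z = E 1 1 0 0" "cj x w = E 0 1 a b" "cj y z = E 1 0 c d"
  using rels by (simp_all add: cj_eq_cm E_def)

text \<open>On exponent vectors, which count modulo \<open>p\<close>, both generators act by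
  unipotent matrices.\<close>

lemma cj_x: "cj x (E i j k l) = E i (j + i) (k + a * j) (l + b * j)"
  by (simp add: cj_E cj_gens fixed zp_gens E_zp E_mult algebra_simps)

lemma cj_y: "cj y (E i j k l) = E i j (k + c * i) (l + d * i)"
  by (simp add: cj_E cj_gens fixed zp_gens E_zp E_mult algebra_simps)

lemma E_cong:
  assumes "int p dvd i - i'" "int p dvd j - j'" "int p dvd k - k'" "int p dvd l - l'"
  shows "E i j k l = E i' j' k' l'"
  unfolding E_def using zp_cong[OF rels(3) assms(1)] zp_cong[OF rels(4) assms(2)]
    zp_cong[OF rels(1) assms(3)] zp_cong[OF rels(2) assms(4)] by simp

lemma E_power_p: "E i j k l ^ p = 1"
  using E_cong[of "int p * i" 0 "int p * j" 0 "int p * k" 0 "int p * l" 0] E_one by (simp add: E_power)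

lemma cj_central:
  "cj z w = w" "cj z (x ^ p) = x ^ p" "cj z (y ^ p) = y ^ p" "cj w (x ^ p) = x ^ p" "cj w (y ^ p) = y ^ p"
  "cj (x ^ p) (y ^ p) = y ^ p"
  unfolding cj_eq_iff_commute by (rule comm)+

lemma polycyclic_rel2: "polycyclic p [x, y, z, w, x ^ p, y ^ p]"
proof -
  have "cj x y = y * inverse z" by (simp add: cj_eq_cm inverse_cm)
  moreover have "cj x z = z * w" "cj x w = w * (zp (x ^ p) a * zp (y ^ p) b)"
    "cj y z = z * (zp (x ^ p) c * zp (y ^ p) d)"
    using rels by (simp_all add: cj_eq_cm)
  ultimately show ?thesis
    by (simp add: fixed cj_central rels gen_one)
       (intro conjI gen_mult gen_inverse sgp_zp[OF sgp_gen]; rule gen_base; simp)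
qed

lemma gen_rel2: "gen (set [x, y, z, w, x ^ p, y ^ p]) = gen {x, y}"
proof
  show "gen (set [x, y, z, w, x ^ p, y ^ p]) \<subseteq> gen {x, y}"
    by (rule gen_subset) (use mem in auto)
qed (rule gen_mono, simp)

lemma card_rel2: "finite (gen {x, y})" "card (gen {x, y}) \<le> p ^ 6"
  using polycyclic_card[OF polycyclic_rel2 p] unfolding gen_rel2 by (simp_all add: eval_nat_numeral)

text \<open>To leading order \<open>z\<close> becomes \<open>z ^ n\<close> and \<open>w\<close>
  becomes \<open>w ^ (n ^ 2)\<close>. So \<open>cm w x\<close> is multiplied by \<open>n ^ 3\<close>
  and \<open>cm z y\<close> by \<open>n\<close>; rewriting in the new \<open>x ^ p\<close> divides
  the coefficients \<open>a\<close> and \<open>c\<close> by \<open>n\<close>.\<close>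

lemma scale_x:
  shows "rel2 p (x ^ n) y (int n ^ 2 * a) (int n ^ 3 * b) c (int n * d)"
proof -
  have 1: "\<exists>k' l'. cj (x ^ n) (E i j k l) = E i (j + int n * i) k' l'" for n i j k l
  proof (induction n)
    case (Suc n)
    then obtain k' l' where "cj (x ^ n) (E i j k l) = E i (j + int n * i) k' l'" by blast
    then have "cj (x ^ Suc n) (E i j k l) = cj x (E i (j + int n * i) k' l')"
      by (simp add: power_Suc2 del: power_Suc flip: cj_cj)
    then show ?case by (auto simp: cj_x algebra_simps)
  qed auto
  have 2: "cj (x ^ n) (E 0 j k l) = E 0 j (k + a * (int n * j)) (l + b * (int n * j))" for n j k l
  proof (induction n)
    case (Suc n)
    have "cj (x ^ Suc n) (E 0 j k l) = cj x (cj (x ^ n) (E 0 j k l))"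
      by (simp add: power_Suc2 cj_cj del: power_Suc)
    then show ?case using Suc by (simp add: cj_x algebra_simps)
  qed auto
  have 3: "\<exists>j k l. cm (x ^ n) y = E (int n) j k l" for n
  proof (induction n)
    case 0 show ?case using E_one by auto
  next
    case (Suc n)
    then obtain j k l where "cm (x ^ n) y = E (int n) j k l" by blast
    moreover obtain k' l' where "cj (x ^ n) z = E 1 (int n) k' l'"
      using 1[of n 1 0 0 0] by (auto simp flip: E_gens(1))
    ultimately show ?case by (auto simp: cm_mult_left E_mult)
  qed
  obtain j k l where z': "cm (x ^ n) y = E (int n) j k l" using 3 by blast
  obtain k' l' where w': "cm (E (int n) j k l) (x ^ n) = E 0 (int n * int n) k' l'"
    using 1[of n "int n" j k l] by (auto simp: cm_E E_mult)
  have P: "cm (E 0 (int n * int n) k' l') (x ^ n) = E 0 0 (a * (int n * (int n * int n))) (b * (int n * (int n * int n)))"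
    by (simp add: cm_E 2 E_mult)
  have Q: "cm (E (int n) j k l) y = E 0 0 (c * int n) (d * int n)"
    by (simp add: cm_E cj_y E_mult)
  have X': "(x ^ n) ^ p = E 0 0 (int n) 0"
    by (simp add: E_def flip: power_mult) (simp add: mult.commute)
  show ?thesis
    unfolding rel2_def Let_def z' w' P Q X'
  proof (intro conjI)
    show "E 0 0 (int n) 0 ^ p = 1" "E (int n) j k l ^ p = 1" "E 0 (int n * int n) k' l' ^ p = 1"
      by (rule E_power_p)+
    show "(y ^ p) ^ p = 1" by (rule rels)
    show "E 0 0 (int n) 0 * y = y * E 0 0 (int n) 0"
      by (simp flip: cj_eq_iff_commute add: cj_y)
    show "y ^ p * x ^ n = x ^ n * y ^ p"
      by (rule central) (rule sgp_power[OF sgp_gen mem(1)])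
    show "E 0 (int n * int n) k' l' * E (int n) j k l = E (int n) j k l * E 0 (int n * int n) k' l'"
      by (rule E_commute)
    show "E 0 (int n * int n) k' l' * y = y * E 0 (int n * int n) k' l'"
      by (simp flip: cj_eq_iff_commute add: cj_y)
    show "E 0 0 (a * (int n * (int n * int n))) (b * (int n * (int n * int n))) =
      zp (E 0 0 (int n) 0) (int n ^ 2 * a) * zp (y ^ p) (int n ^ 3 * b)"
      by (simp add: zp_gens E_zp E_mult power2_eq_square power3_eq_cube algebra_simps)
    show "E 0 0 (c * int n) (d * int n) = zp (E 0 0 (int n) 0) c * zp (y ^ p) (int n * d)"
      by (simp add: zp_gens E_zp E_mult algebra_simps)
  qed
qed

lemma cj_y_power: "cj (y ^ n) (E i j k l) = E i j (k + c * (int n * i)) (l + d * (int n * i))"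
proof (induction n)
  case (Suc n)
  have "cj (y ^ Suc n) (E i j k l) = cj y (cj (y ^ n) (E i j k l))"
    by (simp add: power_Suc2 cj_cj del: power_Suc)
  then show ?case using Suc by (simp add: cj_y algebra_simps)
qed auto

text \<open>Here \<open>z\<close> and \<open>w\<close> become \<open>n\<close>-th powers to leading
  order, \<open>cm z y\<close> is multiplied by \<open>n ^ 2\<close>, and the coefficients
  \<open>b\<close> and \<open>d\<close> are divided by \<open>n\<close> on passing to the new
  \<open>y ^ p\<close>.\<close>

lemma scale_y:
  shows "rel2 p x (y ^ n) (int n * a) b (int n ^ 2 * c) (int n * d)"
proof -
  have "\<exists>k l. cm x (y ^ n) = E (int n) 0 k l" for n
  proof (induction n)
    case 0 show ?case using E_one by auto
  next
    case (Suc n)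
    then obtain k l where "cm x (y ^ n) = E (int n) 0 k l" by blast
    moreover have "cm x (y ^ Suc n) = cm x (y ^ n) * cj (y ^ n) (E 1 0 0 0)"
      by (simp add: cm_mult_right flip: E_gens(1))
    ultimately have "cm x (y ^ Suc n) = E (int (Suc n)) 0 (k + c * int n) (l + d * int n)"
      by (simp add: cj_y_power E_mult add.commute)
    then show ?case by blast
  qed
  then obtain k l where z': "cm x (y ^ n) = E (int n) 0 k l" by blast
  have w': "cm (E (int n) 0 k l) x = E 0 (int n) 0 0" by (simp add: cm_E cj_x E_mult)
  have P: "cm (E 0 (int n) 0 0) x = E 0 0 (a * int n) (b * int n)" by (simp add: cm_E cj_x E_mult)
  have Q: "cm (E (int n) 0 k l) (y ^ n) = E 0 0 (c * (int n * int n)) (d * (int n * int n))"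
    by (simp add: cm_E cj_y_power E_mult)
  have Y': "(y ^ n) ^ p = E 0 0 0 (int n)"
    by (simp add: E_def flip: power_mult) (simp add: mult.commute)
  show ?thesis
    unfolding rel2_def Let_def z' w' P Q Y'
  proof (intro conjI)
    show "E 0 0 0 (int n) ^ p = 1" "E (int n) 0 k l ^ p = 1" "E 0 (int n) 0 0 ^ p = 1"
      by (rule E_power_p)+
    show "(x ^ p) ^ p = 1" by (rule rels)
    show "x ^ p * y ^ n = y ^ n * x ^ p"
      by (rule central) (rule sgp_power[OF sgp_gen mem(2)])
    show "E 0 0 0 (int n) * x = x * E 0 0 0 (int n)"
      by (simp flip: cj_eq_iff_commute add: cj_x)
    show "E 0 (int n) 0 0 * E (int n) 0 k l = E (int n) 0 k l * E 0 (int n) 0 0"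
      by (rule E_commute)
    show "E 0 (int n) 0 0 * y ^ n = y ^ n * E 0 (int n) 0 0"
      by (simp flip: cj_eq_iff_commute add: cj_y_power)
    show "E 0 0 (a * int n) (b * int n) = zp (x ^ p) (int n * a) * zp (E 0 0 0 (int n)) b"
      by (simp add: zp_gens E_zp E_mult algebra_simps)
    show "E 0 0 (c * (int n * int n)) (d * (int n * int n)) =
      zp (x ^ p) (int n ^ 2 * c) * zp (E 0 0 0 (int n)) (int n * d)"
      by (simp add: zp_gens E_zp E_mult power2_eq_square algebra_simps)
  qed
qed

text \<open>The two free commutators keep their values. Expressed with
  \<open>x ^ p * (y ^ p) ^ n\<close> in place of \<open>x ^ p\<close>, their second coefficients
  shift.\<close>

lemma shear:
  assumes X': "(x * y ^ n) ^ p = x ^ p * (y ^ p) ^ n"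
  shows "rel2 p (x * y ^ n) y a (b - int n * a) c (d - int n * c)"
proof -
  let ?n = "int n"
  have z': "cm (x * y ^ n) y = E 1 0 (c * ?n) (d * ?n)"
  proof -
    have "cm (y ^ n) y = 1" by (simp add: cm_eq_one_iff power_commutes)
    then have "cm (x * y ^ n) y = cj (y ^ n) (E 1 0 0 0)"
      by (simp add: cm_mult_left flip: E_gens(1))
    then show ?thesis by (simp add: cj_y_power)
  qed
  have w': "cm (E 1 0 (c * ?n) (d * ?n)) (x * y ^ n) = E 0 1 (c * ?n) (d * ?n)"
    by (simp add: cm_E cj_x cj_y_power E_mult flip: cj_cj)
  have P: "cm (E 0 1 (c * ?n) (d * ?n)) (x * y ^ n) = E 0 0 a b"
    by (simp add: cm_E cj_x cj_y_power E_mult flip: cj_cj)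
  have Q: "cm (E 1 0 (c * ?n) (d * ?n)) y = E 0 0 c d"
    by (simp add: cm_E cj_y E_mult)
  have X': "(x * y ^ n) ^ p = E 0 0 1 ?n" using X' by (simp add: E_def)
  show ?thesis
    unfolding rel2_def Let_def z' w' P Q X'
  proof (intro conjI)
    show "E 0 0 1 ?n ^ p = 1" "E 1 0 (c * ?n) (d * ?n) ^ p = 1" "E 0 1 (c * ?n) (d * ?n) ^ p = 1"
      by (rule E_power_p)+
    show "(y ^ p) ^ p = 1" by (rule rels)
    show "E 0 0 1 ?n * y = y * E 0 0 1 ?n" by (simp flip: cj_eq_iff_commute add: cj_y)
    show "y ^ p * (x * y ^ n) = x * y ^ n * y ^ p"
      by (rule central) (intro sgp_mult[OF sgp_gen] sgp_power[OF sgp_gen] mem)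
    show "E 0 1 (c * ?n) (d * ?n) * E 1 0 (c * ?n) (d * ?n) = E 1 0 (c * ?n) (d * ?n) * E 0 1 (c * ?n) (d * ?n)"
      by (rule E_commute)
    show "E 0 1 (c * ?n) (d * ?n) * y = y * E 0 1 (c * ?n) (d * ?n)"
      by (simp flip: cj_eq_iff_commute add: cj_y)
    show "E 0 0 a b = zp (E 0 0 1 ?n) a * zp (y ^ p) (b - ?n * a)"
      by (simp add: zp_gens E_zp E_mult algebra_simps)
    show "E 0 0 c d = zp (E 0 0 1 ?n) c * zp (y ^ p) (d - ?n * c)"
      by (simp add: zp_gens E_zp E_mult algebra_simps)
  qed
qed

end

lemma rel2_iso:
  fixes G :: "'a::grp set" and H :: "'b::grp set"
  assumes "p > 0" "rel2 p x y a b c d" "gen {x, y} = G" "card G = p ^ 6"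
    and "rel2 p x' y' a b c d" "gen {x', y'} = H" "card H = p ^ 6"
  shows "mon G \<cong> mon H"
proof -
  interpret case2 p "(x, x')" "(y, y')" a b c d
    by unfold_locales (use assms in \<open>simp_all add: rel2_pair\<close>)
  show ?thesis by (rule iso_of_common_relations[OF assms(3,4,6,7) card_rel2])
qed

section \<open>Residues modulo p and square classes\<close>

lemma coprime_prime_int: "prime p \<Longrightarrow> \<not> int p dvd a \<Longrightarrow> coprime a (int p)"
  by (metis coprime_commute prime_imp_coprime_int prime_nat_int_transfer)

lemma unit_solve:
  assumes "prime p" "\<not> int p dvd a"
  obtains n :: nat where "[int n * a = b] (mod int p)" "n > 0"
proof -
  obtain j where j: "[a * j = 1] (mod int p)"
    using cong_solve_coprime_int[OF coprime_prime_int[OF assms]] by blast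
  have p: "int p > 0" using assms(1) prime_gt_0_nat by simp
  define n where "n = nat ((j * b) mod int p) + p"
  have "[int n = j * b] (mod int p)"
    using p by (simp add: n_def cong_def)
  then have "[int n * a = j * b * a] (mod int p)" by (rule cong_scalar_right)
  also have "j * b * a = a * j * b" by simp
  also have "[a * j * b = 1 * b] (mod int p)" using j by (rule cong_scalar_right)
  finally have "[int n * a = b] (mod int p)" by simp
  then show ?thesis by (rule that) (use p in \<open>simp add: n_def\<close>)
qed

text \<open>\<open>n0\<close> stands for a fixed nonsquare: up to square factors every unit modulo
  \<open>p\<close> is 1 or \<open>n0\<close>.\<close>

definition square_class :: "nat \<Rightarrow> int \<Rightarrow> bool" where
  "square_class p n0 \<longleftrightarrow> (\<forall>d. \<not> int p dvd d \<longrightarrow>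
     (\<exists>v::nat. coprime (int v) (int p) \<and> ([int v ^ 2 * d = 1] (mod int p) \<or> [int v ^ 2 * d = n0] (mod int p))))"

text \<open>By Euler's criterion the product of two nonresidues is a residue, so any nonresidue can
  serve as \<open>n0\<close>.\<close>

lemma square_class_exists:
  assumes p: "prime p" "2 < p"
  shows "\<exists>n0. square_class p n0"
proof -
  \<comment> \<open>From \<open>s ^ 2 = d * r\<close> the scaling factor is \<open>v = s / d\<close>
    modulo \<open>p\<close>.\<close>
  have ex: "\<exists>v::nat. coprime (int v) (int p) \<and> [int v ^ 2 * d = r] (mod int p)"
    if sr: "[s ^ 2 = d * r] (mod int p)" and d: "\<not> int p dvd d" and r: "\<not> int p dvd r" for s d r
  proof -
    obtain v :: nat where v: "[int v * d = s] (mod int p)" using unit_solve[OF p(1) d] by blast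
    have "[(int v * d) ^ 2 = d * r] (mod int p)" using cong_pow[OF v, of 2] sr by (rule cong_trans)
    then have "[d * (int v ^ 2 * d) = d * r] (mod int p)" by (simp add: power2_eq_square ac_simps)
    then have *: "[int v ^ 2 * d = r] (mod int p)"
      using cong_mult_lcancel[OF coprime_prime_int[OF p(1) d]] by blast
    have "\<not> int p dvd int v"
    proof
      assume "int p dvd int v"
      then have "int p dvd int v ^ 2 * d" by (simp add: power2_eq_square)
      then show False using * r by (simp add: cong_dvd_iff flip: cong_0_iff) (metis cong_0_iff cong_sym cong_trans)
    qed
    then show ?thesis using * coprime_prime_int[OF p(1)] by blast
  qed
  have one: "\<not> int p dvd 1" using p by simp
  show ?thesis
  proof (cases "\<exists>n. \<not> int p dvd n \<and> \<not> QuadRes (int p) n")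
    case True
    then obtain n where n: "\<not> int p dvd n" "\<not> QuadRes (int p) n" by blast
    have L: "[- 1 = a ^ ((p - 1) div 2)] (mod int p)" if "\<not> int p dvd a" "\<not> QuadRes (int p) a" for a
      using euler_criterion[OF p, of a] that by (simp add: Legendre_def cong_0_iff)
    have "\<exists>v::nat. coprime (int v) (int p) \<and> ([int v ^ 2 * d = 1] (mod int p) \<or> [int v ^ 2 * d = n] (mod int p))"
      if d: "\<not> int p dvd d" for d
    proof (cases "QuadRes (int p) d")
      case True
      then obtain s where "[s ^ 2 = d * 1] (mod int p)" by (auto simp: QuadRes_def)
      then show ?thesis using ex[OF _ d one] by blast
    next
      case False
      have "[Legendre (d * n) (int p) = (d * n) ^ ((p - 1) div 2)] (mod int p)"
        by (rule euler_criterion[OF p])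
      also have "(d * n) ^ ((p - 1) div 2) = d ^ ((p - 1) div 2) * n ^ ((p - 1) div 2)"
        by (rule power_mult_distrib)
      also have "[\<dots> = (- 1) * (- 1)] (mod int p)"
        by (rule cong_sym) (rule cong_mult[OF L[OF d False] L[OF n]])
      finally have *: "[Legendre (d * n) (int p) = 1] (mod int p)" by simp
      have "QuadRes (int p) (d * n)"
      proof (rule ccontr)
        assume "\<not> ?thesis"
        then have "Legendre (d * n) (int p) = 0 \<or> Legendre (d * n) (int p) = - 1"
          by (simp add: Legendre_def)
        then have "int p dvd 1 \<or> int p dvd 2" using * by (auto simp: cong_iff_dvd_diff)
        then show False using p by (auto dest: zdvd_imp_le)
      qed
      then obtain s where "[s ^ 2 = d * n] (mod int p)" by (auto simp: QuadRes_def)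
      then show ?thesis using ex[OF _ d n(1)] by blast
    qed
    then show ?thesis by (auto simp: square_class_def)
  next
    case False
    have "\<exists>v::nat. coprime (int v) (int p) \<and> [int v ^ 2 * d = 1] (mod int p)" if d: "\<not> int p dvd d" for d
    proof -
      obtain s where "[s ^ 2 = d * 1] (mod int p)" using False d by (auto simp: QuadRes_def)
      then show ?thesis using ex[OF _ d one] by blast
    qed
    then show ?thesis unfolding square_class_def by blast
  qed
qed

section \<open>Commutators in sections of small order\<close>

lemma nrm_gen_Un:
  assumes "sgp H" "nrm A H" "nrm B H"
  shows "nrm (gen (A \<union> B)) H"
  unfolding nrm_def
proof (intro conjI ballI)
  show "gen (A \<union> B) \<subseteq> H" using assms by (intro gen_subset) (auto dest: nrm_subset)
  show "cj h n \<in> gen (A \<union> B)" if h: "h \<in> H" and n: "n \<in> gen (A \<union> B)" for h n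
  proof (rule gen_cj_closed[OF _ n])
    show "cj h a \<in> gen (A \<union> B)" if "a \<in> A \<union> B" for a
      using that nrm_cj[OF assms(2) h] nrm_cj[OF assms(3) h] by (intro gen_base) auto
  qed
qed simp

lemma cm_closed_gen_left:
  assumes "sgp H" "A \<subseteq> H" "nrm N H" "h \<in> H" "\<And>a. a \<in> A \<Longrightarrow> cm a h \<in> N" "g \<in> gen A"
  shows "cm g h \<in> N"
proof -
  note sN = nrm_sgp[OF assms(3)]
  have "g \<in> H \<and> cm g h \<in> N" using assms(6)
  proof induction
    case (gen_inverse a)
    have "cm (inverse a) h = cj (inverse a) (inverse (cm a h))"
      by (simp add: cm_def cj_def mult.assoc)
    then show ?case using gen_inverse sgp_inverse[OF assms(1)] sgp_inverse[OF sN] nrm_cj[OF assms(3)] by simp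
  next
    case (gen_mult a b)
    then show ?case
      using sgp_mult[OF assms(1)] sgp_mult[OF sN] nrm_cj[OF assms(3)] by (simp add: cm_mult_left)
  qed (use assms sgp_one[OF sN] sgp_one[OF assms(1)] in auto)
  then show ?thesis ..
qed

text \<open>\<open>B\<close> is generated by \<open>P\<close> and the commutators of
  \<open>A\<close> with \<open>H\<close>. If it were all of \<open>A\<close>, then \<open>A\<close>
  would lie in the subgroup generated by \<open>gam H i\<close> and \<open>P\<close> for every
  \<open>i\<close>, hence in \<open>P\<close>.\<close>

lemma cm_in_smaller_normal:
  assumes H: "pgrp p k H" and A: "nrm A H" and P: "nrm P H" "P \<subseteq> A" "P \<noteq> A"
  obtains B where "nrm B H" "P \<subseteq> B" "B \<subseteq> A" "B \<noteq> A" "\<And>a h. a \<in> A \<Longrightarrow> h \<in> H \<Longrightarrow> cm a h \<in> B"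
proof -
  note sH = pgrp_sgp[OF H]
  let ?C = "{cm a h |a h. a \<in> A \<and> h \<in> H}"
  define B where "B = gen (?C \<union> P)"
  have AH: "A \<subseteq> H" by (rule nrm_subset[OF A])
  have BA: "B \<subseteq> A" unfolding B_def
    by (rule gen_subset) (use P nrm_cm[OF A] nrm_sgp[OF A] in auto)
  have B: "nrm B H"
    unfolding nrm_def
  proof (intro conjI ballI)
    show "sgp B" "B \<subseteq> H" using BA AH by (auto simp: B_def)
    show "cj h n \<in> B" if hn: "h \<in> H" "n \<in> B" for h n
      using hn(2) unfolding B_def
    proof (rule gen_cj_closed[rotated])
      fix a assume "a \<in> ?C \<union> P"
      then show "cj h a \<in> gen (?C \<union> P)"
      proof
        assume "a \<in> ?C"
        then obtain b g where "a = cm b g" "b \<in> A" "g \<in> H" by blast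
        then have "cj h a \<in> ?C" using nrm_cj[OF A hn(1)] sgp_cj[OF sH hn(1)] by (auto simp: cj_cm)
        then show ?thesis by (intro gen_base) simp
      next
        assume "a \<in> P" then show ?thesis using nrm_cj[OF P(1) hn(1)] by (intro gen_base) simp
      qed
    qed
  qed
  have "B \<noteq> A"
  proof
    assume eq: "B = A"
    have "A \<subseteq> gen (gam H i \<union> P)" for i
    proof (induction i)
      case 0 then show ?case using AH gen_superset[of "H \<union> P"] by auto
    next
      case (Suc i)
      let ?N = "gen (gam H (Suc i) \<union> P)"
      have N: "nrm ?N H" by (rule nrm_gen_Un[OF sH gam_normal[OF sH] P(1)])
      have "cm a h \<in> ?N" if "a \<in> A" "h \<in> H" for a h
      proof (rule cm_closed_gen_left[OF sH _ N that(2)])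
        show "a \<in> gen (gam H i \<union> P)" using Suc that by blast
        show "gam H i \<union> P \<subseteq> H" using nrm_subset[OF gam_normal[OF sH]] nrm_subset[OF P(1)] by auto
        show "cm b h \<in> ?N" if "b \<in> gam H i \<union> P" for b
          using that gam_cm_self[OF sH _ \<open>h \<in> H\<close>] nrm_cm[OF P(1) _ \<open>h \<in> H\<close>] by (auto intro: gen_base)
      qed
      then have "gen (?C \<union> P) \<subseteq> ?N" by (intro gen_subset) (auto intro: gen_base)
      then show ?case using eq by (simp add: B_def)
    qed
    from this[of "Suc k"] have "A \<subseteq> gen ({1} \<union> P)" by (simp only: gam_pgrp_trivial[OF H])
    also have "\<dots> \<subseteq> P" using nrm_sgp[OF P(1)] by (intro gen_subset) (auto simp: sgp_one)
    finally show False using P by blast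
  qed
  moreover have "P \<subseteq> B" "\<And>a h. a \<in> A \<Longrightarrow> h \<in> H \<Longrightarrow> cm a h \<in> B"
    unfolding B_def by (auto intro: gen_base)
  ultimately show ?thesis using that B BA by blast
qed

text \<open>No power of \<open>p\<close> lies strictly between the orders of \<open>P\<close> and
  \<open>A\<close>, so the subgroup from \<open>cm_in_smaller_normal\<close> is \<open>P\<close>
  itself: normal sections of order \<open>p\<close> are central.\<close>

lemma cm_in_index_p:
  assumes H: "pgrp p k H" and A: "nrm A H" and P: "nrm P H" "P \<subseteq> A" and c: "card A = p * card P"
    and a: "a \<in> A" "h \<in> H"
  shows "cm a h \<in> P"
proof -
  have p: "p > 1" using prime_gt_1_nat[OF pgrp_prime[OF H]] .
  have fin: "finite A" using finite_subset[OF nrm_subset[OF A] pgrp_finite[OF H]] .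
  obtain j where j: "pgrp p j P" using pgrp_subgroup[OF H nrm_sgp[OF P(1)] nrm_subset[OF P(1)]] .
  have "P \<noteq> A"
  proof
    assume "P = A" then have "p ^ j = p * p ^ j" using c j by (simp add: pgrp_def)
    then show False using p by simp
  qed
  then obtain B where B: "nrm B H" "P \<subseteq> B" "B \<subseteq> A" "B \<noteq> A" "\<And>a h. a \<in> A \<Longrightarrow> h \<in> H \<Longrightarrow> cm a h \<in> B"
    using cm_in_smaller_normal[OF H A P] by metis
  obtain i where i: "pgrp p i B" using pgrp_subgroup[OF H nrm_sgp[OF B(1)] nrm_subset[OF B(1)]] .
  have "card B < card A" using psubset_card_mono[OF fin, of B] B by auto
  then have "p ^ i < p ^ Suc j" using c i j by (simp add: pgrp_def)
  then have "i \<le> j" using p by (simp add: power_strict_increasing_iff less_Suc_eq_le del: power_Suc)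
  then have "P = B" using pgrp_subset_eq[OF i j B(2)] by simp
  then show ?thesis using B(5) a by simp
qed

text \<open>A group whose centre has index at most \<open>p\<close> is abelian, applied to
  \<open>H / N\<close>.\<close>

lemma ucen_index_p:
  assumes H: "pgrp p k H" and N: "nrm N H" and i: "pgrp p i (ucen H N)" "k \<le> Suc i"
  shows "ucen H N = H"
proof (rule ccontr)
  note sH = pgrp_sgp[OF H] and U = ucen_normal[OF pgrp_sgp[OF H] N]
  let ?U = "ucen H N"
  assume ne: "?U \<noteq> H"
  then obtain t where t: "t \<in> H" "t \<notin> ?U" using nrm_subset[OF U(1)] by blast
  let ?L = "gen (insert t ?U)"
  have LH: "?L \<subseteq> H" using t nrm_subset[OF U(1)] sH by (intro gen_subset) auto
  obtain l where l: "pgrp p l ?L" using pgrp_subgroup[OF H sgp_gen LH] .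
  have UL: "?U \<subseteq> ?L" "t \<in> ?L" by (auto intro: gen_base)
  then have "i < l" using pgrp_subset_eq[OF l i(1) UL(1)] t by force
  then have "?L = H" using pgrp_subset_eq[OF H l LH] i(2) by simp
  have "cm g h \<in> N" if "g \<in> H" "h \<in> H" for g h
  proof (rule cm_closed_gen[OF sH _ N _ that])
    show "H = gen (insert t ?U)" using \<open>?L = H\<close> by simp
    fix a b assume ab: "a \<in> insert t ?U" "b \<in> insert t ?U"
    have "cm u v \<in> N \<and> cm v u \<in> N" if "u \<in> ?U" "v \<in> H" for u v
      using that sgp_inverse[OF nrm_sgp[OF N], of "cm u v"] by (simp add: ucen_def inverse_cm)
    then show "cm a b \<in> N" using ab t nrm_subset[OF U(1)] sgp_one[OF nrm_sgp[OF N]] by auto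
  qed
  then show False using ne by (auto simp: ucen_def)
qed

lemma ucen_card:
  assumes H: "pgrp p k H" and N: "nrm N H" and c: "card H = p ^ r * card N" "r > 0"
  obtains i where "pgrp p i (ucen H N)" "k < r + i"
proof -
  note U = ucen_normal[OF pgrp_sgp[OF H] N]
  have p: "p > 1" using prime_gt_1_nat[OF pgrp_prime[OF H]] .
  obtain j where j: "pgrp p j N" using pgrp_subgroup[OF H nrm_sgp[OF N] nrm_subset[OF N]] .
  obtain i where i: "pgrp p i (ucen H N)" using pgrp_subgroup[OF H nrm_sgp[OF U(1)] nrm_subset[OF U(1)]] .
  have "p ^ k = p ^ (r + j)" using c(1) by (simp only: pgrp_card[OF H] pgrp_card[OF j] power_add)
  then have k: "k = r + j" by (simp only: power_inject_exp[OF p])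
  have "N \<noteq> H"
  proof
    assume "N = H" then have "p ^ k = p ^ j" using H j by (simp add: pgrp_def)
    then show False using k c(2) by (simp add: power_inject_exp[OF p])
  qed
  then have "ucen H N \<noteq> N" using ucen_proper[OF H N] by simp
  then have "j < i" using pgrp_subset_eq[OF i j U(2)] by force
  then show ?thesis using that i k by simp
qed

text \<open>Groups of order \<open>p ^ 2\<close> are abelian, applied to
  \<open>H / N\<close>.\<close>

lemma cm_in_index_p2:
  assumes H: "pgrp p k H" and N: "nrm N H" and c: "card H = p\<^sup>2 * card N"
    and gh: "g \<in> H" "h \<in> H"
  shows "cm g h \<in> N"
proof -
  obtain i where i: "pgrp p i (ucen H N)" "k < 2 + i" using ucen_card[OF H N c] by auto
  then have "ucen H N = H" by (intro ucen_index_p[OF H N i(1)]) simp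
  then show ?thesis using gh by (auto simp: ucen_def)
qed

text \<open>Groups of order \<open>p ^ 3\<close> have class at most 2, applied to
  \<open>H / N\<close>.\<close>

lemma cm_cm_in_index_p3:
  assumes H: "pgrp p k H" and N: "nrm N H" and c: "card H = p ^ 3 * card N"
    and gh: "g \<in> H" "h \<in> H" "l \<in> H"
  shows "cm (cm g h) l \<in> N"
proof -
  note U = ucen_normal[OF pgrp_sgp[OF H] N]
  obtain i where i: "pgrp p i (ucen H N)" "k < 3 + i" using ucen_card[OF H N c] by auto
  have "i \<le> k"
  proof -
    have "p ^ i \<le> p ^ k" using card_mono[OF pgrp_finite[OF H] nrm_subset[OF U(1)]] H i(1) by (simp add: pgrp_def)
    then show ?thesis using prime_gt_1_nat[OF pgrp_prime[OF H]] by (simp add: power_increasing_iff)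
  qed
  have "cm g h \<in> ucen H N"
  proof (cases "k = 2 + i")
    case True
    have "card H = p\<^sup>2 * card (ucen H N)"
      using True by (simp only: pgrp_card[OF H] pgrp_card[OF i(1)] power_add)
    then show ?thesis by (rule cm_in_index_p2[OF H U(1) _ gh(1,2)])
  next
    case False
    then have "ucen H N = H" using i(2) by (intro ucen_index_p[OF H N i(1)]) simp
    then show ?thesis using sgp_cm[OF pgrp_sgp[OF H]] gh by simp
  qed
  then show ?thesis using gh(3) by (simp add: ucen_def)
qed

lemma gen_commuting_pair:
  assumes "u * v = v * u" "g \<in> gen {u, v}"
  shows "\<exists>i j. g = zp u i * zp v j"
  using assms(2)
proof induction
  case gen_one show ?case by (intro exI[of _ 0]) simp
next
  case (gen_base a)
  then consider "a = u" | "a = v" by blast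
  then show ?case
  proof cases
    case 1 then show ?thesis by (intro exI[of _ 1] exI[of _ 0]) simp
  next
    case 2 then show ?thesis by (intro exI[of _ 0] exI[of _ 1]) simp
  qed
next
  case (gen_mult a b)
  then obtain i j i' j' where *: "a = zp u i * zp v j" "b = zp u i' * zp v j'" by blast
  have "a * b = zp u i * (zp v j * zp u i') * zp v j'" by (simp add: * mult.assoc)
  also have "zp v j * zp u i' = zp u i' * zp v j" by (rule zp_commute[OF assms(1)[symmetric]])
  finally have "a * b = zp u (i + i') * zp v (j + j')" by (simp add: zp_add mult.assoc)
  then show ?case by blast
next
  case (gen_inverse a)
  then obtain i j where *: "a = zp u i * zp v j" by blast
  have "inverse a = zp v (- j) * zp u (- i)" by (simp add: * zp_minus)
  also have "\<dots> = zp u (- i) * zp v (- j)" by (rule zp_commute[OF assms(1)[symmetric]])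
  finally show ?case by blast
qed

section \<open>Groups with p^2 many p-th powers satisfy the first presentation\<close>

context regular_pgrp
begin

text \<open>The Hall--Petrescu error is a product of \<open>p\<close>-th powers from the derived
  subgroup, which are trivial here.\<close>

lemma power_hom:
  assumes "gam H 2 \<subseteq> om p H" "g \<in> H" "h \<in> H"
  shows "(g * h) ^ p = g ^ p * h ^ p"
proof -
  have "gen {g ^ (p ^ 1) |g. g \<in> gam H 2} \<subseteq> {1}"
    by (rule gen_subset) (use assms(1) in \<open>auto simp: om_def\<close>)
  then show ?thesis using pgrp_power_mult[OF pgrp k assms(2,3), of 1] by auto
qed

lemma gen_powers:
  assumes hom: "\<And>g h. g \<in> H \<Longrightarrow> h \<in> H \<Longrightarrow> (g * h) ^ p = g ^ p * h ^ p" and g: "gen {x, y} = H"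
  shows "pw p H = gen {x ^ p, y ^ p}"
  using gen_image[of "{x, y}" "\<lambda>g. g ^ p"] hom g by (simp add: pw_def)

text \<open>There is a chain \<open>P \<subset> B \<subset> W\<close> of normal subgroups of orders
  \<open>p ^ 2\<close>, \<open>p ^ 3\<close>, \<open>p ^ 4\<close> with central factors, where
  \<open>P\<close> consists of the \<open>p\<close>-th powers and \<open>W\<close> of the elements
  killed by \<open>p\<close>. By \<open>nt\<close> the commutator \<open>cm z x\<close> generates
  \<open>B\<close> modulo \<open>P\<close>, so \<open>y0\<close> can be corrected by a power of
  \<open>x\<close> until \<open>cm z y\<close> falls into \<open>P\<close>.\<close>

lemma case2_structure:
  assumes k6: "k = 6" and g: "gen {x, y0} = H"
    and e2: "\<And>g. g \<in> H \<Longrightarrow> (g ^ p) ^ p = 1" and c: "card (pw p H) = p\<^sup>2"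
    and nt: "cm (cm x y0) x \<notin> pw p H"
  shows "\<exists>y a b c d. gen {x, y} = H \<and> rel2 p x y a b c d"
proof -
  define P where "P = pw p H"
  define W where "W = om p H"
  have p: "p > 1" by (rule p_gt_1)
  have xy: "x \<in> H" "y0 \<in> H" using g gen_base[of _ "{x, y0}"] by auto
  have nP: "nrm P H" and nW: "nrm W H" using nrm_pw[of 1] nrm_om[of 1] by (simp_all add: P_def W_def)
  note sP = nrm_sgp[OF nP] and sW = nrm_sgp[OF nW]
  have PW: "P \<subseteq> W" using e2 closed by (auto simp: P_def W_def pw_def om_def)
  have cW: "card W = p ^ 4"
  proof -
    have "p\<^sup>2 * card W = p\<^sup>2 * p ^ 4"
      using card_om_pw[of 1] c card k6 p by (auto simp: W_def eval_nat_numeral)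
    then have "card W = p ^ 4 \<or> p\<^sup>2 = 0" by (simp only: mult_cancel1) 
    then show ?thesis using p by simp
  qed
  have cm_W: "cm g h \<in> W" if "g \<in> H" "h \<in> H" for g h
    by (rule cm_in_index_p2[OF pgrp nW _ that]) (use cW card k6 in \<open>simp add: eval_nat_numeral\<close>)
  have g2W: "gam H 2 \<subseteq> W" by (rule gam_2_subset[OF sgp nW cm_W])
  note hom = power_hom[OF g2W[unfolded W_def]]
  \<comment> \<open>All commutators are killed by \<open>p\<close>, which by regularity makes
    \<open>p\<close>-th powers central.\<close>
  have central: "u * h = h * u" if uh: "u \<in> P" "h \<in> H" for u h
  proof -
    obtain v where v: "v \<in> H" "u = v ^ p" using uh(1) unfolding P_def pw_def by blast
    then show ?thesis using power_commute_iff[of v h 1] cm_W[of v h] uh(2) by (simp add: W_def om_def)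
  qed
  define z where "z = cm x y0"
  have z: "z \<in> H" "z \<in> W" "z \<in> gam H 2" using xy cm_W closed by (simp_all add: z_def cm_in_gam_2)
  have ne: "P \<noteq> W" using cW c p by (auto simp: P_def power_inject_exp)
  obtain B where B: "nrm B H" "P \<subseteq> B" "B \<subseteq> W" "B \<noteq> W" "\<And>a h. a \<in> W \<Longrightarrow> h \<in> H \<Longrightarrow> cm a h \<in> B"
    by (rule cm_in_smaller_normal[OF pgrp nW nP PW ne]) (rule that)
  have g3B: "gam H 3 \<subseteq> B"
    unfolding numeral_3_eq_3 gam.simps(3)[of H "Suc 0"]
    by (rule gen_subset[OF _ nrm_sgp[OF B(1)]]) (use B(5) g2W in \<open>auto simp: numeral_2_eq_2\<close>)
  obtain j where j: "pgrp p j B" using pgrp_subgroup[OF pgrp nrm_sgp[OF B(1)] nrm_subset[OF B(1)]] .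
  have pW: "pgrp p 4 W" using prime sW cW by (simp add: pgrp_def)
  have pP: "pgrp p 2 P" using prime sP c by (simp add: pgrp_def P_def)
  have "j < 4" using pgrp_subset_eq[OF pW j B(3)] B(4) by force
  have r: "cm z x \<in> B" "cm z x \<notin> P" using B(5) z xy nt by (simp_all add: z_def P_def)
  have "2 < j" using pgrp_subset_eq[OF j pP B(2)] r by force
  then have cB: "card B = p * card P" using \<open>j < 4\<close> j pP by (simp add: pgrp_def eval_nat_numeral le_less_Suc_eq)
  have BP: "cm b h \<in> P" if "b \<in> B" "h \<in> H" for b h
    by (rule cm_in_index_p[OF pgrp B(1) nP B(2) cB that])
  have B_rep: "\<exists>i. \<exists>s\<in>P. b = cm z x ^ i * s" if b: "b \<in> B" for b
  proof -
    let ?L = "gen (insert (cm z x) P)"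
    have rH: "cm z x \<in> H" using z xy closed by simp
    have eq: "?L = (\<lambda>(i, s). cm z x ^ i * s) ` ({..<p} \<times> P)"
    proof (rule gen_insert_normal[OF sP])
      show "cj (cm z x) s \<in> P" if "s \<in> P" for s using nrm_cj[OF nP rH that] .
      show "cm z x ^ p \<in> P" using rH by (auto simp: P_def pw_def)
    qed (use p in simp)
    have LB: "?L \<subseteq> B" using r B by (intro gen_subset nrm_sgp[OF B(1)]) auto
    obtain l where l: "pgrp p l ?L"
      using pgrp_subgroup[OF j sgp_gen LB] .
    have PL: "P \<subseteq> ?L" "cm z x \<in> ?L" by (auto intro: gen_base)
    have "2 < l" using pgrp_subset_eq[OF l pP PL(1)] PL(2) r by force
    then have "?L = B" using pgrp_subset_eq[OF j l LB] \<open>j < 4\<close> by simp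
    then have "b \<in> (\<lambda>(i, s). cm z x ^ i * s) ` ({..<p} \<times> P)" using b eq by simp
    then show ?thesis by auto
  qed
  obtain i s where si: "s \<in> P" "cm z y0 = cm z x ^ i * s" using B_rep[OF B(5)[OF z(2) xy(2)]] by blast
  define r where "r = cm z x"
  \<comment> \<open>\<open>m\<close> represents \<open>- i\<close> modulo \<open>p\<close>: the
    exponent of \<open>r\<close> in \<open>cm z y\<close> becomes \<open>m + i = p * i\<close>, and
    \<open>r ^ p = 1\<close>.\<close>
  define m where "m = (p - 1) * i"
  define y where "y = y0 * x ^ m"
  have rH: "r \<in> H" "r \<in> B" using r z xy closed by (simp_all add: r_def)
  have xm: "x ^ m \<in> H" "y \<in> H" using xy closed by (simp_all add: y_def)
  have zxm: "\<exists>t\<in>P. cm z (x ^ n) = r ^ n * t" for n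
  proof (induction n)
    case 0 show ?case using sgp_one[OF sP] by (intro bexI[of _ 1]) simp_all
  next
    case (Suc n)
    then obtain t where t: "t \<in> P" "cm z (x ^ n) = r ^ n * t" by blast
    have "cm z (x ^ Suc n) = r ^ n * t * (r * cm r (x ^ n))"
      using t by (simp add: cm_mult_right cj_eq_cm flip: r_def)
    also have "\<dots> = r ^ n * (t * r) * cm r (x ^ n)" by (simp add: mult.assoc)
    also have "t * r = r * t" by (rule central[OF t(1) rH(1)])
    finally have "cm z (x ^ Suc n) = r ^ Suc n * (t * cm r (x ^ n))"
      by (simp add: mult.assoc power_Suc2 del: power_Suc)
    moreover have "t * cm r (x ^ n) \<in> P"
      using t(1) BP[OF rH(2), of "x ^ n"] xy(1) sgp_mult[OF sP] closed by simp
    ultimately show ?case by blast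
  qed
  obtain t where t: "t \<in> P" "cm z (x ^ m) = r ^ m * t" using zxm by blast
  have zy: "cm z y \<in> P"
  proof -
    have riB: "r ^ i * s \<in> B" using rH si B(2) nrm_sgp[OF B(1)] by (auto intro!: sgp_mult sgp_power)
    let ?c = "cm (r ^ i * s) (x ^ m)"
    have c: "?c \<in> P" by (rule BP[OF riB xm(1)])
    have "cm z y = r ^ m * t * (r ^ i * s * ?c)"
      using si t by (simp add: y_def cm_mult_right cj_eq_cm r_def)
    also have "\<dots> = r ^ m * (t * r ^ i) * (s * ?c)" by (simp add: mult.assoc)
    also have "t * r ^ i = r ^ i * t" by (rule central[OF t(1) closed(4)[OF rH(1)]])
    finally have "cm z y = r ^ (m + i) * (t * (s * ?c))" by (simp add: mult.assoc power_add)
    also have "m + i = p * i" using p by (simp add: m_def algebra_simps)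
    also have "r ^ (p * i) = 1" using rH(2) B(3) by (auto simp: power_mult W_def om_def)
    finally show ?thesis using t(1) si(1) c sgp_mult[OF sP] by simp
  qed
  define n where "n = cm z (x ^ m)"
  define z2 where "z2 = cm x y"
  have nB: "n \<in> B" unfolding n_def by (rule B(5)[OF z(2) xm(1)])
  have nH: "n \<in> H" using nB nrm_subset[OF B(1)] by blast
  have z2: "z2 = z * n"
  proof -
    have "cm x (x ^ m) = 1" by (simp add: cm_eq_one_iff power_commutes)
    then have "z2 = cj (x ^ m) z" by (simp add: z2_def y_def cm_mult_right z_def)
    then show ?thesis by (simp add: cj_eq_cm n_def)
  qed
  have z2W: "z2 \<in> W" "z2 \<in> H" "z2 \<in> gam H 2" using cm_W cm_in_gam_2 closed xy xm by (simp_all add: z2_def)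
  define w where "w = cm z2 x"
  have Q: "cm z2 y \<in> P"
    using nrm_cj[OF nP nH zy] BP[OF nB xm(2)] sgp_mult[OF sP] by (simp add: z2 cm_mult_left)
  have w: "w \<in> B" "w \<in> gam H 3" "w \<in> H"
    using B(5)[OF z2W(1) xy(1)] gam_cm_self[OF sgp z2W(3) xy(1)] closed z2W xy
    by (simp_all add: w_def numeral_2_eq_2 numeral_3_eq_3)
  have wx: "cm w x \<in> P" by (rule BP[OF w(1) xy(1)])
  have g4: "gam H 4 \<subseteq> P"
  proof -
    have "gen {cm a b |a b. a \<in> gam H 3 \<and> b \<in> H} \<subseteq> P"
      by (rule gen_subset[OF _ sP]) (use g3B BP in auto)
    then show ?thesis by (simp add: eval_nat_numeral)
  qed
  have g5: "gam H 5 \<subseteq> {1}"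
  proof -
    have "cm a b = 1" if "a \<in> gam H 4" "b \<in> H" for a b
      using central[of a b] g4 that by (auto simp: cm_eq_one_iff)
    then have "gen {cm a b |a b. a \<in> gam H 4 \<and> b \<in> H} \<subseteq> {1}"
      by (intro gen_subset) auto
    then show ?thesis by (simp add: eval_nat_numeral)
  qed
  have wz: "w * z2 = z2 * w"
    using gam_cm[OF sgp w(2) z2W(3)] g5 by (auto simp: cm_eq_one_iff)
  \<comment> \<open>A Jacobi identity in disguise: the action of \<open>x * y = y * x * z2\<close>
    on \<open>z2\<close> is expanded in both ways.\<close>
  have wy: "w * y = y * w"
  proof -
    have "x * y = y * x * z2" unfolding z2_def by (rule mult_eq_cm)
    then have "cj y (cj x z2) = cj z2 (cj x (cj y z2))" by (simp add: cj_cj)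
    moreover have "cj y (cj x z2) = z2 * cm z2 y * cj y w" by (simp add: cj_eq_cm[of _ z2] flip: w_def)
    moreover have "cj x (cj y z2) = z2 * w * cm z2 y"
      using central[OF Q xy(1)] by (simp add: cj_eq_cm[of _ z2] cj_eq_iff_commute flip: w_def)
    moreover have "cj z2 w = w" using wz by (simp add: cj_eq_iff_commute)
    moreover have "cj z2 (cm z2 y) = cm z2 y" using central[OF Q z2W(2)] by (simp add: cj_eq_iff_commute)
    moreover have "cj z2 z2 = z2" by (simp add: cj_eq_iff_commute)
    ultimately have "z2 * cm z2 y * cj y w = z2 * w * cm z2 y" by simp
    then have "cm z2 y * cj y w = w * cm z2 y" by (simp add: mult.assoc)
    also have "w * cm z2 y = cm z2 y * w" using central[OF Q w(3)] by simp
    finally have "cj y w = w" by simp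
    then show ?thesis by (simp add: cj_eq_iff_commute)
  qed
  have gy: "gen {x, y} = H"
  proof (rule gen_pair_eqI[OF g])
    have "y * inverse (x ^ m) \<in> gen {x, y}"
      by (intro gen_mult gen_inverse sgp_power[OF sgp_gen] gen_base) simp_all
    then show "y0 \<in> gen {x, y}" by (simp add: y_def mult.assoc)
  qed (use xy xm in \<open>auto intro: gen_base\<close>)
  have XY: "x ^ p \<in> P" "y ^ p \<in> P" using xy xm by (auto simp: P_def pw_def)
  have rep: "\<exists>i j. u = zp (x ^ p) i * zp (y ^ p) j" if "u \<in> P" for u
  proof (rule gen_commuting_pair)
    show "x ^ p * y ^ p = y ^ p * x ^ p" by (rule central[OF XY(1) closed(4)[OF xm(2)]])
    show "u \<in> gen {x ^ p, y ^ p}" using that gen_powers[OF hom gy] by (simp add: P_def)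
  qed
  obtain a b where ab: "cm w x = zp (x ^ p) a * zp (y ^ p) b" using rep[OF wx] by blast
  obtain c d where cd: "cm z2 y = zp (x ^ p) c * zp (y ^ p) d" using rep[OF Q] by blast
  have "rel2 p x y a b c d"
    unfolding rel2_def Let_def z2_def[symmetric] w_def[symmetric]
  proof (intro conjI)
    show "(x ^ p) ^ p = 1" "(y ^ p) ^ p = 1" using e2 xy xm by blast+
    show "z2 ^ p = 1" "w ^ p = 1" using z2W(1) w(1) B(3) by (auto simp: W_def om_def)
    show "x ^ p * y = y * x ^ p" "y ^ p * x = x * y ^ p" using central XY xy xm by blast+
  qed (use wz wy ab cd in blast)+
  then show ?thesis using gy by blast
qed

end

section \<open>Reduction of the first presentation to normal forms\<close>

lemma unit_solve_unit:
  assumes "prime p" "\<not> int p dvd a" "\<not> int p dvd b"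
  obtains n :: nat where "[int n * a = b] (mod int p)" "coprime (int n) (int p)"
proof -
  obtain n :: nat where n: "[int n * a = b] (mod int p)" using unit_solve[OF assms(1,2)] by blast
  have "\<not> int p dvd int n"
  proof
    assume "int p dvd int n"
    then have "int p dvd int n * a" by simp
    then show False using cong_dvd_iff[OF n] assms(3)
      by (metis cong_0_iff cong_sym cong_trans n)
  qed
  then show ?thesis using that n coprime_prime_int[OF assms(1)] by blast
qed

lemma rel2_cong:
  assumes "rel2 p x y a b c d" "[a = a'] (mod int p)" "[b = b'] (mod int p)"
    "[c = c'] (mod int p)" "[d = d'] (mod int p)"
  shows "rel2 p x y a' b' c' d'"
proof -
  have x: "(x ^ p) ^ p = 1" and y: "(y ^ p) ^ p = 1" using assms(1) by (auto simp: rel2_def Let_def)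
  have "zp (x ^ p) a = zp (x ^ p) a'" "zp (y ^ p) b = zp (y ^ p) b'"
    "zp (x ^ p) c = zp (x ^ p) c'" "zp (y ^ p) d = zp (y ^ p) d'"
    using assms(2-5) by (auto intro: zp_cong[OF x] zp_cong[OF y] simp: cong_iff_dvd_diff)
  then show ?thesis using assms(1) by (simp add: rel2_def)
qed

definition data2 :: "nat \<Rightarrow> 'a::grp set \<Rightarrow> int \<Rightarrow> int \<Rightarrow> int \<Rightarrow> int \<Rightarrow> bool" where
  "data2 p H a b c d \<longleftrightarrow> (\<exists>x y. gen {x, y} = H \<and> rel2 p x y a b c d)"

lemma data2_cong:
  "data2 p H a b c d \<Longrightarrow> [a = a'] (mod int p) \<Longrightarrow> [b = b'] (mod int p) \<Longrightarrow>
    [c = c'] (mod int p) \<Longrightarrow> [d = d'] (mod int p) \<Longrightarrow> data2 p H a' b' c' d'"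
  unfolding data2_def using rel2_cong by blast

context regular_pgrp
begin

lemma coprime_generates:
  assumes "g \<in> H" "coprime (int n) (int p)"
  shows "g \<in> gen {g ^ n}"
  using coprime_power_generates[OF pgrp_power_card[OF pgrp assms(1)], of "int n"] assms(2) by simp

lemma gen_scale:
  assumes "gen {x, y} = H" "coprime (int n) (int p)"
  shows "gen {x ^ n, y} = H" "gen {x, y ^ n} = H"
proof -
  have xy: "x \<in> H" "y \<in> H" using assms(1) gen_base[of _ "{x, y}"] by auto
  have "x \<in> gen {x ^ n, y}" "y \<in> gen {x, y ^ n}"
    using coprime_generates[OF _ assms(2)] xy gen_mono[of "{x ^ n}" "{x ^ n, y}"] gen_mono[of "{y ^ n}" "{x, y ^ n}"]
    by blast+
  then show "gen {x ^ n, y} = H" "gen {x, y ^ n} = H"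
    using xy closed by - (rule gen_pair_eqI[OF assms(1)]; simp add: gen_base)+
qed

lemma gen_shear:
  assumes "gen {x, y} = H"
  shows "gen {x * y ^ n, y} = H"
proof (rule gen_pair_eqI[OF assms])
  have "x * y ^ n * inverse (y ^ n) \<in> gen {x * y ^ n, y}"
    by (intro gen_mult gen_inverse sgp_power[OF sgp_gen] gen_base) simp_all
  then show "x \<in> gen {x * y ^ n, y}" by (simp add: mult.assoc)
  have xy: "x \<in> H" "y \<in> H" using assms gen_base[of _ "{x, y}"] by auto
  then show "x * y ^ n \<in> H" "y \<in> H" using closed by simp_all
qed (auto intro: gen_base)

lemma data2_scale_x:
  assumes "data2 p H a b c d" "coprime (int n) (int p)"
  shows "data2 p H (int n ^ 2 * a) (int n ^ 3 * b) c (int n * d)"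
proof -
  obtain x y where xy: "gen {x, y} = H" "rel2 p x y a b c d" using assms(1) by (auto simp: data2_def)
  interpret case2 p x y a b c d by unfold_locales (use xy p_gt_1 in auto)
  show ?thesis unfolding data2_def using scale_x gen_scale(1)[OF xy(1) assms(2)] by blast
qed

lemma data2_scale_y:
  assumes "data2 p H a b c d" "coprime (int n) (int p)"
  shows "data2 p H (int n * a) b (int n ^ 2 * c) (int n * d)"
proof -
  obtain x y where xy: "gen {x, y} = H" "rel2 p x y a b c d" using assms(1) by (auto simp: data2_def)
  interpret case2 p x y a b c d by unfold_locales (use xy p_gt_1 in auto)
  show ?thesis unfolding data2_def using scale_y gen_scale(2)[OF xy(1) assms(2)] by blast
qed

text \<open>As \<open>cm x y\<close> is killed by \<open>p\<close>, so is the derived subgroup, and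
  the \<open>p\<close>-th power map is a homomorphism; this supplies the hypothesis of
  \<open>shear\<close>.\<close>

lemma data2_shear:
  assumes "data2 p H a b c d"
  shows "data2 p H a (b - int n * a) c (d - int n * c)"
proof -
  obtain x y where xy: "gen {x, y} = H" "rel2 p x y a b c d" using assms(1) by (auto simp: data2_def)
  interpret case2 p x y a b c d by unfold_locales (use xy p_gt_1 in auto)
  have N: "nrm (om p H) H" using nrm_om[of 1] by simp
  have z: "cm x y \<in> om p H" "cm y x \<in> om p H"
    using rels(3) mem xy(1) sgp_inverse[OF nrm_sgp[OF N], of "cm x y"] by (auto simp: om_def inverse_cm)
  have "cm g h \<in> om p H" if "g \<in> H" "h \<in> H" for g h
    by (rule cm_closed_gen[OF sgp xy(1)[symmetric] N _ that])
       (use z sgp_one[OF nrm_sgp[OF N]] in auto)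
  then have "gam H 2 \<subseteq> om p H" using gam_2_subset[OF sgp N] by blast
  then have "(x * y ^ n) ^ p = x ^ p * (y ^ n) ^ p"
    using xy(1) mem closed by (intro power_hom) auto
  then have "(x * y ^ n) ^ p = x ^ p * (y ^ p) ^ n"
    by (simp add: mult.commute flip: power_mult)
  then show ?thesis unfolding data2_def using shear gen_shear[OF xy(1)] by blast
qed

text \<open>Otherwise \<open>H\<close> would arise from \<open>pw p H\<close> by adjoining
  \<open>z\<close>, \<open>y\<close> and \<open>x\<close> in turn, each at index at most
  \<open>p\<close>, and have order at most \<open>p ^ 5\<close>.\<close>

lemma case2_nontrivial:
  assumes k6: "k = 6" and g: "gen {x, y} = H" and c: "card (pw p H) = p\<^sup>2"
  shows "cm (cm x y) x \<notin> pw p H \<or> cm (cm x y) y \<notin> pw p H"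
proof (rule ccontr)
  define P where "P = pw p H"
  define z where "z = cm x y"
  assume "\<not> ?thesis"
  then have z: "cm z x \<in> P" "cm z y \<in> P" by (auto simp: P_def z_def)
  have xy: "x \<in> H" "y \<in> H" using g gen_base[of _ "{x, y}"] by auto
  then have zH: "z \<in> H" using closed by (simp add: z_def)
  have P: "nrm P H" using nrm_pw[of 1] by (simp add: P_def)
  have pP: "u ^ p \<in> P" if "u \<in> H" for u using that by (auto simp: P_def pw_def)
  have fP: "finite P" using finite by (simp add: P_def pw_def)
  let ?S1 = "gen (insert z P)"
  let ?S2 = "gen (insert y ?S1)"
  let ?S3 = "gen (insert x ?S2)"
  have S1: "finite ?S1" "card ?S1 \<le> p * card P"
    by (rule card_gen_insert_le[where n = p, OF nrm_sgp[OF P] _ pP[OF zH]];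
        use nrm_cj[OF P zH] fP p_gt_1 in simp)+
  have b1: "a \<in> insert z P \<Longrightarrow> a \<in> ?S1" for a by (rule gen_base)
  have cj1: "cj u s \<in> ?S1" if u: "u \<in> H" "cm z u \<in> P" and s: "s \<in> ?S1" for u s
  proof (rule gen_cj_closed[OF _ s])
    have "cj u z \<in> ?S1" unfolding cj_eq_cm[of u z] by (intro gen_mult b1) (simp_all add: u)
    then show "cj u a \<in> ?S1" if "a \<in> insert z P" for a
      using that nrm_cj[OF P u(1)] b1 by auto
  qed
  have S2: "finite ?S2" "card ?S2 \<le> p * card ?S1"
    by (rule card_gen_insert_le[where n = p, OF sgp_gen _ b1];
        use cj1[OF xy(2) z(2)] S1(1) p_gt_1 pP[OF xy(2)] in simp)+
  have b2: "a \<in> insert y ?S1 \<Longrightarrow> a \<in> ?S2" for a by (rule gen_base)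
  have cj2: "cj x s \<in> ?S2" if s: "s \<in> ?S2" for s
  proof (rule gen_cj_closed[OF _ s])
    have "cj x y = y * inverse z" by (simp add: cj_eq_cm z_def inverse_cm)
    moreover have "y * inverse z \<in> ?S2" using b1 b2 by (intro gen_mult gen_inverse) simp_all
    ultimately show "cj x a \<in> ?S2" if "a \<in> insert y ?S1" for a
      using that cj1[OF xy(1) z(1)] b2 by auto
  qed
  have S3: "card ?S3 \<le> p * card ?S2"
    by (rule card_gen_insert_le[where n = p, OF sgp_gen cj2]) (use S2(1) p_gt_1 b1 b2 pP[OF xy(1)] in simp_all)
  have "H \<subseteq> ?S3"
    unfolding g[symmetric] by (rule gen_subset) (use b2 in \<open>auto intro: gen_base\<close>)
  moreover have "finite ?S3"
    by (rule card_gen_insert_le[where n = p, OF sgp_gen cj2]) (use S2(1) p_gt_1 b1 b2 pP[OF xy(1)] in simp_all)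
  ultimately have "card H \<le> card ?S3" by (intro card_mono)
  also have "\<dots> \<le> p * (p * (p * card P))"
    using S1 S2 S3 by (meson le_trans mult_le_mono2)
  also have "\<dots> = p ^ 5" using c by (simp add: P_def eval_nat_numeral)
  finally show False using card k6 p_gt_1 by simp
qed

text \<open>If \<open>cm (cm x y) x\<close> is a \<open>p\<close>-th power, exchanging the
  generators leads to the situation of \<open>case2_structure\<close>.\<close>

lemma case2_data:
  assumes k6: "k = 6" and g: "gen {x, y} = H"
    and e2: "\<And>g. g \<in> H \<Longrightarrow> (g ^ p) ^ p = 1" and c: "card (pw p H) = p\<^sup>2"
  shows "\<exists>a b c d. data2 p H a b c d"
proof (cases "cm (cm x y) x \<in> pw p H")
  case False
  then show ?thesis unfolding data2_def using case2_structure[OF k6 g e2 c] by blast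
next
  case True
  have P: "nrm (pw p H) H" using nrm_pw[of 1] by simp
  have xy: "x \<in> H" "y \<in> H" using g gen_base[of _ "{x, y}"] by auto
  have zH: "cm x y \<in> H" using closed xy by simp
  have "cm (cm x y) y \<notin> pw p H" using case2_nontrivial[OF k6 g c] True by blast
  moreover have "cm (cm x y) y = cj (cm x y) (inverse (cm (cm y x) y))"
    by (simp add: cm_def cj_def mult.assoc)
  ultimately have "cm (cm y x) y \<notin> pw p H"
    using nrm_cj[OF P zH] sgp_inverse[OF nrm_sgp[OF P]] by auto
  moreover have "gen {y, x} = H" using g by (simp add: insert_commute)
  ultimately show ?thesis unfolding data2_def using case2_structure[OF k6 _ e2 c, of y x] by blast
qed

definition normal2 :: "int \<Rightarrow> (int \<times> int \<times> int \<times> int) set" where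
  "normal2 n0 = (\<lambda>c. (1, 0, c, 1)) ` {0..<int p} \<union> (\<lambda>c. (1, 0, c, 0)) ` {0..<int p} \<union>
     (\<lambda>b. (0, b, 1, 0)) ` {0..<int p} \<union> (\<lambda>b. (0, b, n0, 0)) ` {0..<int p} \<union>
     (\<lambda>b. (0, b, 0, 1)) ` {0..<int p} \<union> (\<lambda>b. (0, b, 0, 0)) ` {0..<int p}"

lemma normal2_mem:
  "(1, 0, r mod int p, 1) \<in> normal2 n0" "(1, 0, r mod int p, 0) \<in> normal2 n0"
  "(0, r mod int p, 1, 0) \<in> normal2 n0" "(0, r mod int p, n0, 0) \<in> normal2 n0"
  "(0, r mod int p, 0, 1) \<in> normal2 n0" "(0, r mod int p, 0, 0) \<in> normal2 n0"
  using p_gt_1 by (simp_all add: normal2_def image_iff)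

text \<open>For a unit \<open>a\<close> the shear removes \<open>b\<close>; for \<open>a = 0\<close>
  and a unit \<open>c\<close> it removes \<open>d\<close>. Scalings then turn one further
  coefficient after another into 1, or into \<open>n0\<close> where only square factors are
  available.\<close>

lemma data2_normal:
  assumes n0: "square_class p n0" and D: "data2 p H a b c d"
  shows "\<exists>(a', b', c', d') \<in> normal2 n0. data2 p H a' b' c' d'"
proof -
  have cm: "[r = r mod int p] (mod int p)" for r by (simp add: cong_def)
  have u1: "\<not> int p dvd 1" using p_gt_1 by simp
  show ?thesis
  proof (cases "int p dvd a")
    case False
    obtain n where n: "[int n * a = b] (mod int p)" using unit_solve[OF prime False] by blast
    have 1: "data2 p H a 0 c (d - int n * c)"
      by (rule data2_cong[OF data2_shear[OF D, of n]]) (use n in \<open>simp_all add: cong_iff_dvd_diff dvd_diff_commute\<close>)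
    obtain v where v: "[int v * a = 1] (mod int p)" "coprime (int v) (int p)"
      using unit_solve_unit[OF prime False u1] by blast
    obtain c2 d2 where 2: "data2 p H 1 0 c2 d2"
      using data2_cong[OF data2_scale_y[OF 1 v(2)] v(1) cong_refl cong_refl cong_refl] by blast
    show ?thesis
    proof (cases "int p dvd d2")
      case True
      have "data2 p H 1 0 (c2 mod int p) 0"
        by (rule data2_cong[OF 2 cong_refl cong_refl cm]) (use True in \<open>simp add: cong_0_iff\<close>)
      then show ?thesis by (intro bexI[OF _ normal2_mem(2)]) simp
    next
      case False
      \<comment> \<open>Scaling \<open>x\<close> by \<open>l = d2\<close> and then \<open>y\<close>
        by \<open>w = 1 / l ^ 2\<close> keeps \<open>a = 1\<close> and turns \<open>d2\<close> into
        \<open>w * l * d2 = 1\<close>.\<close>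
      obtain l where l: "[int l * 1 = d2] (mod int p)" "coprime (int l) (int p)"
        using unit_solve_unit[OF prime u1 False] by blast
      have "\<not> int p dvd int l ^ 2"
      proof
        assume "int p dvd int l ^ 2"
        moreover have "coprime (int l ^ 2) (int p)" using l(2) by simp
        ultimately have "is_unit (int p)" using coprime_common_divisor[of "int l ^ 2" "int p" "int p"] by simp
        then show False using p_gt_1 by simp
      qed
      then obtain w where w: "[int w * int l ^ 2 = 1] (mod int p)" "coprime (int w) (int p)"
        using unit_solve_unit[OF prime _ u1] by blast
      have "[int w * (int l * d2) = int w * (int l * (int l * 1))] (mod int p)"
        by (intro cong_mult cong_refl cong_sym[OF l(1)])
      also have "int w * (int l * (int l * 1)) = int w * int l ^ 2" by (simp add: power2_eq_square)
      finally have d1: "[int w * (int l * d2) = 1] (mod int p)" using w(1) by (rule cong_trans)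
      have "data2 p H 1 0 ((int w)\<^sup>2 * c2 mod int p) 1"
        by (rule data2_cong[OF data2_scale_y[OF data2_scale_x[OF 2 l(2)] w(2)] _ _ cm d1]) (use w(1) in simp_all)
      then show ?thesis by (intro bexI[OF _ normal2_mem(1)]) simp
    qed
  next
    case a: True
    show ?thesis
    proof (cases "int p dvd c")
      case False
      obtain n where n: "[int n * c = d] (mod int p)" using unit_solve[OF prime False] by blast
      have 1: "data2 p H 0 (b - int n * a) c 0"
        by (rule data2_cong[OF data2_shear[OF D, of n]])
           (use n a in \<open>simp_all add: cong_iff_dvd_diff dvd_diff_commute\<close>)
      obtain v :: nat where v: "coprime (int v) (int p)" and
        v2: "[int v ^ 2 * c = 1] (mod int p) \<or> [int v ^ 2 * c = n0] (mod int p)"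
        using n0 False unfolding square_class_def by blast
      have "data2 p H 0 ((b - int n * a) mod int p) 1 0 \<or> data2 p H 0 ((b - int n * a) mod int p) n0 0"
        using v2 data2_cong[OF data2_scale_y[OF 1 v] _ cm] by auto
      then show ?thesis using normal2_mem(3,4)[of "b - int n * a" n0] by fast
    next
      case c: True
      show ?thesis
      proof (cases "int p dvd d")
        case True
        have "data2 p H 0 (b mod int p) 0 0"
          by (rule data2_cong[OF D _ cm]) (use a c True in \<open>simp_all add: cong_0_iff\<close>)
        then show ?thesis by (intro bexI[OF _ normal2_mem(6)]) simp
      next
        case False
        obtain v where v: "[int v * d = 1] (mod int p)" "coprime (int v) (int p)"
          using unit_solve_unit[OF prime False u1] by blast
        have "data2 p H 0 (b mod int p) 0 1"
          by (rule data2_cong[OF data2_scale_y[OF D v(2)] _ cm _ v(1)]) (use a c in \<open>simp_all add: cong_0_iff\<close>)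
        then show ?thesis by (intro bexI[OF _ normal2_mem(5)]) simp
      qed
    qed
  qed
qed

lemma card_normal2: "finite (normal2 n0)" "card (normal2 n0) \<le> 6 * p"
proof -
  have c: "card (f ` {0..<int p}) \<le> p" for f :: "int \<Rightarrow> int \<times> int \<times> int \<times> int"
    using card_image_le[of "{0..<int p}" f] by simp
  show "finite (normal2 n0)" unfolding normal2_def by simp
  show "card (normal2 n0) \<le> 6 * p"
    unfolding normal2_def
    by (rule order_trans[OF card_Un_le], rule order_trans[OF add_mono[OF _ c]],
        rule order_trans[OF card_Un_le], rule add_mono[OF _ c],
        rule order_trans[OF card_Un_le], rule add_mono[OF _ c],
        rule order_trans[OF card_Un_le], rule add_mono[OF _ c],
        rule order_trans[OF card_Un_le], rule add_mono[OF c c], simp)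
qed

end

subsection \<open>Groups of exponent $p^2$ with $p^3$ many $p$-th powers\<close>

text \<open>The shifts \<open>c - b + a\<close> and \<open>f + d + a\<close> make \<open>a, \<dots>, f\<close> the structure constants of the associated
  Lie ring, so that changes of generators act linearly on them.\<close>

definition rel3 :: "nat \<Rightarrow> 'a::grp \<Rightarrow> 'a \<Rightarrow> int \<Rightarrow> int \<Rightarrow> int \<Rightarrow> int \<Rightarrow> int \<Rightarrow> bool" where
  "rel3 p x y a b c d f \<longleftrightarrow> (let z = cm x y; X = x ^ p; Y = y ^ p; Z = z ^ p in
     X ^ p = 1 \<and> Y ^ p = 1 \<and> Z ^ p = 1 \<and> X * z = z * X \<and> Y * z = z * Y \<and> Y * X = X * Y \<and>
     cj y X = X * Z \<and> cj x Y = Y * inverse Z \<and> cj x Z = Z \<and> cj y Z = Z \<and>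
     cm z x = zp X (2 * a) * (zp Y b * zp Z (c - b + a)) \<and>
     cm z y = zp X d * (zp Y (- (2 * a)) * zp Z (f + d + a)))"

lemma fst_cj [simp]: "fst (cj g a) = cj (fst g) (fst a)" and snd_cj [simp]: "snd (cj g a) = cj (snd g) (snd a)"
  by (simp_all add: cj_def)

lemma rel3_pair:
  "rel3 p (x, x') (y, y') a b c d f \<longleftrightarrow> rel3 p x y a b c d f \<and> rel3 p x' y' a b c d f"
  by (auto simp: rel3_def Let_def prod_eq_iff)

locale case3 =
  fixes p :: nat and x y :: "'a::grp" and a b c d f :: int
  assumes rel: "rel3 p x y a b c d f" and p: "p > 0" "odd p"
begin

abbreviation "z \<equiv> cm x y"

lemma rels: "(x ^ p) ^ p = 1" "(y ^ p) ^ p = 1" "(z ^ p) ^ p = 1"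
  "x ^ p * z = z * x ^ p" "y ^ p * z = z * y ^ p" "y ^ p * x ^ p = x ^ p * y ^ p"
  "cj y (x ^ p) = x ^ p * z ^ p" "cj x (y ^ p) = y ^ p * inverse (z ^ p)" "cj x (z ^ p) = z ^ p" "cj y (z ^ p) = z ^ p"
  "cm z x = zp (x ^ p) (2 * a) * (zp (y ^ p) b * zp (z ^ p) (c - b + a))"
  "cm z y = zp (x ^ p) d * (zp (y ^ p) (- (2 * a)) * zp (z ^ p) (f + d + a))"
  using rel by (simp_all add: rel3_def Let_def)

lemma fixed: "cj x (x ^ p) = x ^ p" "cj y (y ^ p) = y ^ p"
  by (simp_all add: cj_eq_iff_commute power_commutes)

lemma mem: "x \<in> gen {x, y}" "y \<in> gen {x, y}" "z \<in> gen {x, y}"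
  "x ^ p \<in> gen {x, y}" "y ^ p \<in> gen {x, y}" "z ^ p \<in> gen {x, y}"
  by (auto intro!: sgp_cm[OF sgp_gen] sgp_power[OF sgp_gen] intro: gen_base)

sublocale commuting z "x ^ p" "y ^ p" 1
  by (unfold_locales; (rule rels)?) simp_all

text \<open>The fourth slot of \<open>commuting\<close> is filled with 1. Since \<open>z ^ p\<close>
  is \<open>F (int p) 0 0\<close>, the first coordinate counts modulo \<open>p ^ 2\<close> and the
  other two modulo \<open>p\<close>.\<close>

definition F :: "int \<Rightarrow> int \<Rightarrow> int \<Rightarrow> 'a" where
  "F i k l = E i k l 0"

lemma F_mult: "F i k l * F i' k' l' = F (i + i') (k + k') (l + l')"
  by (simp add: F_def E_mult)

lemma F_one: "F 0 0 0 = 1" by (simp add: F_def E_one)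

lemma F_inverse: "inverse (F i k l) = F (- i) (- k) (- l)" by (simp add: F_def E_inverse)

lemma F_zp: "zp (F i k l) n = F (n * i) (n * k) (n * l)" by (simp add: F_def E_zp)

lemma cm_F: "cm (F i k l) g = F (- i) (- k) (- l) * cj g (F i k l)"
  by (simp add: F_def cm_E)

lemma gens: "z = F 1 0 0" "x ^ p = F 0 1 0" "y ^ p = F 0 0 1" "z ^ p = F (int p) 0 0"
  by (simp_all add: F_def E_def)

lemma cj_F: "cj g (F i k l) = zp (cj g z) i * (zp (cj g (x ^ p)) k * zp (cj g (y ^ p)) l)"
  by (simp add: F_def cj_E)

lemma cj_gens: "cj x z = F (1 + int p * (c - b + a)) (2 * a) b"
  "cj y z = F (1 + int p * (f + d + a)) d (- (2 * a))"
  "cj y (x ^ p) = F (int p) 1 0" "cj x (y ^ p) = F (- int p) 0 1"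
  "cj x (x ^ p) = F 0 1 0" "cj y (y ^ p) = F 0 0 1"
proof -
  show "cj x z = F (1 + int p * (c - b + a)) (2 * a) b" "cj y z = F (1 + int p * (f + d + a)) d (- (2 * a))"
    unfolding cj_eq_cm[of _ z] rels(11,12) unfolding gens(2-4) unfolding gens(1) F_zp F_mult by (simp_all add: algebra_simps)
  show "cj y (x ^ p) = F (int p) 1 0" "cj x (y ^ p) = F (- int p) 0 1"
    unfolding rels(7,8) unfolding gens(2-4) F_inverse F_mult by simp_all
  show "cj x (x ^ p) = F 0 1 0" "cj y (y ^ p) = F 0 0 1"
    unfolding fixed by (rule gens)+
qed

lemma cj_x: "cj x (F i k l) = F (i + int p * ((c - b + a) * i - l)) (k + 2 * a * i) (l + b * i)"
  unfolding cj_F cj_gens F_zp F_mult by (simp add: algebra_simps)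

lemma cj_y: "cj y (F i k l) = F (i + int p * ((f + d + a) * i + k)) (k + d * i) (l - 2 * a * i)"
  unfolding cj_F cj_gens F_zp F_mult by (simp add: algebra_simps)

lemma F_cong:
  assumes "int p * int p dvd i - i'" "int p dvd k - k'" "int p dvd l - l'"
  shows "F i k l = F i' k' l'"
proof -
  have "z ^ (p * p) = 1" using rels(3) by (simp add: power_mult)
  then show ?thesis
    unfolding F_def E_def using zp_cong[of z "p * p" i i'] zp_cong[OF rels(1) assms(2)]
      zp_cong[OF rels(2) assms(3)] assms(1) by simp
qed

lemma F_power_p: "F i k l ^ p = F (int p * i) 0 0"
proof -
  have "F i k l ^ p = F (int p * i) (int p * k) (int p * l)" using F_zp[of i k l "int p"] by simp
  also have "\<dots> = F (int p * i) 0 0" by (rule F_cong) simp_all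
  finally show ?thesis .
qed

lemma polycyclic_rel3: "polycyclic p [x, y, z, x ^ p, y ^ p, z ^ p]"
proof -
  have "cj x y = y * inverse z" by (simp add: cj_eq_cm inverse_cm)
  moreover have "cj x z = z * (zp (x ^ p) (2 * a) * (zp (y ^ p) b * zp (z ^ p) (c - b + a)))"
    "cj y z = z * (zp (x ^ p) d * (zp (y ^ p) (- (2 * a)) * zp (z ^ p) (f + d + a)))"
    using rels(11,12) by (simp_all only: cj_eq_cm[of _ z])
  moreover have "cj z (x ^ p) = x ^ p" "cj z (y ^ p) = y ^ p" "cj z (z ^ p) = z ^ p"
    "cj (x ^ p) (y ^ p) = y ^ p" "cj (x ^ p) (z ^ p) = z ^ p" "cj (y ^ p) (z ^ p) = z ^ p"
  proof -
    have "z ^ p * x ^ p = x ^ p * z ^ p" "z ^ p * y ^ p = y ^ p * z ^ p"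
      using E_commute[of "int p" 0 0 0 0 1 0 0] E_commute[of "int p" 0 0 0 0 0 1 0] by (simp_all add: E_def)
    then show "cj z (x ^ p) = x ^ p" "cj z (y ^ p) = y ^ p" "cj z (z ^ p) = z ^ p"
      "cj (x ^ p) (y ^ p) = y ^ p" "cj (x ^ p) (z ^ p) = z ^ p" "cj (y ^ p) (z ^ p) = z ^ p"
      unfolding cj_eq_iff_commute by - (assumption | rule rels power_commutes)+
  qed
  ultimately show ?thesis
    by (simp add: fixed rels(1-3) rels(7-10) gen_one)
       (intro conjI gen_mult gen_inverse sgp_zp[OF sgp_gen]; rule gen_base; simp)
qed

lemma card_rel3: "finite (gen {x, y})" "card (gen {x, y}) \<le> p ^ 6"
proof -
  have "gen (set [x, y, z, x ^ p, y ^ p, z ^ p]) = gen {x, y}"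
  proof
    show "gen (set [x, y, z, x ^ p, y ^ p, z ^ p]) \<subseteq> gen {x, y}"
      by (rule gen_subset) (use mem in auto)
  qed (rule gen_mono, simp)
  then show "finite (gen {x, y})" "card (gen {x, y}) \<le> p ^ 6"
    using polycyclic_card[OF polycyclic_rel3 p(1)] by (simp_all add: eval_nat_numeral)
qed

lemma swap: "rel3 p y x a (- d) f (- b) c"
proof -
  have z': "cm y x = F (- 1) 0 0" using F_inverse[of 1 0 0] by (simp add: inverse_cm flip: gens(1))
  show ?thesis
    unfolding rel3_def Let_def z' gens(2-3) F_power_p
    by (unfold cm_F cj_x cj_y F_zp F_mult F_inverse F_one[symmetric]; intro conjI)
       (rule F_cong; simp add: algebra_simps)+
qed

lemma cj_x_power:
  "cj (x ^ n) (F i k l) =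
    F (i + int p * ((c - b + a) * (int n * i) - int n * l - b * (int (n choose 2) * i))) (k + 2 * a * (int n * i)) (l + b * (int n * i))"
proof (induction n)
  case (Suc n)
  have "cj (x ^ Suc n) (F i k l) = cj x (cj (x ^ n) (F i k l))"
    by (simp add: power_Suc2 cj_cj del: power_Suc)
  also have "\<dots> = F (i + int p * ((c - b + a) * (int (Suc n) * i) - int (Suc n) * l - b * (int (Suc n choose 2) * i))) (k + 2 * a * (int (Suc n) * i)) (l + b * (int (Suc n) * i))"
    unfolding Suc cj_x by (rule F_cong) (simp_all add: algebra_simps numeral_2_eq_2)
  finally show ?case .
qed (simp add: binomial_eq_0)

lemma scale_x:
  "rel3 p (x ^ n) y (int n * a) (int n ^ 2 * b) (int n * c) d f"
proof -
  let ?n = "int n" and ?c = "int (n choose 2)"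
  \<comment> \<open>This identity absorbs the binomial coefficients produced by
    \<open>cm (x ^ n) y\<close> into the shifts \<open>c - b + a\<close> and
    \<open>f + d + a\<close> of \<open>rel3\<close>.\<close>
  have c2: "2 * ?c = ?n * (?n - 1)"
  proof -
    have "even (n * (n - 1))" by (cases n) simp_all
    then have "2 * (n choose 2) = n * (n - 1)" by (simp add: choose_two)
    then have "int (2 * (n choose 2)) = int (n * (n - 1))" by simp
    then show ?thesis by (cases n) (simp_all add: algebra_simps)
  qed
  have "\<exists>m. cm (x ^ n) y = F (int n + int p * m) (2 * a * int (n choose 2)) (b * int (n choose 2))" for n
  proof (induction n)
    case 0 show ?case using F_one by (auto intro!: exI[of _ 0] simp: binomial_eq_0)
  next
    case (Suc n)
    then obtain m where "cm (x ^ n) y = F (int n + int p * m) (2 * a * int (n choose 2)) (b * int (n choose 2))"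
      by blast
    moreover have "cm (x ^ Suc n) y = cj (x ^ n) (F 1 0 0) * cm (x ^ n) y"
      by (simp add: cm_mult_left flip: gens(1))
    ultimately have "cm (x ^ Suc n) y = F (int (Suc n) + int p * (m + ((c - b + a) * int n - b * int (n choose 2)))) (2 * a * int (Suc n choose 2)) (b * int (Suc n choose 2))"
      by (simp add: cj_x_power F_mult algebra_simps numeral_2_eq_2)
    then show ?case by blast
  qed
  then obtain m where z': "cm (x ^ n) y = F (?n + int p * m) (2 * a * ?c) (b * ?c)" by blast
  have X': "(x ^ n) ^ p = F 0 ?n 0"
    by (simp add: F_def E_def flip: power_mult) (simp add: mult.commute)
  have Y: "y ^ p = F 0 0 1" by (rule gens)
  have Z': "F (int p * (?n + int p * m)) 0 0 = F (int p * ?n) 0 0"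
    by (rule F_cong) (simp_all add: algebra_simps)
  show ?thesis
    unfolding rel3_def Let_def z' X' Y F_power_p Z'
  proof (intro conjI)
    show "cj (x ^ n) (F (int p * ?n) 0 0) = F (int p * ?n) 0 0" "cj y (F (int p * ?n) 0 0) = F (int p * ?n) 0 0"
      "F (int p * (int p * ?n)) 0 0 = 1" "F (int p * 0) 0 0 = 1" "F (int p * 0) 0 0 = 1"
      unfolding cj_x_power cj_y F_one[symmetric] by (rule F_cong; simp)+
    show "cm (F (?n + int p * m) (2 * a * ?c) (b * ?c)) (x ^ n) =
      zp (F 0 ?n 0) (2 * (?n * a)) * (zp (F 0 0 1) (?n ^ 2 * b) *
        zp (F (int p * ?n) 0 0) (?n * c - ?n ^ 2 * b + ?n * a))"
    proof -
      have "int p * ?n * (?n * c - ?n ^ 2 * b + ?n * a) =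
          int p * ((c - b + a) * (?n * ?n) - ?n * (b * ?c) - b * (?c * ?n))"
        using arg_cong[OF c2, of "\<lambda>t. int p * ?n * b * t"]
        by (simp add: algebra_simps power2_eq_square)
      then show ?thesis
        unfolding cm_F cj_x_power F_zp F_mult
        by (intro F_cong dvdI[of _ "int p * int p" "m * ((c - b + a) * ?n - b * ?c)"])
           (simp_all add: algebra_simps power2_eq_square)
    qed
    show "cm (F (?n + int p * m) (2 * a * ?c) (b * ?c)) y =
      zp (F 0 ?n 0) d * (zp (F 0 0 1) (- (2 * (?n * a))) * zp (F (int p * ?n) 0 0) (f + d + ?n * a))"
    proof -
      have "int p * ?n * (f + d + ?n * a) = int p * ((f + d + a) * ?n + 2 * a * ?c)"
        using arg_cong[OF c2, of "\<lambda>t. int p * a * t"] by (simp add: algebra_simps)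
      then show ?thesis
        unfolding cm_F cj_y F_zp F_mult
        by (intro F_cong dvdI[of _ "int p * int p" "(f + d + a) * m"]) (simp_all add: algebra_simps)
    qed
  qed (unfold cj_x_power cj_y F_mult F_inverse; rule F_cong; simp add: algebra_simps)+
qed

text \<open>The square avoids a half: the commutator enters the \<open>p\<close>-th power of the
  product with exponent \<open>p choose 2\<close>, and for \<open>y\<^sup>2\<close> this amounts to
  exactly one factor \<open>z ^ p\<close>.\<close>

lemma shear:
  assumes X': "(x * y\<^sup>2) ^ p = F (int p) 1 2"
  shows "rel3 p (x * y\<^sup>2) y (a + d) (b - 8 * a - 4 * d) (c + 2 * f) d f"
proof -
  have "cm (y\<^sup>2) y = 1" by (simp add: cm_eq_one_iff power_commutes)
  then have "cm (x * y\<^sup>2) y = cj y (cj y (F 1 0 0))"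
    by (simp add: cm_mult_left cj_cj power2_eq_square flip: gens(1))
  then have z': "cm (x * y\<^sup>2) y = F (1 + int p * (2 * (f + d + a) + d)) (2 * d) (- (4 * a))"
    unfolding cj_y by (simp, intro F_cong) (simp_all add: algebra_simps)
  have Y: "y ^ p = F 0 0 1" by (rule gens)
  have cjx: "cj (x * y\<^sup>2) u = cj y (cj y (cj x u))" for u
    by (simp add: cj_cj power2_eq_square mult.assoc)
  have Z': "F (int p * (1 + int p * (2 * (f + d + a) + d))) 0 0 = F (int p) 0 0"
    by (rule F_cong) (simp_all add: algebra_simps)
  have cx: "cj x (F (i + int p * m) k l) = F (i + int p * (m + (c - b + a) * i - l)) (k + 2 * a * i) (l + b * i)"
    and cy: "cj y (F (i + int p * m) k l) = F (i + int p * (m + (f + d + a) * i + k)) (k + d * i) (l - 2 * a * i)"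
    for i m k l
    unfolding cj_x cj_y
    by (rule F_cong dvdI[of _ "int p * int p" "(c - b + a) * m"] dvdI[of _ "int p * int p" "(f + d + a) * m"];
        simp add: algebra_simps)+
  have cx0: "cj x (F (int p * m) k l) = F (int p * (m - l)) k l"
    and cy0: "cj y (F (int p * m) k l) = F (int p * (m + k)) k l" for m k l
    using cx[of 0 m k l] cy[of 0 m k l] by simp_all
  have c1: "cj y (F (int p) 1 2) = F (int p * 2) 1 2" "cj y (F (int p) 0 0) = F (int p * 1) 0 0"
    "cj x (F (int p) 0 0) = F (int p * 1) 0 0" "cj x (F 0 0 1) = F (int p * - 1) 0 1"
    using cx0[of 1 0 0] cx0[of 0 0 1] cy0[of 1 1 2] cy0[of 1 0 0] by simp_all
  show ?thesis
    unfolding rel3_def Let_def z' X' Y F_power_p Z' cm_F cjx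
    by (unfold c1 cx cy cx0 cy0 F_zp F_mult F_inverse F_one[symmetric]; intro conjI)
       (rule F_cong; simp add: algebra_simps)+
qed

end

section \<open>Groups with p^3 many p-th powers satisfy the second presentation\<close>

lemma (in commuting) gen_E: "g \<in> gen {u1, u2, u3, u4} \<Longrightarrow> \<exists>i j k l. g = E i j k l"
proof (induction rule: gen.induct)
  case gen_one show ?case using E_one by metis
next
  case (gen_base a) then show ?case using E_gens by auto
next
  case (gen_mult a b) then show ?case using E_mult by metis
next
  case (gen_inverse a) then show ?case using E_inverse by metis
qed

lemma cm_flip_in: "nrm N H \<Longrightarrow> cm g h \<in> N \<Longrightarrow> cm h g \<in> N"
  using sgp_inverse[OF nrm_sgp, of N H "cm g h"] by (simp add: inverse_cm)

context regular_pgrp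
begin

text \<open>This is \<open>power_hom\<close> inside the subgroup generated by \<open>g\<close> and
  \<open>h\<close>, whose derived subgroup is killed by \<open>p\<close> once \<open>cm g h\<close>
  is.\<close>

lemma mult_power_cm:
  assumes "g \<in> H" "h \<in> H" "(cm g h) ^ p = 1"
  shows "(g * h) ^ p = g ^ p * h ^ p"
proof -
  let ?K = "gen {g, h}"
  have KH: "?K \<subseteq> H" using assms sgp by (intro gen_subset) auto
  obtain j where "regular_pgrp p j ?K" using regular_subgroup[OF sgp_gen KH] .
  then interpret K: regular_pgrp p j ?K .
  have N: "nrm (om p ?K) ?K" using K.nrm_om[of 1] by simp
  have gh: "g \<in> ?K" "h \<in> ?K" by (auto intro: gen_base)
  then have c: "cm g h \<in> om p ?K" using assms K.closed by (simp add: om_def)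
  have "cm a b \<in> om p ?K" if "a \<in> ?K" "b \<in> ?K" for a b
    by (rule cm_closed_gen[OF K.sgp refl N _ that])
       (use c cm_flip_in[OF N c] sgp_one[OF nrm_sgp[OF N]] in auto)
  then have "gam ?K 2 \<subseteq> om p ?K" using gam_2_subset[OF K.sgp N] by blast
  then show ?thesis using K.power_hom gh by blast
qed

text \<open>Modulo \<open>N\<close> the commutator of the two generators is central, so it alone
  generates the derived subgroup.\<close>

lemma gam_3_subset:
  assumes N: "nrm N H" and g: "gen {x, y} = H" and c: "cm (cm x y) x \<in> N" "cm (cm x y) y \<in> N"
  shows "gam H 3 \<subseteq> N" "gam H 2 \<subseteq> gen (insert (cm x y) N)"
proof -
  define z where "z = cm x y"
  have xy: "x \<in> H" "y \<in> H" using g gen_base[of _ "{x, y}"] by auto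
  have zH: "z \<in> H" using xy closed by (simp add: z_def)
  have zh: "cm z h \<in> N" if h: "h \<in> H" for h
  proof -
    have "cm h z \<in> N"
      by (rule cm_closed_gen_left[OF sgp _ N zH, of "{x, y}"])
         (use xy c g h cm_flip_in[OF N] in \<open>auto simp: z_def\<close>)
    then show ?thesis by (rule cm_flip_in[OF N])
  qed
  let ?M = "gen (insert z N)"
  have mh: "cm m h \<in> N" if "m \<in> ?M" "h \<in> H" for m h
    by (rule cm_closed_gen_left[OF sgp _ N that(2) _ that(1)])
       (use zH nrm_subset[OF N] zh that nrm_cm[OF N] in auto)
  have NM: "N \<subseteq> ?M" "z \<in> ?M" by (auto intro: gen_base)
  have M: "nrm ?M H"
    unfolding nrm_def
  proof (intro conjI ballI)
    show "?M \<subseteq> H" using zH nrm_subset[OF N] sgp by (intro gen_subset) auto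
    show "cj h m \<in> ?M" if "h \<in> H" "m \<in> ?M" for h m
      using mh[OF that(2,1)] NM that unfolding cj_eq_cm by (intro gen_mult) auto
  qed simp
  have "cm a b \<in> ?M" if "a \<in> H" "b \<in> H" for a b
    by (rule cm_closed_gen[OF sgp g[symmetric] M _ that])
       (use NM cm_flip_in[OF M, of x y] gen_one in \<open>auto simp: z_def\<close>)
  then show g2: "gam H 2 \<subseteq> gen (insert (cm x y) N)"
    using gam_2_subset[OF sgp M] by (simp add: z_def)
  have "gen {cm a b |a b. a \<in> gam H 2 \<and> b \<in> H} \<subseteq> N"
    by (rule gen_subset[OF _ nrm_sgp[OF N]]) (use g2 mh in \<open>auto simp: z_def\<close>)
  then show "gam H 3 \<subseteq> N" by (simp add: eval_nat_numeral)
qed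

text \<open>The elements killed by \<open>p\<close> coincide with the \<open>p\<close>-th powers and
  form a subgroup \<open>W\<close> of index \<open>p ^ 3\<close>. As \<open>H / W\<close> has class
  at most 2, conjugation acts on \<open>p\<close>-th powers by
  \<open>cj h (g ^ p) = g ^ p * cm g h ^ p\<close>. The free commutators \<open>cm z x\<close> and
  \<open>cm z y\<close> lie in \<open>W\<close> and are expanded in \<open>x ^ p\<close>,
  \<open>y ^ p\<close>, \<open>z ^ p\<close>.\<close>

lemma case3_structure:
  assumes k6: "k = 6" and g: "gen {x, y} = H"
    and e2: "\<And>g. g \<in> H \<Longrightarrow> (g ^ p) ^ p = 1" and c: "card (pw p H) = p ^ 3"
  shows "\<exists>a b c d f. rel3 p x y a b c d f"
proof -
  define W where "W = om p H"
  define z where "z = cm x y"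
  have p: "p > 1" by (rule p_gt_1)
  have xy: "x \<in> H" "y \<in> H" using g gen_base[of _ "{x, y}"] by auto
  then have zH: "z \<in> H" using closed by (simp add: z_def)
  have nW: "nrm W H" using nrm_om[of 1] by (simp add: W_def)
  note sW = nrm_sgp[OF nW]
  have cW: "card W = p ^ 3"
  proof -
    have "p ^ 3 * card W = p ^ 3 * p ^ 3" using card_om_pw[of 1] c card k6 p by (auto simp: W_def eval_nat_numeral)
    then have "card W = p ^ 3 \<or> p ^ 3 = 0" by (simp only: mult_cancel1)
    then show ?thesis using p by simp
  qed
  have W_pw: "W = pw p H"
    by (rule sym, rule card_subset_eq)
       (use finite e2 closed c cW in \<open>auto simp: W_def om_def pw_def\<close>)
  have Wp: "u ^ p = 1" "u \<in> H" if "u \<in> W" for u using that by (auto simp: W_def om_def)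
  have ccW: "cm (cm g h) l \<in> W" if "g \<in> H" "h \<in> H" "l \<in> H" for g h l
    by (rule cm_cm_in_index_p3[OF pgrp nW _ that]) (use cW card k6 in \<open>simp add: eval_nat_numeral\<close>)
  have cjp: "cj h (g ^ p) = g ^ p * (cm g h) ^ p" if "g \<in> H" "h \<in> H" for g h
  proof -
    have "cm g (cm g h) \<in> W" using ccW[of g h g] that cm_flip_in[OF nW] by blast
    then have "(g * cm g h) ^ p = g ^ p * (cm g h) ^ p"
      using that closed by (intro mult_power_cm) (auto simp: Wp)
    then show ?thesis by (simp only: cj_power cj_eq_cm[of h g])
  qed
  have W_comm: "u * v = v * u" if uv: "u \<in> W" "v \<in> insert z W" for u v
  proof -
    obtain g where g: "g \<in> H" "u = g ^ p" using uv(1) by (auto simp: W_pw pw_def)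
    have "cm g v \<in> W"
      using uv(2) nrm_cm'[OF nW _ g(1)] ccW[OF xy g(1)] cm_flip_in[OF nW] by (auto simp: z_def)
    then have "cj v u = u" using cjp[of g v] g uv Wp zH by auto
    then show ?thesis by (simp add: cj_eq_iff_commute)
  qed
  \<comment> \<open>Were \<open>z\<close> in \<open>W\<close>, adjoining \<open>y\<close> and
    \<open>x\<close> to \<open>W\<close> would give all of \<open>H\<close> with order at most
    \<open>p ^ 5\<close>.\<close>
  have zW: "z \<notin> W"
  proof
    assume zW: "z \<in> W"
    let ?S1 = "gen (insert y W)"
    let ?S2 = "gen (insert x ?S1)"
    have pW: "u ^ p \<in> W" if "u \<in> H" for u using that by (auto simp: W_pw pw_def)
    have fW: "finite W" using finite by (simp add: W_def om_def)
    have S1: "finite ?S1" "card ?S1 \<le> p * card W"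
      by (rule card_gen_insert_le[where n = p, OF sW _ pW[OF xy(2)]];
          use nrm_cj[OF nW xy(2)] fW p in simp)+
    have b1: "a \<in> insert y W \<Longrightarrow> a \<in> ?S1" for a by (rule gen_base)
    have cj1: "cj x s \<in> ?S1" if s: "s \<in> ?S1" for s
    proof (rule gen_cj_closed[OF _ s])
      have "cj x y = y * inverse z" by (simp add: cj_eq_cm z_def inverse_cm)
      then have "cj x y \<in> ?S1" using zW b1 by (auto intro!: gen_mult gen_inverse)
      then show "cj x a \<in> ?S1" if "a \<in> insert y W" for a
        using that nrm_cj[OF nW xy(1)] b1 by auto
    qed
    have S2: "finite ?S2" "card ?S2 \<le> p * card ?S1"
      by (rule card_gen_insert_le[where n = p, OF sgp_gen cj1 b1]; use S1(1) p pW[OF xy(1)] in simp)+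
    have "H \<subseteq> ?S2"
      unfolding g[symmetric] by (rule gen_subset) (use b1 in \<open>auto intro: gen_base\<close>)
    then have "card H \<le> card ?S2" using S2(1) by (intro card_mono)
    also have "\<dots> \<le> p * (p * card W)" using S1 S2 by (meson le_trans mult_le_mono2)
    also have "\<dots> = p ^ 5" using cW by (simp add: eval_nat_numeral)
    finally show False using card k6 p by simp
  qed
  then have zp1: "z ^ p \<noteq> 1" using zH by (simp add: W_def om_def)
  have XYZ: "x ^ p \<in> W" "y ^ p \<in> W" "z ^ p \<in> W" using xy zH by (auto simp: W_pw pw_def)
  have czW: "cm z h \<in> W" if "h \<in> H" for h unfolding z_def by (rule ccW[OF xy that])
  have fx: "cj y (x ^ p) = x ^ p * z ^ p" "cj x (y ^ p) = y ^ p * inverse (z ^ p)"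
    "cj x (z ^ p) = z ^ p" "cj y (z ^ p) = z ^ p"
  proof -
    show "cj y (x ^ p) = x ^ p * z ^ p" using cjp[OF xy] by (simp add: z_def)
    have "cm y x = inverse z" by (simp add: z_def inverse_cm)
    then show "cj x (y ^ p) = y ^ p * inverse (z ^ p)" using cjp[OF xy(2,1)] by (simp add: grp_power_inverse)
    show "cj x (z ^ p) = z ^ p" "cj y (z ^ p) = z ^ p" using cjp[OF zH] xy Wp(1)[OF czW] by simp_all
  qed
  interpret C: commuting "x ^ p" "y ^ p" "z ^ p" 1
    by unfold_locales (simp_all add: W_comm XYZ)
  \<comment> \<open>By Hall--Petrescu the elements whose \<open>p\<close>-th power lies in
    \<open>?G\<close> are closed under products: the error comes from \<open>p\<close>-th powers in
    the derived subgroup, and these are powers of \<open>z ^ p\<close>.\<close>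
  have W_gen: "u \<in> gen {x ^ p, y ^ p, z ^ p, 1}" if "u \<in> W" for u
  proof -
    let ?G = "gen {x ^ p, y ^ p, z ^ p, 1}"
    have b: "x ^ p \<in> ?G" "y ^ p \<in> ?G" "z ^ p \<in> ?G" by (auto intro: gen_base)
    have g2: "gam H 2 \<subseteq> gen (insert z W)"
      unfolding z_def by (rule gam_3_subset(2)[OF nW g ccW[OF xy xy(1)] ccW[OF xy xy(2)]])
    have eq: "gen (insert z W) = (\<lambda>(i, s). z ^ i * s) ` ({..<p} \<times> W)"
      by (rule gen_insert_normal[OF sW nrm_cj[OF nW zH] XYZ(3)]) (use p in simp_all)
    have "s \<in> ?G" if "s \<in> gen {g ^ (p ^ 1) |g. g \<in> gam H 2}" for s
    proof -
      have "{g ^ (p ^ 1) |g. g \<in> gam H 2} \<subseteq> ?G"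
      proof clarify
        fix h assume "h \<in> gam H 2"
        then have "h \<in> (\<lambda>(i, s). z ^ i * s) ` ({..<p} \<times> W)" using g2 by (simp only: eq subset_iff)
        then obtain i w where h: "h = z ^ i * w" "w \<in> W" by auto
        then have "h ^ p = (z ^ i) ^ p"
          using mult_order'[of "z ^ i" w 1] Wp zH closed by simp
        then have "h ^ p = (z ^ p) ^ i" by (simp add: mult.commute flip: power_mult)
        then show "h ^ p ^ 1 \<in> ?G" using b by (simp add: sgp_power[OF sgp_gen])
      qed
      then show ?thesis using gen_subset[OF _ sgp_gen] that by blast
    qed
    then have mult: "(g * h) ^ p \<in> ?G" if "g \<in> H" "h \<in> H" "g ^ p \<in> ?G" "h ^ p \<in> ?G" for g h
      using pgrp_power_mult[OF pgrp k that(1,2), of 1] that(3,4) by (auto intro!: gen_mult)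
    have "h \<in> H \<and> h ^ p \<in> ?G" if "h \<in> gen {x, y}" for h
      using that
    proof induction
      case (gen_mult a b) then show ?case using mult closed by simp
    next
      case (gen_inverse a) then show ?case using closed by (simp add: grp_power_inverse gen.gen_inverse)
    qed (use b xy closed gen_one in auto)
    then show ?thesis using that g by (auto simp: W_pw pw_def)
  qed
  have W_rep: "\<exists>i j l. u = zp (x ^ p) i * (zp (y ^ p) j * zp (z ^ p) l)" if "u \<in> W" for u
    using C.gen_E[OF W_gen[OF that]] by (auto simp: C.E_def)
  obtain A B C where r1: "cm z x = zp (x ^ p) A * (zp (y ^ p) B * zp (z ^ p) C)"
    using W_rep[OF czW[OF xy(1)]] by blast
  obtain D E F where r2: "cm z y = zp (x ^ p) D * (zp (y ^ p) E * zp (z ^ p) F)"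
    using W_rep[OF czW[OF xy(2)]] by blast
  have cmE: "cm z x = C.E A B C 0" "cm z y = C.E D E F 0" using r1 r2 by (simp_all add: C.E_def)
  have cyE: "cj y (C.E i j l 0) = C.E i j (l + i) 0" for i j l
  proof -
    have "zp (x ^ p * z ^ p) i = zp (x ^ p) i * zp (z ^ p) i"
      by (rule zp_commute_mult) (rule C.comm(2)[symmetric])
    then show ?thesis
      by (simp add: C.cj_E fx cj_power[of y y] C.zp_gens(1,2,3) C.E_mult add.commute cj_def[of y y])
  qed
  have cxE: "cj x (C.E i j l 0) = C.E i j (l - j) 0" for i j l
  proof -
    have "zp (y ^ p * inverse (z ^ p)) j = zp (y ^ p) j * zp (z ^ p) (- j)"
      using zp_commute_mult[of "y ^ p" "inverse (z ^ p)" j] C.E_commute[of 0 1 0 0 0 0 "- 1" 0] zp_zp[of "z ^ p" "- 1" j]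
      by (simp add: C.E_def zp_minus)
    then show ?thesis
      by (simp add: C.cj_E fx cj_power[of x x] C.zp_gens(1,2,3) C.E_mult cj_def[of x x])
  qed
  have EW: "C.E i j l 0 \<in> W" for i j l by (rule C.E_in[OF sW XYZ sgp_one[OF sW]])
  \<comment> \<open>The action of \<open>x * y = y * x * z\<close> on \<open>z\<close> is computed
    in two ways; the comparison is a Jacobi identity and yields \<open>A + E = 0\<close> modulo
    \<open>p\<close>.\<close>
  have "cj y (cj x z) = z * (C.E D E F 0 * C.E A B (C + A) 0)"
    by (simp add: cj_eq_cm[of _ z] cmE cyE mult.assoc)
  moreover have "cj z (cj x (cj y z)) = z * (C.E A B C 0 * C.E D E (F - E) 0)"
    by (simp add: cj_eq_cm[of _ z] cmE cxE mult.assoc C.E_mult) (simp add: cj_eq_iff_commute W_comm[OF EW])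
  moreover have "cj y (cj x z) = cj z (cj x (cj y z))"
    using mult_eq_cm[of x y] by (simp add: cj_cj z_def)
  ultimately have "C.E D E F 0 * C.E A B (C + A) 0 = C.E A B C 0 * C.E D E (F - E) 0" by simp
  then have "inverse (C.E A B C 0 * C.E D E (F - E) 0) * (C.E D E F 0 * C.E A B (C + A) 0) = 1" by (simp only: grp_left_inverse)
  then have "C.E 0 0 (A + E) 0 = 1" by (simp add: C.E_mult C.E_inverse add.commute)
  then have ZAE: "zp (z ^ p) (A + E) = 1" by (simp add: C.E_def)
  have AE: "int p dvd A + E"
  proof (rule ccontr)
    assume "\<not> int p dvd A + E"
    then have "coprime (A + E) (int p)" by (rule coprime_prime_int[OF prime])
    then have "z ^ p \<in> gen {zp (z ^ p) (A + E)}"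
      by (rule coprime_power_generates[OF Wp(1)[OF XYZ(3)]])
    then have "z ^ p \<in> gen {1}" by (simp add: ZAE)
    then show False using zp1 gen_sgp[of "{1 :: 'a}"] by simp
  qed
  \<comment> \<open>As 2 is invertible, \<open>A\<close> can be written as \<open>2 * a\<close>, and
    then \<open>E\<close> is \<open>- (2 * a)\<close> modulo \<open>p\<close>.\<close>
  have "\<not> int p dvd 2" using k k6 by (auto dest: zdvd_imp_le)
  then obtain a :: nat where a: "[int a * 2 = A] (mod int p)" using unit_solve[OF prime] by blast
  have cong: "zp (x ^ p) A = zp (x ^ p) (2 * int a)" "zp (y ^ p) E = zp (y ^ p) (- (2 * int a))"
  proof -
    show "zp (x ^ p) A = zp (x ^ p) (2 * int a)"
      using a by (intro zp_cong[OF Wp(1)[OF XYZ(1)]]) (simp add: cong_iff_dvd_diff dvd_diff_commute mult.commute)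
    have "int p dvd (A + E) + (int a * 2 - A)" using a by (intro dvd_add[OF AE]) (simp add: cong_iff_dvd_diff)
    then show "zp (y ^ p) E = zp (y ^ p) (- (2 * int a))"
      by (intro zp_cong[OF Wp(1)[OF XYZ(2)]]) (simp add: algebra_simps)
  qed
  have "rel3 p x y (int a) B (C + B - int a) D (F - D - int a)"
    unfolding rel3_def Let_def z_def[symmetric]
    using XYZ W_comm[of _ z] W_comm[OF XYZ(2)] W_comm[OF XYZ(2), of "x ^ p"] Wp fx r1 r2 cong C.comm(1)
    by simp
  then show ?thesis by blast
qed

end

lemma rel3_iso:
  fixes G :: "'a::grp set" and H :: "'b::grp set"
  assumes "odd p" "rel3 p x y a b c d f" "gen {x, y} = G" "card G = p ^ 6"
    and "rel3 p x' y' a b c d f" "gen {x', y'} = H" "card H = p ^ 6"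
  shows "mon G \<cong> mon H"
proof -
  interpret case3 p "(x, x')" "(y, y')" a b c d f
    by unfold_locales (use assms in \<open>simp_all add: rel3_pair odd_pos\<close>)
  show ?thesis by (rule iso_of_common_relations[OF assms(3,4,6,7) card_rel3])
qed

section \<open>Reduction of the second presentation to normal forms\<close>

lemma rel3_cong:
  assumes "rel3 p x y a b c d f" and cong: "[a = a'] (mod int p)" "[b = b'] (mod int p)"
    "[c = c'] (mod int p)" "[d = d'] (mod int p)" "[f = f'] (mod int p)"
  shows "rel3 p x y a' b' c' d' f'"
proof -
  have o: "(x ^ p) ^ p = 1" "(y ^ p) ^ p = 1" "(cm x y ^ p) ^ p = 1"
    using assms(1) by (simp_all add: rel3_def Let_def)
  have "[2 * a = 2 * a'] (mod int p)" "[- (2 * a) = - (2 * a')] (mod int p)"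
    "[c - b + a = c' - b' + a'] (mod int p)" "[f + d + a = f' + d' + a'] (mod int p)"
    by (intro cong_add cong_diff cong_mult cong_refl cong cong_minus_minus_iff[THEN iffD2])+
  then have "zp (x ^ p) (2 * a) = zp (x ^ p) (2 * a')" "zp (y ^ p) (- (2 * a)) = zp (y ^ p) (- (2 * a'))"
    "zp (y ^ p) b = zp (y ^ p) b'" "zp (x ^ p) d = zp (x ^ p) d'"
    "zp (cm x y ^ p) (c - b + a) = zp (cm x y ^ p) (c' - b' + a')"
    "zp (cm x y ^ p) (f + d + a) = zp (cm x y ^ p) (f' + d' + a')"
    using cong by (auto intro!: zp_cong[OF o(1)] zp_cong[OF o(2)] zp_cong[OF o(3)] simp: cong_iff_dvd_diff)
  then show ?thesis using assms(1) by (simp add: rel3_def Let_def)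
qed

definition data3 :: "nat \<Rightarrow> 'a::grp set \<Rightarrow> int \<Rightarrow> int \<Rightarrow> int \<Rightarrow> int \<Rightarrow> int \<Rightarrow> bool" where
  "data3 p H a b c d f \<longleftrightarrow> (\<exists>x y. gen {x, y} = H \<and> rel3 p x y a b c d f)"

lemma data3_cong:
  "data3 p H a b c d f \<Longrightarrow> [a = a'] (mod int p) \<Longrightarrow> [b = b'] (mod int p) \<Longrightarrow>
    [c = c'] (mod int p) \<Longrightarrow> [d = d'] (mod int p) \<Longrightarrow> [f = f'] (mod int p) \<Longrightarrow> data3 p H a' b' c' d' f'"
  unfolding data3_def using rel3_cong by blast

locale odd_regular_pgrp = regular_pgrp +
  assumes odd_p: "odd p"
begin

lemma case3I: "rel3 p x y a b c d f \<Longrightarrow> case3 p x y a b c d f"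
  using p_gt_1 odd_p by unfold_locales auto

lemma data3_swap: "data3 p H a b c d f \<Longrightarrow> data3 p H a (- d) f (- b) c"
  unfolding data3_def using case3.swap[OF case3I] by (metis insert_commute)

lemma data3_scale_x:
  assumes "data3 p H a b c d f" "coprime (int n) (int p)"
  shows "data3 p H (int n * a) (int n ^ 2 * b) (int n * c) d f"
  using assms unfolding data3_def using case3.scale_x[OF case3I] gen_scale(1) by blast

lemma data3_scale_y:
  assumes "data3 p H a b c d f" "coprime (int n) (int p)"
  shows "data3 p H (int n * a) b c (int n ^ 2 * d) (int n * f)"
  using data3_swap[OF data3_scale_x[OF data3_swap[OF assms(1)] assms(2)]] by simp

text \<open>Here \<open>gam H 3\<close> is killed by \<open>p\<close>, so the second-order
  Hall--Petrescu formula gives the \<open>p\<close>-th power of \<open>x * y\<^sup>2\<close>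
  exactly.\<close>

lemma data3_shear2:
  assumes "data3 p H a b c d f"
  shows "data3 p H (a + d) (b - 8 * a - 4 * d) (c + 2 * f) d f"
proof -
  obtain x y where xy: "gen {x, y} = H" "rel3 p x y a b c d f" using assms(1) by (auto simp: data3_def)
  interpret case3 p x y a b c d f by (rule case3I[OF xy(2)])
  have H: "x \<in> H" "y \<in> H" "z \<in> H" using mem xy(1) by auto
  have N: "nrm (om p H) H" using nrm_om[of 1] by simp
  have FH: "F i k l \<in> H" for i k l
    unfolding F_def by (rule E_in[OF sgp]) (use H closed in auto)
  have Fom: "F (int p * t) k l \<in> om p H" for t k l
  proof -
    have "F (int p * (int p * t)) 0 0 = F 0 0 0" by (rule F_cong) simp_all
    then show ?thesis by (simp add: om_def FH F_power_p F_one)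
  qed
  have "cm (F 1 0 0) x = F (int p * (c - b + a)) (2 * a) b" "cm (F 1 0 0) y = F (int p * (f + d + a)) d (- (2 * a))"
    by (simp_all add: cm_F cj_x cj_y F_mult)
  then have "cm z x \<in> om p H" "cm z y \<in> om p H" using Fom by (simp_all only: gens(1))
  then have g3: "gam H 3 \<subseteq> om p H" by (rule gam_3_subset(1)[OF N xy(1)])
  have one: "gen {g ^ (p ^ 1) |g. g \<in> gam H 3} \<subseteq> {1}"
    by (rule gen_subset) (use g3 in \<open>auto simp: om_def\<close>)
  obtain s where s: "s \<in> gen {g ^ (p ^ 1) |g. g \<in> gam H 3}"
    "(x * y\<^sup>2) ^ (p ^ 1) = x ^ (p ^ 1) * (y\<^sup>2) ^ (p ^ 1) * cj (y\<^sup>2) (cm (y\<^sup>2) x) ^ (p ^ 1 choose 2) * s"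
    using hall_petrescu_gam_2[OF sgp gam_pgrp_trivial[OF pgrp] prime k H(1), of "y\<^sup>2" 1] H closed by blast
  have s1: "s = 1" using s(1) one by blast
  have "cm (y\<^sup>2) x = cj y (F (- 1) 0 0) * F (- 1) 0 0"
  proof -
    have "cm y x = F (- 1) 0 0" using F_inverse[of 1 0 0] by (simp add: inverse_cm flip: gens(1))
    then show ?thesis by (simp add: power2_eq_square cm_mult_left)
  qed
  also have "cj y (F (- 1) 0 0) * F (- 1) 0 0 = F (- 2 + int p * - (f + d + a)) (- d) (2 * a)"
    by (simp add: cj_y F_mult algebra_simps)
  finally have c1: "cm (y\<^sup>2) x = F (- 2 + int p * - (f + d + a)) (- d) (2 * a)" .
  have step: "\<exists>m' k' l'. cj y (F (- 2 + int p * m) k l) = F (- 2 + int p * m') k' l'" for m k l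
  proof -
    have "cj y (F (- 2 + int p * m) k l) = F (- 2 + int p * (m + ((f + d + a) * (- 2 + int p * m) + k)))
        (k + d * (- 2 + int p * m)) (l - 2 * a * (- 2 + int p * m))"
      unfolding cj_y by (simp only: distrib_left add.assoc)
    then show ?thesis by blast
  qed
  obtain m k' l' where m: "cj (y\<^sup>2) (cm (y\<^sup>2) x) = F (- 2 + int p * m) k' l'"
  proof -
    obtain m1 k1 l1 where 1: "cj y (cm (y\<^sup>2) x) = F (- 2 + int p * m1) k1 l1" unfolding c1 using step by blast
    obtain m2 k2 l2 where 2: "cj y (F (- 2 + int p * m1) k1 l1) = F (- 2 + int p * m2) k2 l2" using step by blast
    have "cj (y\<^sup>2) (cm (y\<^sup>2) x) = cj y (cj y (cm (y\<^sup>2) x))" by (simp only: power2_eq_square cj_cj)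
    then have "cj (y\<^sup>2) (cm (y\<^sup>2) x) = F (- 2 + int p * m2) k2 l2" by (simp only: 1 2)
    then show ?thesis by (rule that)
  qed
  \<comment> \<open>Up to factors killed by \<open>p\<close> the base is the inverse of
    \<open>z ^ 2\<close>, and \<open>- 2 * (p choose 2) = - p * (p - 1)\<close> is congruent to
    \<open>p\<close> modulo \<open>p ^ 2\<close>.\<close>
  have "F (- 2 + int p * m) k' l' ^ (p choose 2) = F (int p) 0 0"
  proof -
    obtain h where h: "p = 2 * h + 1" using odd_p by (rule oddE)
    have C: "p choose 2 = p * h" by (simp add: choose_two h)
    have "F (- 2 + int p * m) k' l' ^ (p choose 2) =
        F (int (p * h) * (- 2 + int p * m)) (int (p * h) * k') (int (p * h) * l')"
      using F_zp[of "- 2 + int p * m" k' l' "int (p * h)"] by (simp only: zp_of_nat C)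
    also have "\<dots> = F (int p) 0 0"
    proof (rule F_cong)
      have "int p = 2 * int h + 1" using h by simp
      then show "int p * int p dvd int (p * h) * (- 2 + int p * m) - int p"
        by (intro dvdI[of _ _ "int h * m - 1"]) (simp add: algebra_simps)
    qed simp_all
    finally show ?thesis .
  qed
  then have "(x * y\<^sup>2) ^ p = x ^ p * (y\<^sup>2) ^ p * F (int p) 0 0"
    using s(2) s1 m by simp
  also have "(y\<^sup>2) ^ p = y ^ p * y ^ p" by (simp only: power_mult[symmetric] power_add[symmetric] mult_2)
  also have "x ^ p * (y ^ p * y ^ p) * F (int p) 0 0 = F (int p) 1 2"
    by (simp add: gens(2,3) F_mult)
  finally show ?thesis
    unfolding data3_def using shear gen_shear[OF xy(1)] by blast
qed

lemma data3_shear: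
  "data3 p H a b c d f \<Longrightarrow>
    data3 p H (a + int m * d) (b - 8 * int m * a - 4 * int m ^ 2 * d) (c + 2 * int m * f) d f"
proof (induction m)
  case (Suc m)
  from data3_shear2[OF Suc.IH[OF Suc.prems]] show ?case
    by (simp add: algebra_simps power2_eq_square)
qed simp

definition normal3 :: "int \<Rightarrow> (int \<times> int \<times> int \<times> int \<times> int) set" where
  "normal3 n0 = (\<lambda>b. (0, b, 1, 1, 0)) ` {0..<int p} \<union> (\<lambda>b. (0, b, 1, n0, 0)) ` {0..<int p} \<union>
     (\<lambda>a. (a, 0, 1, 0, 0)) ` {0..<int p} \<union> (\<lambda>b. (0, b, 1, 0, 0)) ` {0..<int p} \<union>
     (\<lambda>b. (0, b, 0, 1, 0)) ` {0..<int p} \<union> (\<lambda>b. (0, b, 0, n0, 0)) ` {0..<int p} \<union>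
     (\<lambda>a. (a, 0, 0, 0, 0)) ` {0..<int p}"

lemma normal3_mem:
  "(0, r mod int p, 1, 1, 0) \<in> normal3 n0" "(0, r mod int p, 1, n0, 0) \<in> normal3 n0"
  "(r mod int p, 0, 1, 0, 0) \<in> normal3 n0" "(0, r mod int p, 1, 0, 0) \<in> normal3 n0"
  "(0, r mod int p, 0, 1, 0) \<in> normal3 n0" "(0, r mod int p, 0, n0, 0) \<in> normal3 n0"
  "(r mod int p, 0, 0, 0, 0) \<in> normal3 n0"
  using p_gt_1 by (simp_all add: normal3_def image_iff)

lemma card_normal3: "finite (normal3 n0)" "card (normal3 n0) \<le> 7 * p"
proof -
  have c: "card (f ` {0..<int p}) \<le> p" for f :: "int \<Rightarrow> int \<times> int \<times> int \<times> int \<times> int"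
    using card_image_le[of "{0..<int p}" f] by simp
  show "finite (normal3 n0)" unfolding normal3_def by simp
  have "card (normal3 n0) \<le> p + p + p + p + p + p + p"
    unfolding normal3_def by (intro order_trans[OF card_Un_le] add_mono c)
  then show "card (normal3 n0) \<le> 7 * p" by simp
qed

text \<open>Modulo \<open>p\<close>, the form \<open>d * t^2 + 2 * a * t * s - (b / 4) * s^2\<close>
  transforms as a binary quadratic form and \<open>2 * f * t + c * s\<close> as a linear form under
  the changes of generators. The linear form is first brought to \<open>s\<close> or 0, then the
  quadratic form is reduced by substitutions that keep it.\<close>

lemma data3_normal:
  assumes n0: "square_class p n0" and D: "data3 p H a b c d f"
  shows "\<exists>(a', b', c', d', f') \<in> normal3 n0. data3 p H a' b' c' d' f'"
proof -
  have md: "[r = r mod int p] (mod int p)" for r by (simp add: cong_def)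
  have u1: "\<not> int p dvd 1" using p_gt_1 by simp
  have u2: "\<not> int p dvd 2" using odd_p by (metis even_of_nat_iff dvd_refl prime prime_nat_int_transfer primes_dvd_imp_eq two_is_prime_nat of_nat_numeral int_dvd_int_iff)
  have u8: "\<not> int p dvd 8 * a" if "\<not> int p dvd a" for a
  proof
    assume "int p dvd 8 * a"
    then have "int p dvd 2 ^ 3 * a" by simp
    then have "int p dvd 2 ^ 3 \<or> int p dvd a" using prime by (simp only: prime_dvd_mult_iff prime_nat_int_transfer)
    then show False using that u2 prime by (metis prime_dvd_power prime_nat_int_transfer)
  qed
  have c1: ?thesis if D: "data3 p H a b 1 d 0" for a b d
  proof (cases "int p dvd d")
    case False
    obtain m where m: "[int m * d = - a] (mod int p)" using unit_solve[OF prime False] by blast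
    define b' where "b' = b - 8 * int m * a - 4 * int m ^ 2 * d"
    have 1: "data3 p H 0 b' 1 d 0"
      by (rule data3_cong[OF data3_shear[OF D, of m]])
         (use m in \<open>simp_all add: cong_iff_dvd_diff add.commute b'_def\<close>)
    obtain v :: nat where v: "coprime (int v) (int p)" and
      v2: "[int v ^ 2 * d = 1] (mod int p) \<or> [int v ^ 2 * d = n0] (mod int p)"
      using n0 False unfolding square_class_def by blast
    have "data3 p H 0 (b' mod int p) 1 1 0 \<or> data3 p H 0 (b' mod int p) 1 n0 0"
      using v2 data3_cong[OF data3_scale_y[OF 1 v] _ md] by auto
    then show ?thesis using normal3_mem(1,2)[of b' n0] by fast
  next
    case d: True
    show ?thesis
    proof (cases "int p dvd a")
      case False
      obtain m where m: "[int m * (8 * a) = b] (mod int p)" using unit_solve[OF prime u8[OF False]] by blast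
      have "data3 p H (a mod int p) 0 1 0 0"
      proof (rule data3_cong[OF data3_shear[OF D, of m]])
        show "[b - 8 * int m * a - 4 * int m ^ 2 * d = 0] (mod int p)"
        proof -
          have "int p dvd b - int m * (8 * a)" using m by (simp add: cong_iff_dvd_diff dvd_diff_commute)
          moreover have "int p dvd 4 * int m ^ 2 * d" using d by simp
          ultimately have "int p dvd (b - int m * (8 * a)) - 4 * int m ^ 2 * d" by (rule dvd_diff)
          then show ?thesis by (simp add: cong_0_iff algebra_simps)
        qed
        have "int p dvd (a - a mod int p) + int m * d" using d by (intro dvd_add) (simp_all add: minus_mod_eq_mult_div)
        then show "[a + int m * d = a mod int p] (mod int p)" by (simp add: cong_iff_dvd_diff algebra_simps)
      qed (use d in \<open>simp_all add: cong_0_iff\<close>)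
      then show ?thesis by (intro bexI[OF _ normal3_mem(3)]) simp
    next
      case True
      have "data3 p H 0 (b mod int p) 1 0 0"
        by (rule data3_cong[OF D _ md]) (use True d in \<open>simp_all add: cong_0_iff\<close>)
      then show ?thesis by (intro bexI[OF _ normal3_mem(4)]) simp
    qed
  qed
  have cu: ?thesis if D: "data3 p H a b c d 0" and c: "\<not> int p dvd c" for a b c d
  proof -
    obtain l where l: "[int l * c = 1] (mod int p)" "coprime (int l) (int p)"
      using unit_solve_unit[OF prime c u1] by blast
    show ?thesis
      by (rule c1) (rule data3_cong[OF data3_scale_x[OF D l(2)] cong_refl cong_refl l(1) cong_refl cong_refl])
  qed
  have c0: ?thesis if D: "data3 p H a b 0 d 0" and d: "\<not> int p dvd d" for a b d
  proof -
    obtain m where m: "[int m * d = - a] (mod int p)" using unit_solve[OF prime d] by blast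
    define b' where "b' = b - 8 * int m * a - 4 * int m ^ 2 * d"
    have 1: "data3 p H 0 b' 0 d 0"
      by (rule data3_cong[OF data3_shear[OF D, of m]])
         (use m in \<open>simp_all add: cong_iff_dvd_diff add.commute b'_def\<close>)
    obtain v :: nat where v: "coprime (int v) (int p)" and
      v2: "[int v ^ 2 * d = 1] (mod int p) \<or> [int v ^ 2 * d = n0] (mod int p)"
      using n0 d unfolding square_class_def by blast
    have "data3 p H 0 (b' mod int p) 0 1 0 \<or> data3 p H 0 (b' mod int p) 0 n0 0"
      using v2 data3_cong[OF data3_scale_y[OF 1 v] _ md] by auto
    then show ?thesis using normal3_mem(5,6)[of b' n0] by fast
  qed
  show ?thesis
  proof (cases "int p dvd f")
    case False
    have "\<not> int p dvd 2 * f" using False u2 prime by (simp add: prime_dvd_mult_iff)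
    then obtain m where m: "[int m * (2 * f) = - c] (mod int p)" using unit_solve[OF prime] by blast
    \<comment> \<open>The shear removes \<open>c\<close>, and the swap then moves the unit
      \<open>f\<close> into its place.\<close>
    have "data3 p H (a + int m * d) (b - 8 * int m * a - 4 * int m ^ 2 * d) 0 d f"
      by (rule data3_cong[OF data3_shear[OF D, of m]])
         (use m in \<open>simp_all add: cong_iff_dvd_diff ac_simps\<close>)
    from data3_swap[OF this] False show ?thesis by (rule cu)
  next
    case f: True
    have D0: "data3 p H a b c d 0"
      by (rule data3_cong[OF D]) (use f in \<open>simp_all add: cong_0_iff\<close>)
    show ?thesis
    proof (cases "int p dvd c")
      case False
      then show ?thesis by (rule cu[OF D0])
    next
      case c: True
      have D1: "data3 p H a b 0 d 0"
        by (rule data3_cong[OF D0]) (use c in \<open>simp_all add: cong_0_iff\<close>)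
      consider "\<not> int p dvd d" | "int p dvd d" "\<not> int p dvd b" | "int p dvd d" "int p dvd b" by blast
      then show ?thesis
      proof cases
        case 1 then show ?thesis by (rule c0[OF D1])
      next
        case 2
        have "\<not> int p dvd - b" using 2 by simp
        with data3_swap[OF D1] show ?thesis by (rule c0)
      next
        case 3
        have "data3 p H (a mod int p) 0 0 0 0"
          by (rule data3_cong[OF D1 md]) (use 3 in \<open>simp_all add: cong_0_iff\<close>)
        then show ?thesis by (intro bexI[OF _ normal3_mem(7)]) simp
      qed
    qed
  qed
qed

end

subsection \<open>Groups of exponent $p^3$\<close>

text \<open>A metacyclic presentation in which only \<open>m\<close> modulo \<open>p ^ 2\<close>
  matters.\<close>

definition rel4 :: "nat \<Rightarrow> 'a::grp \<Rightarrow> 'a \<Rightarrow> int \<Rightarrow> bool" where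
  "rel4 p h y m \<longleftrightarrow> h ^ (p ^ 3) = 1 \<and> y ^ (p ^ 3) = 1 \<and> cj y h = zp h (1 + int p * m)"

lemma rel4_pair: "rel4 p (h, h') (y, y') m \<longleftrightarrow> rel4 p h y m \<and> rel4 p h' y' m"
  by (auto simp: rel4_def prod_eq_iff)

lemma card_rel4:
  assumes "rel4 p h y m" "p > 0"
  shows "finite (gen {h, y})" "card (gen {h, y}) \<le> p ^ 6"
proof -
  let ?ks = "[y, y ^ p, y ^ p\<^sup>2, h, h ^ p, h ^ p\<^sup>2]"
  have rel: "h ^ (p ^ 3) = 1" "y ^ (p ^ 3) = 1" "cj y h = zp h (1 + int p * m)"
    using assms by (auto simp: rel4_def)
  have cjn: "\<exists>i. cj (y ^ n) (h ^ j) = zp h i" for n j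
  proof -
    have "\<exists>i. cj (y ^ n) h = zp h i"
    proof (induction n)
      case 0 show ?case by (intro exI[of _ 1]) simp
    next
      case (Suc n)
      then obtain i where i: "cj (y ^ n) h = zp h i" by blast
      have "cj (y ^ Suc n) h = cj y (cj (y ^ n) h)" by (simp add: power_Suc2 cj_cj del: power_Suc)
      also have "\<dots> = zp h ((1 + int p * m) * i)" by (simp add: i zp_cj[symmetric] rel zp_zp)
      finally show ?case by blast
    qed
    then obtain i where "cj (y ^ n) h = zp h i" by blast
    then have "cj (y ^ n) (h ^ j) = zp h (i * int j)" by (simp add: cj_power zp_power)
    then show ?thesis by blast
  qed
  have hin: "zp h i \<in> gen (insert h A)" for i A by (intro sgp_zp gen_base) auto
  have cjh: "cj (y ^ n) (h ^ j) \<in> gen (insert h A)" for n j A using cjn[of n j] hin by metis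
  have self: "cj (g ^ i) (g ^ j) = g ^ j" for g :: 'a and i j
    by (simp add: cj_eq_iff_commute flip: power_add) (simp add: add.commute)
  have p3: "(g ^ p\<^sup>2) ^ p = g ^ (p ^ 3)" for g :: 'a
    by (simp add: power2_eq_square power3_eq_cube mult.assoc flip: power_mult)
  have p2: "(g ^ p) ^ p = g ^ p\<^sup>2" for g :: 'a
    by (simp add: power2_eq_square flip: power_mult)
  have insert2: "insert (a :: 'a) (insert b A) = insert b (insert a A)" for a b A by auto
  have "polycyclic p ?ks"
    using self[of _ 1] self[of y p] self[of h p] self[of h "p\<^sup>2"] cjh[of 1] cjh[of _ 1] cjh
    by (simp add: p3 p2 rel gen_one gen_base insert_commute[of _ h] hin)
  then have "finite (gen (set ?ks)) \<and> card (gen (set ?ks)) \<le> p ^ length ?ks"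
    using polycyclic_card assms(2) by blast
  moreover have "gen (set ?ks) = gen {h, y}"
  proof
    have "h \<in> gen {h, y}" "y \<in> gen {h, y}" by (auto intro: gen_base)
    then show "gen (set ?ks) \<subseteq> gen {h, y}"
      by (intro gen_subset) (auto intro: sgp_power[OF sgp_gen])
  qed (rule gen_mono, simp)
  ultimately show "finite (gen {h, y})" "card (gen {h, y}) \<le> p ^ 6"
    by (simp_all add: eval_nat_numeral)
qed

lemma rel4_iso:
  fixes G :: "'a::grp set" and H :: "'b::grp set"
  assumes "p > 0" "rel4 p x y m" "gen {x, y} = G" "card G = p ^ 6"
    and "rel4 p x' y' m" "gen {x', y'} = H" "card H = p ^ 6"
  shows "mon G \<cong> mon H"
  using assms card_rel4[of p "(x, x')" "(y, y')" m]
  by (intro iso_of_common_relations[of x y G "p ^ 6" x' y' H]) (simp_all add: rel4_pair)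

lemma rel4_cong:
  assumes "rel4 p h y m" "[m = m'] (mod int p ^ 2)"
  shows "rel4 p h y m'"
proof -
  have "int p * (m - m') = int p * m - int p * m'" by (simp add: algebra_simps)
  moreover have "int p * int p ^ 2 dvd int p * (m - m')"
    using assms(2) by (intro mult_dvd_mono) (simp_all add: cong_iff_dvd_diff)
  ultimately have "zp h (1 + int p * m) = zp h (1 + int p * m')"
    using assms(1) by (intro zp_cong[of h "p ^ 3"]) (auto simp: rel4_def power2_eq_square power3_eq_cube)
  then show ?thesis using assms(1) by (simp add: rel4_def)
qed

lemma power_one_plus:
  "\<exists>m'. (1 + int p * m) ^ n = 1 + int p * m' \<and> [m' = int n * m] (mod int p)"
proof (induction n)
  case 0 show ?case by (intro exI[of _ 0]) simp
next
  case (Suc n)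
  then obtain m' where m': "(1 + int p * m) ^ n = 1 + int p * m'" "[m' = int n * m] (mod int p)" by blast
  have "(1 + int p * m) ^ Suc n = 1 + int p * (m' + m + int p * (m * m'))"
    using m'(1) by (simp add: algebra_simps)
  moreover have "[m' + m + int p * (m * m') = int n * m + m + 0] (mod int p)"
    by (intro cong_add m'(2) cong_refl) (simp add: cong_0_iff)
  then have "[m' + m + int p * (m * m') = int (Suc n) * m] (mod int p)" by (simp add: algebra_simps)
  ultimately show ?case by blast
qed

text \<open>Replacing \<open>y\<close> by \<open>y ^ n\<close> raises \<open>1 + p * m\<close> to
  the \<open>n\<close>-th power, which multiplies \<open>m\<close> by \<open>n\<close> modulo
  \<open>p\<close>.\<close>

lemma rel4_power:
  assumes "rel4 p h y m"
  shows "\<exists>m'. rel4 p h (y ^ n) m' \<and> [m' = int n * m] (mod int p)"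
proof -
  have rel: "h ^ (p ^ 3) = 1" "y ^ (p ^ 3) = 1" "cj y h = zp h (1 + int p * m)"
    using assms by (auto simp: rel4_def)
  have "cj (y ^ n) h = zp h ((1 + int p * m) ^ n)"
  proof (induction n)
    case (Suc n)
    have "cj (y ^ Suc n) h = cj y (cj (y ^ n) h)" by (simp add: power_Suc2 cj_cj del: power_Suc)
    then show ?case by (simp add: Suc zp_cj[symmetric] rel zp_zp)
  qed simp
  moreover obtain m' where "(1 + int p * m) ^ n = 1 + int p * m'" "[m' = int n * m] (mod int p)"
    using power_one_plus by blast
  moreover have "(y ^ n) ^ (p ^ 3) = (y ^ (p ^ 3)) ^ n" by (simp add: mult.commute flip: power_mult)
  ultimately show ?thesis using rel by (auto simp: rel4_def)
qed

definition data4 :: "nat \<Rightarrow> 'a::grp set \<Rightarrow> int \<Rightarrow> bool" where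
  "data4 p H m \<longleftrightarrow> (\<exists>h y. gen {h, y} = H \<and> rel4 p h y m)"

context regular_pgrp
begin

text \<open>The last digit of \<open>m\<close> in base \<open>p\<close> is scaled to 1 or is 0; the
  next digit \<open>t\<close> is left free.\<close>

definition normal4 :: "int set" where
  "normal4 = (\<lambda>t. 1 + int p * t) ` {0..<int p} \<union> (\<lambda>t. int p * t) ` {0..<int p}"

lemma card_normal4: "finite normal4" "card normal4 \<le> 2 * p"
proof -
  have c: "card (f ` {0..<int p}) \<le> p" for f :: "int \<Rightarrow> int"
    using card_image_le[of "{0..<int p}" f] by simp
  show "finite normal4" unfolding normal4_def by simp
  have "card normal4 \<le> p + p"
    unfolding normal4_def by (intro order_trans[OF card_Un_le] add_mono c)
  then show "card normal4 \<le> 2 * p" by simp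
qed

lemma cong_p2: "[m = r] (mod int p) \<Longrightarrow> \<exists>t\<in>{0..<int p}. [m = r + int p * t] (mod int p ^ 2)"
proof -
  assume "[m = r] (mod int p)"
  then obtain s where s: "m = r + int p * s" by (auto simp: cong_iff_dvd_diff dvd_def algebra_simps)
  have "m - (r + int p * (s mod int p)) = int p * (s - s mod int p)" by (simp add: s algebra_simps)
  also have "s - s mod int p = int p * (s div int p)" by (simp add: minus_mod_eq_mult_div)
  finally have "[m = r + int p * (s mod int p)] (mod int p ^ 2)"
    by (simp add: cong_iff_dvd_diff power2_eq_square)
  then show ?thesis using p_gt_1 by (intro bexI[of _ "s mod int p"]) simp_all
qed

lemma data4_normal:
  assumes "data4 p H m"
  shows "\<exists>m'\<in>normal4. data4 p H m'"
proof -
  obtain h y where hy: "gen {h, y} = H" "rel4 p h y m" using assms by (auto simp: data4_def)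
  show ?thesis
  proof (cases "int p dvd m")
    case True
    then obtain t where t: "t \<in> {0..<int p}" "[m = 0 + int p * t] (mod int p ^ 2)"
      using cong_p2[of m 0] by (auto simp: cong_0_iff)
    have "data4 p H (0 + int p * t)" unfolding data4_def using rel4_cong[OF hy(2) t(2)] hy(1) by blast
    moreover have "0 + int p * t \<in> normal4" using t(1) by (simp add: normal4_def)
    ultimately show ?thesis by blast
  next
    case False
    obtain n where n: "[int n * m = 1] (mod int p)" "coprime (int n) (int p)"
      using unit_solve_unit[OF prime False, of 1] p_gt_1 by auto
    obtain m' where m': "rel4 p h (y ^ n) m'" "[m' = int n * m] (mod int p)"
      using rel4_power[OF hy(2)] by blast
    obtain t where t: "t \<in> {0..<int p}" "[m' = 1 + int p * t] (mod int p ^ 2)"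
      using cong_p2[OF cong_trans[OF m'(2) n(1)]] by blast
    have "data4 p H (1 + int p * t)"
      unfolding data4_def using rel4_cong[OF m'(1) t(2)] gen_scale(2)[OF hy(1) n(2)] by blast
    moreover have "1 + int p * t \<in> normal4" using t(1) by (simp add: normal4_def)
    ultimately show ?thesis by blast
  qed
qed

lemma zp_in_powers: "g \<in> gen {u} \<Longrightarrow> \<exists>i. g = zp u i"
  using gen_commuting_pair[of u u g] by (auto simp flip: zp_add)

text \<open>Order estimates force \<open>card (pw p H) = p ^ 4\<close>, so \<open>H / pw p H\<close>
  is abelian and \<open>cm x y\<close> is a \<open>p\<close>-th power \<open>v ^ p\<close>. The aim
  is an \<open>h\<close> outside \<open>pw p H\<close> for which \<open>h ^ p\<close> generates a
  normal subgroup containing \<open>cm x y\<close>; then a second generator sends \<open>h\<close>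
  to one of its powers.\<close>

lemma case4_structure:
  assumes k6: "k = 6" and g: "gen {x, y} = H"
    and e3: "\<And>g. g \<in> H \<Longrightarrow> g ^ (p ^ 3) = 1" and c: "p\<^sup>2 \<le> card (pw (p\<^sup>2) H)"
  shows "\<exists>m. data4 p H m"
proof -
  define P where "P = pw p H"
  define B where "B = om p H"
  have p: "p > 1" by (rule p_gt_1)
  have xy: "x \<in> H" "y \<in> H" using g gen_base[of _ "{x, y}"] by auto
  have nP: "nrm P H" and nB: "nrm B H" using nrm_pw[of 1] nrm_om[of 1] by (simp_all add: P_def B_def)
  have p3: "(u ^ p\<^sup>2) ^ p = u ^ (p ^ 3)" "(u ^ p) ^ p\<^sup>2 = u ^ (p ^ 3)" "(u ^ p) ^ p = u ^ p\<^sup>2" for u :: 'a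
    by (simp_all add: power2_eq_square power3_eq_cube mult.assoc flip: power_mult)
  have e3': "\<And>g. g \<in> H \<Longrightarrow> g ^ p ^ Suc 2 = 1" using e3 by (simp add: numeral_3_eq_3)
  have "(p\<^sup>2) ^ 2 \<le> card P"
    using pw_card_ge[OF e3' c, of 2] by (simp add: P_def)
  moreover have "p\<^sup>2 \<le> card B"
  proof -
    have "pw (p\<^sup>2) H \<subseteq> B" using e3 closed by (auto simp: B_def om_def pw_def p3)
    moreover have "finite B" using finite by (simp add: B_def om_def)
    ultimately show ?thesis using c card_mono by (meson le_trans)
  qed
  moreover have "card B * card P = p ^ 6" using card_om_pw[of 1] card k6 by (simp add: B_def P_def)
  ultimately have cP: "card P = p ^ 4"
  proof -
    assume a: "(p\<^sup>2)\<^sup>2 \<le> card P" "p\<^sup>2 \<le> card B" "card B * card P = p ^ 6"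
    have "p\<^sup>2 * card P \<le> p\<^sup>2 * p ^ 4"
      using mult_le_mono1[OF a(2), of "card P"] a(3) by (simp flip: power_add)
    then have "card P \<le> p ^ 4" by (rule mult_left_le_imp_le) (use p in simp)
    then show ?thesis using a(1) by (simp flip: power_mult)
  qed
  have cmP: "cm g h \<in> P" if "g \<in> H" "h \<in> H" for g h
    by (rule cm_in_index_p2[OF pgrp nP _ that]) (use cP card k6 in \<open>simp flip: power_add\<close>)
  have PB: "u ^ p\<^sup>2 = 1" if "u \<in> P" for u using that e3 by (auto simp: P_def pw_def p3)
  have central: "u ^ p\<^sup>2 * h = h * u ^ p\<^sup>2" if "u \<in> H" "h \<in> H" for u h
    using power_commute_iff[OF that, of 2] PB[OF cmP[OF that]] by simp
  have PcB: "cm a b \<in> B" if ab: "a \<in> P" "b \<in> H" for a b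
  proof -
    obtain v where v: "v \<in> H" "a = v ^ p" using ab(1) by (auto simp: P_def pw_def)
    have "a ^ p * b = b * a ^ p" using central[OF v(1) ab(2)] by (simp add: v p3)
    then show ?thesis using power_commute_iff[of a b 1] v closed ab by (simp add: B_def om_def)
  qed
  \<comment> \<open>\<open>H / P\<close> has order \<open>p ^ 2\<close> and \<open>P\<close>
    consists of \<open>p\<close>-th powers, so every element outside \<open>P\<close> extends to a
    generating pair, with \<open>x\<close> or \<open>y\<close> as its partner.\<close>
  have gen_h: "\<exists>u\<in>{x, y}. gen {h, u} = H" if h: "h \<in> H" "h \<notin> P" for h
  proof -
    let ?L = "gen (insert h P)"
    have LH: "?L \<subseteq> H" using h nrm_subset[OF nP] sgp by (intro gen_subset) auto
    have "card ?L \<le> p * card P"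
      by (rule card_gen_insert_le[OF nrm_sgp[OF nP] nrm_cj[OF nP h(1)]])
         (use h p finite in \<open>auto simp: P_def pw_def\<close>)
    also have "\<dots> < card H" using cP card k6 power_strict_increasing[of 5 6 p] p by (simp flip: power_Suc)
    finally have "card ?L \<noteq> card H" by simp
    then obtain u where u: "u \<in> {x, y}" "u \<notin> ?L"
    proof (cases "{x, y} \<subseteq> ?L")
      case True
      then have "H \<subseteq> ?L" using gen_subset[OF True sgp_gen] g by simp
      then show ?thesis using LH \<open>card ?L \<noteq> card H\<close> by (simp add: subset_antisym)
    qed (use that in auto)
    have uH: "u \<in> H" using u xy by auto
    let ?M = "gen ({h, u} \<union> P)"
    have MH: "?M \<subseteq> H" using h uH nrm_subset[OF nP] sgp by (intro gen_subset) auto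
    obtain m where m: "pgrp p m ?M" using pgrp_subgroup[OF pgrp sgp_gen MH] .
    obtain l where l: "pgrp p l ?L" using pgrp_subgroup[OF pgrp sgp_gen LH] .
    have pP: "pgrp p 4 P" using prime nrm_sgp[OF nP] cP by (simp add: pgrp_def)
    have PL: "P \<subseteq> ?L" "h \<in> ?L" by (auto intro: gen_base)
    have LM: "?L \<subseteq> ?M" "u \<in> ?M" by (auto intro!: gen_mono gen_base)
    have "4 < l" using pgrp_subset_eq[OF l pP PL(1)] PL h by force
    moreover have "l < m" using pgrp_subset_eq[OF m l LM(1)] LM u by force
    ultimately have "?M = H" using pgrp_subset_eq[OF pgrp m MH] k6 by simp
    then have "gen {h, u} = H"
      by (intro frattini_generate[OF pgrp, of "{h, u}" P]) (use h uH in \<open>auto simp: P_def pw_def\<close>)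
    then show ?thesis using u by blast
  qed
  have finish: "\<exists>m. data4 p H m" if h: "h \<in> H" "h \<notin> P" and c: "cm x y \<in> gen {h ^ p}" and N: "nrm (gen {h ^ p}) H" for h
  proof -
    obtain u where u: "u \<in> {x, y}" "gen {h, u} = H" using gen_h[OF h] by blast
    have uH: "u \<in> H" using u xy by auto
    have "cm h u \<in> gen {h ^ p}"
      by (rule cm_closed_gen[OF sgp g[symmetric] N _ h(1) uH])
         (use c cm_flip_in[OF N c] gen_one in auto)
    then obtain i where "cm h u = zp (h ^ p) i" using zp_in_powers by blast
    then have "cj u h = h * zp (zp h (int p)) i" by (simp add: cj_eq_cm)
    then have "cj u h = zp h (1 + int p * i)" by (simp only: zp_zp zp_add zp_1)
    then have "rel4 p h u i" using e3 h uH by (simp add: rel4_def)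
    then show ?thesis using u(2) by (auto simp: data4_def)
  qed
  obtain v where v: "v \<in> H" "cm x y = v ^ p" using cmP[OF xy] by (auto simp: P_def pw_def)
  consider "cm x y = 1" | "cm x y \<noteq> 1" "v \<in> P" | "v \<notin> P" by blast
  then show ?thesis
  proof cases
    case 1
    then have "cj y x = x" by (simp add: cj_eq_cm)
    then have "rel4 p x y 0" using e3 xy by (simp add: rel4_def)
    then show ?thesis using g by (auto simp: data4_def)
  next
    case 2
    then obtain h where h: "h \<in> H" "v = h ^ p" by (auto simp: P_def pw_def)
    \<comment> \<open>\<open>cm x y\<close> is now the central element \<open>h ^ p\<^sup>2\<close>.
      The subgroup generated by it contains the derived subgroup, so every larger subgroup is
      normal.\<close>
    have c2: "cm x y = h ^ p\<^sup>2" using v h by (simp add: p3)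
    have hP: "h \<notin> P" using PB 2(1) c2 by auto
    have hp: "h ^ p\<^sup>2 \<in> gen {h ^ p}" using sgp_power[OF sgp_gen gen_base, of "h ^ p" "{h ^ p}" p] by (simp add: p3)
    have N2: "nrm (gen {h ^ p\<^sup>2}) H"
      unfolding nrm_def
    proof (intro conjI ballI)
      show "gen {h ^ p\<^sup>2} \<subseteq> H" using h sgp closed by (intro gen_subset) auto
      show "cj b n \<in> gen {h ^ p\<^sup>2}" if b: "b \<in> H" and n: "n \<in> gen {h ^ p\<^sup>2}" for b n
      proof (rule gen_cj_closed[OF _ n])
        have "cj b (h ^ p\<^sup>2) = h ^ p\<^sup>2" using central[OF h(1) b] by (simp add: cj_eq_iff_commute)
        then show "cj b a \<in> gen {h ^ p\<^sup>2}" if "a \<in> {h ^ p\<^sup>2}" for a using that by (auto intro: gen_base)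
      qed
    qed simp
    have cN2: "cm x y \<in> gen {h ^ p\<^sup>2}" unfolding c2 by (auto intro: gen_base)
    have sub: "gen {h ^ p\<^sup>2} \<subseteq> gen {h ^ p}" using hp by (intro gen_subset) auto
    have all: "cm a b \<in> gen {h ^ p\<^sup>2}" if "a \<in> H" "b \<in> H" for a b
      by (rule cm_closed_gen[OF sgp g[symmetric] N2 _ that])
         (use cN2 cm_flip_in[OF N2 cN2] gen_one in auto)
    have "nrm (gen {h ^ p}) H"
    proof (rule nrm_of_gam_2[OF sgp sgp_gen])
      show "gen {h ^ p} \<subseteq> H" using h sgp closed by (intro gen_subset) auto
      show "gam H 2 \<subseteq> gen {h ^ p}" using gam_2_subset[OF sgp N2 all] sub by blast
    qed
    then show ?thesis using finish[OF h(1) hP] cN2 sub by blast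
  next
    case 3
    obtain u where u: "u \<in> {x, y}" "gen {v, u} = H" using gen_h[OF v(1) 3] by blast
    have uH: "u \<in> H" using u xy by auto
    have cB: "cm (cm x y) x \<in> B" "cm (cm x y) y \<in> B" using PcB cmP xy by simp_all
    have vpp: "cm x y ^ p \<in> B" using v e3 closed by (simp add: B_def om_def p3)
    \<comment> \<open>Modulo \<open>B\<close> the commutator \<open>cm x y\<close> is central and
      generates the derived subgroup. So \<open>cm v u ^ p\<close> is a power of
      \<open>cm x y ^ p = (v ^ p) ^ p\<close>, and conjugation by \<open>u\<close> sends
      \<open>v ^ p\<close> to one of its own powers.\<close>
    have cvu: "\<exists>i. \<exists>s\<in>B. cm v u = cm x y ^ i * s"
    proof -
      have eq: "gen (insert (cm x y) B) = (\<lambda>(i, s). cm x y ^ i * s) ` ({..<p} \<times> B)"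
        by (rule gen_insert_normal[OF nrm_sgp[OF nB] nrm_cj[OF nB] vpp]) (use closed xy p in simp_all)
      have "cm v u \<in> gen (insert (cm x y) B)"
        using gam_3_subset(2)[OF nB g cB] cm_in_gam_2[OF v(1) uH] by blast
      then show ?thesis unfolding eq by auto
    qed
    then obtain i s where s: "s \<in> B" "cm v u = cm x y ^ i * s" by blast
    have "cm v u ^ p = (cm x y ^ i) ^ p"
      using mult_order'[of "cm x y ^ i" s 1] s closed xy by (simp add: B_def om_def)
    also have "\<dots> = (v ^ p) ^ (p * i)" by (simp add: v mult.commute flip: power_mult)
    finally have cp: "cm v u ^ p = (v ^ p) ^ (p * i)" .
    have "cm v (cm v u) \<in> B" using PcB[OF cmP[OF v(1) uH] v(1)] cm_flip_in[OF nB] by blast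
    then have "(v * cm v u) ^ p = v ^ p * cm v u ^ p"
      using v uH closed by (intro mult_power_cm) (simp_all add: B_def om_def)
    then have cjuv: "cj u (v ^ p) = v ^ p * (v ^ p) ^ (p * i)"
      by (simp only: cj_power cj_eq_cm[of u v] cp)
    have "nrm (gen {v ^ p}) H"
    proof -
      let ?N = "gen {v ^ p}"
      have vN: "v ^ p \<in> ?N" by (auto intro: gen_base)
      have "cj v (v ^ p) = v ^ p" by (simp only: cj_eq_iff_commute power_commutes)
      then have 1: "cj v (v ^ p) \<in> ?N" using vN by argo
      have 2: "cj u (v ^ p) \<in> ?N" unfolding cjuv by (rule gen_mult[OF vN sgp_power[OF sgp_gen vN]])
      have NH: "?N \<subseteq> H" using v closed sgp by (intro gen_subset) auto
      have fN: "finite ?N" by (rule finite_subset[OF NH finite])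
      have cl: "cj b n \<in> ?N" if "cj b (v ^ p) \<in> ?N" "n \<in> ?N" for b n
        by (rule gen_cj_closed[OF _ that(2)]) (use that(1) in blast)
      have "b \<in> H \<and> (\<forall>n\<in>?N. cj b n \<in> ?N)" if "b \<in> gen {v, u}" for b
        using that
      proof induction
        case (gen_inverse b)
        then have "cj b ` ?N \<subseteq> ?N" by auto
        then have "cj b ` ?N = ?N" using fN by (intro card_subset_eq) (auto simp: card_image inj_on_def)
        have "cj (inverse b) n \<in> ?N" if n: "n \<in> ?N" for n
        proof -
          obtain n' where "n' \<in> ?N" "n = cj b n'" using n \<open>cj b ` ?N = ?N\<close> by blast
          then show ?thesis by (simp add: cj_cj)
        qed
        then show ?case using gen_inverse closed by blast
      next
        case (gen_mult a b)
        then show ?case using closed by (auto simp flip: cj_cj)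
      qed (use v uH cl 1 2 closed in auto)
      then show ?thesis using u(2) NH by (auto simp: nrm_def)
    qed
    then show ?thesis using finish[OF v(1) 3] v(2) by (auto intro: gen_base)
  qed
qed

end

subsection \<open>Twisting groups of exponent $p$\<close>

lemma (in group) power_in_beauville_Sigma:
  assumes "finite (carrier G)" and u: "u \<in> {x, y}" and xy: "x \<in> carrier G" "y \<in> carrier G"
  shows "u [^] (n::nat) \<in> beauville_Sigma G x y"
proof -
  have ord: "order G > 0" using assms(1) by (simp add: order_gt_0_iff_finite)
  define i where "i = n + order G - (order G * (n div order G))"
  \<comment> \<open>Exponents in \<open>beauville_Sigma\<close> start at 1, so the remainder 0 is
    replaced by \<open>order G\<close>.\<close>
  define j where "j = (if n mod order G = 0 then order G else n mod order G)"
  have j: "j \<in> {1..order G}" using ord by (auto simp: j_def Suc_le_eq intro: less_imp_le)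
  have u': "u \<in> carrier G" using u xy by blast
  have "u [^] n = u [^] (order G * (n div order G) + n mod order G)" by simp
  also have "\<dots> = (u [^] order G) [^] (n div order G) \<otimes> u [^] (n mod order G)"
    using u' by (simp only: nat_pow_mult[symmetric] nat_pow_pow)
  also have "\<dots> = u [^] j"
    using u' pow_order_eq_1[OF u'] by (simp add: j_def)
  also have "\<dots> = conjugate G (u [^] j) \<one>" using u' by (simp add: conjugate_def)
  finally show ?thesis
    unfolding beauville_Sigma_def using j u by (auto intro!: bexI[of _ j] bexI[of _ \<one>])
qed

text \<open>Such a \<open>t\<close> lies in the set \<open>beauville_Sigma\<close> of every
  generating pair.\<close>

lemma (in group) not_beauville_groupI:
  assumes t: "t \<noteq> \<one>"
    and gp: "\<And>x y. generating_pair G x y \<Longrightarrow> \<exists>u\<in>{x, y}. \<exists>n::nat. u [^] n = t"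
  shows "\<not> beauville_group G"
proof
  assume "beauville_group G"
  then obtain x y x' y' where fin: "finite (carrier G)"
    and g: "generating_pair G x y" "generating_pair G x' y'"
    and S: "beauville_Sigma G x y \<inter> beauville_Sigma G x' y' = {\<one>}"
    by (auto simp: beauville_group_def beauville_structure_def)
  have "t \<in> beauville_Sigma G x y" if "generating_pair G x y" for x y
    using gp[OF that] power_in_beauville_Sigma[OF fin] that by (auto simp: generating_pair_def)
  then show False using g S t by blast
qed

text \<open>\<open>\<chi>\<close> takes its values in the representatives below \<open>p\<close>, so
  that the carry \<open>(\<chi> g + \<chi> h) div p\<close>, which is 0 or 1, makes sense.\<close>

locale twist =
  fixes p :: nat and H :: "'a::grp set" and \<chi> :: "'a \<Rightarrow> nat" and t :: 'a
  assumes p: "prime p" and sgp: "sgp H" and finite: "finite H"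
    and t: "t \<in> H" "t \<noteq> 1"
    and central: "h \<in> H \<Longrightarrow> t * h = h * t"
    and exponent: "h \<in> H \<Longrightarrow> h ^ p = 1"
    and \<chi>_less: "h \<in> H \<Longrightarrow> \<chi> h < p"
    and \<chi>_mult: "g \<in> H \<Longrightarrow> h \<in> H \<Longrightarrow> \<chi> (g * h) = (\<chi> g + \<chi> h) mod p"
    and \<chi>_t: "\<chi> t = 0"
    and \<chi>_onto: "\<exists>h\<in>H. \<chi> h = 1"
begin

text \<open>Adding the carry cocycle pulled back along \<open>\<chi>\<close> makes \<open>t ^ \<chi> h\<close> the \<open>p\<close>-th power of \<open>h\<close>.\<close>

definition K :: "'a monoid" where
  "K = \<lparr>carrier = H, monoid.mult = (\<lambda>g h. g * h * t ^ ((\<chi> g + \<chi> h) div p)), one = 1\<rparr>"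

lemma K_simps [simp]: "carrier K = H" "\<one>\<^bsub>K\<^esub> = 1" "g \<otimes>\<^bsub>K\<^esub> h = g * h * t ^ ((\<chi> g + \<chi> h) div p)"
  by (simp_all add: K_def)

lemmas closed = sgp_closed[OF sgp]

lemma p_gt_0: "p > 0" and p_gt_1: "p > 1"
  using prime_gt_0_nat[OF p] prime_gt_1_nat[OF p] by auto

lemma central_power: "h \<in> H \<Longrightarrow> t ^ n * h = h * t ^ n"
proof (induction n)
  case (Suc n)
  have "t ^ Suc n * h = t * (t ^ n * h)" by (simp add: mult.assoc)
  also have "\<dots> = t * h * t ^ n" using Suc by (simp add: mult.assoc)
  also have "\<dots> = h * t ^ Suc n" using central[OF Suc.prems] by (simp add: mult.assoc)
  finally show ?case .
qed simp

lemma \<chi>_one: "\<chi> 1 = 0"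
  using \<chi>_mult[of 1 1] \<chi>_less[of 1] closed(1) by (auto simp: mod_if split: if_splits)

lemma \<chi>_t_power: "\<chi> (t ^ n) = 0"
  by (induction n) (simp_all add: \<chi>_one \<chi>_mult \<chi>_t t closed)

lemma \<chi>_mult_t: "g \<in> H \<Longrightarrow> \<chi> (g * t ^ n) = \<chi> g"
  using \<chi>_less by (simp add: \<chi>_mult \<chi>_t_power t closed)

lemma \<chi>_inverse: "h \<in> H \<Longrightarrow> \<chi> h = 0 \<Longrightarrow> \<chi> (inverse h) = 0"
  using \<chi>_mult[of h "inverse h"] closed \<chi>_less[of "inverse h"] by (simp add: \<chi>_one)

text \<open>The cocycle identity: the two carries together count the multiples of \<open>p\<close>
  in \<open>a + b + c\<close>, whatever the bracketing.\<close>

lemma carry_assoc: "(a + b) div p + ((a + b) mod p + c) div p = (a + b + c) div p"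
proof -
  have "a + b + c = p * ((a + b) div p) + ((a + b) mod p + c)" by (simp flip: add.assoc)
  then show ?thesis using p_gt_0 by (simp only: div_mult_self4)
qed

lemma group_K: "group K"
proof (rule groupI)
  fix x y z assume xyz: "x \<in> carrier K" "y \<in> carrier K" "z \<in> carrier K"
  then have H: "x \<in> H" "y \<in> H" "z \<in> H" by simp_all
  define m where "m = (\<chi> x + \<chi> y) div p"
  define n where "n = (\<chi> y + \<chi> z) div p"
  define m' where "m' = ((\<chi> x + \<chi> y) mod p + \<chi> z) div p"
  define n' where "n' = (\<chi> x + (\<chi> y + \<chi> z) mod p) div p"
  have mn: "m + m' = n + n'"
    using carry_assoc[of "\<chi> x" "\<chi> y" "\<chi> z"] carry_assoc[of "\<chi> y" "\<chi> z" "\<chi> x"]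
    by (simp add: m_def n_def m'_def n'_def ac_simps)
  have "(x \<otimes>\<^bsub>K\<^esub> y) \<otimes>\<^bsub>K\<^esub> z = x * y * t ^ m * z * t ^ m'"
    using H by (simp add: \<chi>_mult_t \<chi>_mult closed m_def m'_def)
  also have "\<dots> = x * y * (t ^ m * z) * t ^ m'" by (simp only: mult.assoc)
  also have "\<dots> = x * y * z * t ^ (m + m')"
    by (simp only: central_power[OF H(3)] mult.assoc power_add)
  also have "\<dots> = x * (y * z * t ^ n) * t ^ n'"
    by (simp only: mn mult.assoc power_add)
  also have "\<dots> = x \<otimes>\<^bsub>K\<^esub> (y \<otimes>\<^bsub>K\<^esub> z)"
    using H by (simp add: \<chi>_mult_t \<chi>_mult closed n_def n'_def)
  finally show "(x \<otimes>\<^bsub>K\<^esub> y) \<otimes>\<^bsub>K\<^esub> z = x \<otimes>\<^bsub>K\<^esub> (y \<otimes>\<^bsub>K\<^esub> z)" .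
next
  fix x assume "x \<in> carrier K"
  then have x: "x \<in> H" by simp
  define n where "n = (\<chi> (inverse x) + \<chi> x) div p"
  \<comment> \<open>\<open>t ^ (n * (p - 1))\<close> is the inverse of \<open>t ^ n\<close>, written
    with a natural exponent.\<close>
  let ?y = "inverse x * t ^ (n * (p - 1))"
  have y: "?y \<in> H" using x t closed by simp
  have "?y \<otimes>\<^bsub>K\<^esub> x = inverse x * (t ^ (n * (p - 1)) * x) * t ^ n"
    using x by (simp add: \<chi>_mult_t closed n_def mult.assoc)
  also have "\<dots> = inverse x * x * t ^ (n * (p - 1) + n)"
    by (simp only: central_power[OF x] mult.assoc power_add)
  also have "n * (p - 1) + n = p * n" using p_gt_0 by (cases p) simp_all
  finally have "?y \<otimes>\<^bsub>K\<^esub> x = 1" using exponent[OF t(1)] by (simp add: power_mult)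
  then show "\<exists>y\<in>carrier K. y \<otimes>\<^bsub>K\<^esub> x = \<one>\<^bsub>K\<^esub>" using y by auto
qed (auto simp: \<chi>_one \<chi>_less t closed)

interpretation K: group K by (rule group_K)

lemma K_pow: "h \<in> H \<Longrightarrow> h [^]\<^bsub>K\<^esub> (n::nat) = h ^ n * t ^ (n * \<chi> h div p) \<and> \<chi> (h [^]\<^bsub>K\<^esub> n) = n * \<chi> h mod p"
proof (induction n)
  case 0
  then show ?case using K.nat_pow_0[of h] by (simp add: \<chi>_one)
next
  case (Suc n)
  from Suc.IH[OF Suc.prems] have IH: "h [^]\<^bsub>K\<^esub> n = h ^ n * t ^ (n * \<chi> h div p)" "\<chi> (h [^]\<^bsub>K\<^esub> n) = n * \<chi> h mod p" by blast+
  have "h [^]\<^bsub>K\<^esub> Suc n = h [^]\<^bsub>K\<^esub> n * h * t ^ ((n * \<chi> h mod p + \<chi> h) div p)"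
    unfolding K.nat_pow_Suc K_simps IH(2) ..
  also have "\<dots> = h ^ n * (t ^ (n * \<chi> h div p) * h) * t ^ ((n * \<chi> h mod p + \<chi> h) div p)"
    by (simp only: IH(1) mult.assoc)
  also have "\<dots> = h ^ Suc n * t ^ (n * \<chi> h div p + (n * \<chi> h mod p + \<chi> h) div p)"
    by (simp only: central_power[OF Suc.prems] mult.assoc power_add power_Suc2)
  also have "n * \<chi> h div p + (n * \<chi> h mod p + \<chi> h) div p = Suc n * \<chi> h div p"
    using carry_assoc[of "n * \<chi> h" 0 "\<chi> h"] by (simp add: add.commute)
  finally have 1: "h [^]\<^bsub>K\<^esub> Suc n = h ^ Suc n * t ^ (Suc n * \<chi> h div p)" .
  have "\<chi> (h ^ m) = m * \<chi> h mod p" for m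
    by (induction m) (use Suc.prems in \<open>simp_all add: \<chi>_one \<chi>_mult closed mod_simps\<close>)
  moreover have "\<chi> (h ^ Suc n * t ^ (Suc n * \<chi> h div p)) = \<chi> (h ^ Suc n)"
    using closed(4)[OF Suc.prems] by (rule \<chi>_mult_t)
  ultimately show ?case unfolding 1 by (metis)
qed

lemma K_pow_p: "h \<in> H \<Longrightarrow> h [^]\<^bsub>K\<^esub> p = t ^ \<chi> h"
  using p_gt_0 by (simp add: K_pow exponent)

lemma K_pow_0: "h \<in> H \<Longrightarrow> \<chi> h = 0 \<Longrightarrow> h [^]\<^bsub>K\<^esub> (n::nat) = h ^ n"
  by (simp add: K_pow)

lemma t_power_eq_iff: "t ^ m = t ^ n \<longleftrightarrow> [m = n] (mod p)"
proof -
  have "ord_t": "m mod p = 0" if "t ^ m = 1" for m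
  proof (rule ccontr)
    assume "m mod p \<noteq> 0"
    then have "coprime m p" using p by (metis coprime_commute dvd_eq_mod_eq_0 prime_imp_coprime)
    then have "t \<in> gen {zp t (int m)}" using exponent[OF t(1)] by (intro coprime_power_generates) auto
    also have "zp t (int m) = 1" using that by simp
    finally show False using t gen_subset[of "{1}" "{1}"] by auto
  qed
  have *: "t ^ m = t ^ n \<longleftrightarrow> [m = n] (mod p)" if "m \<le> n" for m n
  proof -
    have "t ^ m = t ^ n \<longleftrightarrow> t ^ (n - m) = 1" using that by (metis grp_eq_1_right' le_add_diff_inverse power_add)
    also have "\<dots> \<longleftrightarrow> p dvd n - m"
      using ord_t[of "n - m"] exponent[OF t(1)] by (auto elim!: dvdE simp: power_mult)
    also have "\<dots> \<longleftrightarrow> [m = n] (mod p)" using that by (metis cong_altdef_nat cong_sym_eq)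
    finally show ?thesis .
  qed
  show ?thesis using *[of m n] *[of n m] by (cases "m \<le> n") (auto simp: cong_sym_eq)
qed

lemma generates_t:
  assumes "h \<in> H" "\<chi> h \<noteq> 0"
  shows "\<exists>n::nat. h [^]\<^bsub>K\<^esub> n = t"
proof -
  have "\<not> p dvd \<chi> h" using \<chi>_less[OF assms(1)] assms(2) by (auto dest: dvd_imp_le)
  then have "coprime (\<chi> h) p" using p by (simp add: coprime_commute prime_imp_coprime)
  then obtain n where n: "[\<chi> h * n = 1] (mod p)" using cong_solve_coprime_nat by auto
  have "h [^]\<^bsub>K\<^esub> (p * n) = (h [^]\<^bsub>K\<^esub> p) [^]\<^bsub>K\<^esub> n"
    using assms(1) by (simp add: K.nat_pow_pow)
  also have "\<dots> = t ^ (\<chi> h * n)"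
    using assms(1) t by (simp add: K_pow_p K_pow_0 closed \<chi>_t_power power_mult)
  also have "\<dots> = t ^ 1" using n by (simp only: t_power_eq_iff)
  finally show ?thesis by auto
qed

text \<open>A generator with \<open>\<chi>\<close> nonzero has \<open>t\<close> as a power in
  \<open>K\<close>, so the subgroup of \<open>K\<close> generated by the same pair contains
  \<open>t\<close>. It is then closed under the original product, which differs only by powers of
  \<open>t\<close>.\<close>

lemma two_generated_K:
  assumes "gen {x, y} = H"
  shows "two_generated K"
proof -
  have xy: "x \<in> H" "y \<in> H" using assms by (auto intro: gen_base)
  let ?S = "generate K {x, y}"
  have S: "subgroup ?S K" using xy by (intro K.generate_is_subgroup) simp
  have SH: "?S \<subseteq> H" using subgroup.subset[OF S] by simp
  have Spow: "h [^]\<^bsub>K\<^esub> (n::nat) \<in> ?S" if "h \<in> ?S" for h n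
    by (induction n) (use that subgroup.m_closed[OF S] subgroup.one_closed[OF S] K.nat_pow_Suc K.nat_pow_0 in \<open>simp_all del: K_simps\<close>)
  have "\<exists>u\<in>{x, y}. \<chi> u \<noteq> 0"
  proof (rule ccontr)
    assume "\<not> ?thesis"
    then have *: "\<chi> x = 0" "\<chi> y = 0" by simp_all
    have "sgp {h \<in> H. \<chi> h = 0}" by (rule sgpI) (auto simp: closed \<chi>_one \<chi>_mult \<chi>_inverse)
    then have "gen {x, y} \<subseteq> {h \<in> H. \<chi> h = 0}" using xy * by (intro gen_subset) auto
    then show False using assms \<chi>_onto by auto
  qed
  then obtain u where u: "u \<in> {x, y}" "\<chi> u \<noteq> 0" by blast
  then have "u \<in> H" "u \<in> ?S" using xy by (auto intro: generate.incl)
  then have tS: "t \<in> ?S" using generates_t[OF _ u(2)] Spow by metis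
  have tnS: "t ^ n \<in> ?S" for n using Spow[OF tS, of n] t \<chi>_t by (simp add: K_pow_0)
  have st: "g * t ^ n \<in> ?S" if "g \<in> ?S" for g n
  proof -
    have "g \<otimes>\<^bsub>K\<^esub> t ^ n \<in> ?S" using subgroup.m_closed[OF S that tnS] .
    moreover have "g \<otimes>\<^bsub>K\<^esub> t ^ n = g * t ^ n"
      using that SH \<chi>_less by (auto simp: \<chi>_t_power)
    ultimately show ?thesis by simp
  qed
  have mS: "g * h \<in> ?S" if "g \<in> ?S" "h \<in> ?S" for g h
  proof -
    define n where "n = (\<chi> g + \<chi> h) div p"
    have "g \<otimes>\<^bsub>K\<^esub> h \<in> ?S" using subgroup.m_closed[OF S that] .
    then have "g * h * t ^ n \<in> ?S" by (simp add: n_def)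
    then have "g * h * t ^ n * t ^ (n * (p - 1)) \<in> ?S" by (rule st)
    moreover have "t ^ n * t ^ (n * (p - 1)) = 1"
    proof -
      have "n + n * (p - 1) = p * n" using p_gt_0 by (cases p) simp_all
      then have "t ^ n * t ^ (n * (p - 1)) = (t ^ p) ^ n" by (metis power_add power_mult)
      then show ?thesis using exponent[OF t(1)] by simp
    qed
    ultimately show ?thesis by (simp add: mult.assoc)
  qed
  have S1: "1 \<in> ?S" using subgroup.one_closed[OF S] by simp
  have "h ^ n \<in> ?S" if "h \<in> ?S" for h n by (induction n) (use that S1 mS in auto)
  moreover have "inverse h = h ^ (p - 1)" if "h \<in> H" for h
    using exponent[OF that] p_gt_0 by (intro grp_inverse_unique) (simp flip: power_Suc)
  ultimately have "sgp ?S" using S1 mS SH by (intro sgpI) auto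
  then have "gen {x, y} \<subseteq> ?S" by (intro gen_subset) (auto intro: generate.incl)
  then show ?thesis using assms SH xy by (auto simp: two_generated_def generating_pair_def)
qed

text \<open>The elements with \<open>\<chi>\<close> zero still form a proper subgroup of
  \<open>K\<close>. Hence each generating pair has a member outside it, and \<open>t\<close> is a
  power of that member.\<close>

lemma not_beauville_K: "\<not> beauville_group K"
proof (rule K.not_beauville_groupI)
  show "t \<noteq> \<one>\<^bsub>K\<^esub>" using t by simp
  fix x y assume g: "generating_pair K x y"
  then have xy: "x \<in> H" "y \<in> H" by (simp_all add: generating_pair_def)
  have "\<exists>u\<in>{x, y}. \<chi> u \<noteq> 0"
  proof (rule ccontr)
    assume "\<not> ?thesis"
    then have *: "\<chi> x = 0" "\<chi> y = 0" by simp_all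
    have "subgroup {h \<in> H. \<chi> h = 0} K"
    proof (rule K.subgroupI)
      show "inv\<^bsub>K\<^esub> h \<in> {h \<in> H. \<chi> h = 0}" if "h \<in> {h \<in> H. \<chi> h = 0}" for h
      proof -
        have h: "h \<in> H" "\<chi> h = 0" using that by simp_all
        then have 0: "\<chi> (inverse h) = 0" by (rule \<chi>_inverse)
        then have "inv\<^bsub>K\<^esub> h = inverse h" using h closed by (intro K.inv_equality) simp_all
        then show ?thesis using 0 h closed by simp
      qed
    qed (auto simp: closed \<chi>_one \<chi>_mult \<chi>_mult_t intro!: exI[of _ 1])
    then have "generate K {x, y} \<subseteq> {h \<in> H. \<chi> h = 0}"
      using xy * by (intro K.generate_subgroup_incl) auto
    then show False using g \<chi>_onto by (auto simp: generating_pair_def)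
  qed
  then show "\<exists>u\<in>{x, y}. \<exists>n::nat. u [^]\<^bsub>K\<^esub> n = t" using generates_t xy by blast
qed

end

text \<open>The \<open>p\<close>-th power map of the twisted group is
  \<open>h \<mapsto> t ^ \<chi> h\<close>. So an isomorphism \<open>f\<close> takes \<open>t\<close>
  to \<open>t' ^ k\<close>, and \<open>\<chi>' (f g) = k * \<chi> g\<close> modulo \<open>p\<close>,
  for one unit \<open>k\<close>. Correcting \<open>f g\<close> by \<open>k * \<chi> g div p\<close>
  inverse factors \<open>t'\<close> removes the carries and gives an isomorphism of the original
  groups.\<close>

lemma twist_untwist:
  assumes "twist p H \<chi> t" "twist p H' \<chi>' t'" and iso: "twist.K p H \<chi> t \<cong> twist.K p H' \<chi>' t'"
  shows "mon H \<cong> mon H'"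
proof -
  interpret A: twist p H \<chi> t by fact
  interpret B: twist p H' \<chi>' t' by fact
  interpret KA: group A.K by (rule A.group_K)
  interpret KB: group B.K by (rule B.group_K)
  obtain f where f: "f \<in> iso A.K B.K" using iso by (auto simp: is_iso_def)
  then have bij: "bij_betw f H H'" and hom: "f \<in> hom A.K B.K" by (simp_all add: iso_def)
  interpret f: group_hom A.K B.K f using hom A.group_K B.group_K by (simp add: group_hom_def group_hom_axioms_def)
  have fH: "f h \<in> H'" if "h \<in> H" for h using bij that by (auto dest: bij_betwE)
  have f_mult: "f (g * h * t ^ ((\<chi> g + \<chi> h) div p)) = f g * f h * t' ^ ((\<chi>' (f g) + \<chi>' (f h)) div p)"
    if "g \<in> H" "h \<in> H" for g h
    using f.hom_mult[of g h] that by simp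
  obtain x where x: "x \<in> H" "\<chi> x = 1" using A.\<chi>_onto by blast
  define k where "k = \<chi>' (f x)"
  have ft: "f t = t' ^ k"
    using f.hom_nat_pow[of x p] x A.K_pow_p[of x] B.K_pow_p[OF fH, of x] by (simp add: k_def)
  have "f t \<noteq> 1" using bij_betw_imp_inj_on[OF bij] A.t A.closed(1) f.hom_one by (metis A.K_simps(2) B.K_simps(2) inj_onD)
  then have k: "\<not> p dvd k" using B.t_power_eq_iff[of k 0] by (auto simp: ft cong_0_iff)
  have ftn: "f (t ^ n) = t' ^ (k * n)" for n
  proof -
    have "f (t ^ n) = f t [^]\<^bsub>B.K\<^esub> n"
      using f.hom_nat_pow[of t n] A.t by (simp add: A.K_pow_0 A.\<chi>_t)
    also have "\<dots> = t' ^ (k * n)"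
      using B.t by (simp add: ft B.K_pow_0 B.closed B.\<chi>_t_power power_mult)
    finally show ?thesis .
  qed
  have \<chi>': "\<chi>' (f g) = k * \<chi> g mod p" if g: "g \<in> H" for g
  proof -
    have "t' ^ \<chi>' (f g) = t' ^ (k * \<chi> g)"
      using f.hom_nat_pow[of g p] g by (simp add: A.K_pow_p B.K_pow_p fH ftn)
    then show ?thesis using B.\<chi>_less[OF fH[OF g]] by (simp add: B.t_power_eq_iff cong_def)
  qed
  \<comment> \<open>Carries of \<open>k \<cdot> \<chi>\<close> and of \<open>\<chi>\<close> differ by a coboundary.\<close>
  define q where "q a = k * a div p" for a
  define \<psi> where "\<psi> g = f g * inverse t' ^ q (\<chi> g)" for g
  have f_mult': "f (g * h) * t' ^ (k * ((\<chi> g + \<chi> h) div p)) = f g * f h * t' ^ ((\<chi>' (f g) + \<chi>' (f h)) div p)"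
    if "g \<in> H" "h \<in> H" for g h
  proof -
    let ?n = "(\<chi> g + \<chi> h) div p"
    have "f (g * h * t ^ ?n) = f (g * h) * t' ^ (k * ?n)"
      using f.hom_mult[of "g * h" "t ^ ?n"] that A.t A.closed A.\<chi>_less[of "g * h"] B.\<chi>_less[OF fH, of "g * h"]
      by (simp add: A.\<chi>_t_power ftn B.\<chi>_t_power)
    then show ?thesis using f_mult[OF that] by simp
  qed
  have carry: "k * ((a + b) div p) + q ((a + b) mod p) = q a + q b + (k * a mod p + k * b mod p) div p" for a b
  proof -
    have "k * (a + b) = q ((a + b) mod p) * p + k * ((a + b) mod p) mod p + (k * ((a + b) div p)) * p"
      by (simp add: q_def) (metis add_mult_distrib2 div_mult_mod_eq mult.assoc add.commute)
    then have "k * (a + b) div p = k * ((a + b) div p) + q ((a + b) mod p)"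
      using A.p_gt_0 by (simp add: q_def) 
    moreover have "k * (a + b) div p = q a + q b + (k * a mod p + k * b mod p) div p"
      unfolding q_def distrib_left by (rule div_add1_eq)
    ultimately show ?thesis by simp
  qed
  have \<psi>_mult: "\<psi> (g * h) = \<psi> g * \<psi> h" if gh: "g \<in> H" "h \<in> H" for g h
  proof -
    let ?a = "\<chi> g" and ?b = "\<chi> h"
    let ?c = "k * ((?a + ?b) div p)" and ?d = "(k * ?a mod p + k * ?b mod p) div p"
    have com: "inverse t' ^ n * u = u * inverse t' ^ n" if "u \<in> H'" for u n
    proof -
      have "t' ^ n * u = u * t' ^ n" using B.central_power[OF that] .
      then show ?thesis unfolding grp_power_inverse by (metis mult.assoc grp_left_inverse2 grp_right_inverse mult_1_right)
    qed
    have "\<psi> (g * h) = f (g * h) * t' ^ ?c * inverse t' ^ (?c + q ((?a + ?b) mod p))"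
      by (simp add: \<psi>_def A.\<chi>_mult gh power_add mult.assoc) (simp add: grp_power_inverse)
    also have "\<dots> = f g * f h * t' ^ ?d * inverse t' ^ (?d + (q ?a + q ?b))"
      using f_mult'[OF gh] gh carry[of ?a ?b] by (simp only: \<chi>') (simp only: ac_simps)
    also have "\<dots> = f g * (f h * inverse t' ^ q ?a) * inverse t' ^ q ?b"
      by (simp add: power_add mult.assoc) (simp add: grp_power_inverse)
    also have "\<dots> = f g * (inverse t' ^ q ?a * f h) * inverse t' ^ q ?b"
      by (simp only: com[OF fH[OF gh(2)]])
    also have "\<dots> = \<psi> g * \<psi> h" by (simp add: \<psi>_def mult.assoc)
    finally show ?thesis .
  qed
  have \<psi>H: "\<psi> g \<in> H'" if "g \<in> H" for g
    using that fH B.closed B.t by (simp add: \<psi>_def)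
  have "inj_on \<psi> H"
  proof (rule inj_onI)
    fix g h assume gh: "g \<in> H" "h \<in> H" "\<psi> g = \<psi> h"
    \<comment> \<open>\<open>\<psi> u\<close> differs from \<open>f u\<close> by a power of
      \<open>t'\<close>, which \<open>\<chi>'\<close> does not see; so \<open>\<psi> u\<close>
      determines \<open>\<chi> u\<close> and then \<open>f u\<close>.\<close>
    have "\<chi>' (\<psi> u) = k * \<chi> u mod p" if u: "u \<in> H" for u
    proof -
      have "inverse t' ^ n = t' ^ (n * (p - 1))" for n
      proof -
        have "inverse t' = t' ^ (p - 1)"
          using B.exponent[OF B.t(1)] A.p_gt_0 by (intro grp_inverse_unique) (simp flip: power_Suc)
        then show ?thesis by (simp add: mult.commute flip: power_mult)
      qed
      then show ?thesis using fH[OF u] \<chi>'[OF u] by (simp only: \<psi>_def B.\<chi>_mult_t)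
    qed
    then have "[k * \<chi> g = k * \<chi> h] (mod p)" using gh by (metis cong_def)
    moreover have "coprime k p" using prime_imp_coprime[OF A.p k] by (simp add: coprime_commute)
    ultimately have "[\<chi> g = \<chi> h] (mod p)" by (simp add: cong_mult_lcancel_nat)
    then have "\<chi> g = \<chi> h" using A.\<chi>_less gh by (simp add: cong_def)
    then have "f g = f h" using gh(3) by (simp add: \<psi>_def)
    then show "g = h" using bij gh by (auto simp: bij_betw_def inj_on_def)
  qed
  moreover have "card H = card H'" using bij by (rule bij_betw_same_card)
  ultimately have "bij_betw \<psi> H H'"
    using \<psi>H B.finite by (intro bij_betw_imageI card_subset_eq) (auto simp: card_image)
  then have "\<psi> \<in> iso (mon H) (mon H')"
    using \<psi>_mult by (auto simp: iso_def hom_def bij_betw_def)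
  then show ?thesis by (auto simp: is_iso_def)
qed

text \<open>\<open>\<chi>\<close> records the coset of a maximal subgroup \<open>M\<close>. The
  element \<open>t\<close> is taken from the last nontrivial intersection of \<open>M\<close> with
  the lower central series, which is central; \<open>k \<ge> 2\<close> makes \<open>M\<close>
  nontrivial.\<close>

lemma twist_exists:
  assumes H: "pgrp p k H" and k: "k \<ge> 2" and exponent: "\<And>h. h \<in> H \<Longrightarrow> h ^ p = 1"
  obtains \<chi> t where "twist p H \<chi> t"
proof -
  note sgp = pgrp_sgp[OF H] and fin = pgrp_finite[OF H] and p = pgrp_prime[OF H]
  note closed = sgp_closed[OF sgp]
  have p1: "p > 1" using prime_gt_1_nat[OF p] .
  have cH: "card H = p ^ k" using H by (simp add: pgrp_def)
  have "p ^ k \<noteq> 1" using p1 k by simp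
  then have "card H \<noteq> card {1 :: 'a}" using cH by simp
  moreover have "gen {} = {1 :: 'a}" using gen_subset[of "{}" "{1 :: 'a}"] gen_one[of "{}"] by auto
  ultimately have "gen {} \<noteq> H" by metis
  then obtain M where M: "sgp M" "M \<subseteq> H" "M \<noteq> H" "nrm M H" "\<And>g. g \<in> H \<Longrightarrow> g \<notin> M \<Longrightarrow> gen (insert g M) = H"
    using obtain_maximal_subgroup[OF H empty_subsetI] by metis
  obtain x where x: "x \<in> H" "x \<notin> M" using M by blast
  have xp: "x ^ p = 1" using exponent[OF x(1)] .
  have cjM: "cj h m \<in> M" if "h \<in> H" "m \<in> M" for h m using nrm_cj[OF M(4)] that by blast
  have Heq: "H = (\<lambda>(i, s). x ^ i * s) ` ({..<p} \<times> M)"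
    using gen_insert_normal[OF M(1) cjM[OF x(1)], of p] M(5)[OF x] xp sgp_one[OF M(1)] p1 by simp
  have xM: "p dvd n" if "x ^ n \<in> M" for n
  proof (rule ccontr)
    assume "\<not> p dvd n"
    then have "coprime n p" using prime_imp_coprime[OF p] by (simp add: coprime_commute)
    then have "x \<in> gen {zp x (int n)}" using xp by (intro coprime_power_generates) auto
    also have "\<dots> \<subseteq> M" using that M(1) by (intro gen_subset) auto
    finally show False using x by simp
  qed
  have eq: "[i = j] (mod p)" if "x ^ i * m = x ^ j * m'" "m \<in> M" "m' \<in> M" for i j m m'
  proof -
    have *: "[i = j] (mod p)" if h: "x ^ i * m = x ^ j * m'" "m \<in> M" "m' \<in> M" "i \<le> j" for i j m m'
    proof -
      have "x ^ j = x ^ i * x ^ (j - i)" using h(4) by (simp flip: power_add)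
      then have "m = x ^ (j - i) * m'" using h(1) by (simp add: mult.assoc)
      then have "x ^ (j - i) \<in> M" using h(2,3) sgp_mult_right_iff[OF M(1)] by blast
      then show ?thesis using xM h(4) by (metis cong_altdef_nat cong_sym_eq)
    qed
    show ?thesis using *[of i m j m'] *[of j m' i m] that by (cases "i \<le> j") (auto simp: cong_sym_eq)
  qed
  define \<chi> where "\<chi> h = (SOME i. i < p \<and> (\<exists>m\<in>M. h = x ^ i * m))" for h
  have \<chi>: "\<chi> h < p \<and> (\<exists>m\<in>M. h = x ^ \<chi> h * m)" if "h \<in> H" for h
    unfolding \<chi>_def by (rule someI_ex) (use that in \<open>subst (asm) Heq, auto\<close>)
  have \<chi>I: "\<chi> h = i mod p" if "h = x ^ i * m" "m \<in> M" for h i m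
  proof -
    have "h \<in> H" using that M(2) x closed by auto
    then obtain m' where m': "\<chi> h < p" "m' \<in> M" "h = x ^ \<chi> h * m'" using \<chi>[of h] by blast
    then have "x ^ \<chi> h * m' = x ^ i * m" using that(1) by metis
    then have "[\<chi> h = i] (mod p)" using m'(2) that(2) by (rule eq)
    then show ?thesis using m'(1) by (simp add: cong_def)
  qed
  define N where "N i = M \<inter> gam H i" for i
  have "card H \<le> p * card M" using card_gen_insert_le(2)[OF M(1) cjM[OF x(1)], of p] M(5)[OF x] xp sgp_one[OF M(1)] p1 finite_subset[OF M(2) fin] by simp
  then have "p ^ k \<le> p * card M" using cH by simp
  moreover have "p * 1 < p ^ k" using power_strict_increasing[of 1 k p] k p1 by simp
  ultimately have "M \<noteq> {1}" by auto
  then have N0: "N 0 \<noteq> {1}" using M(2) by (simp add: N_def Int_absorb2)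
  have N7: "N (Suc k) = {1}" using gam_pgrp_trivial[OF H] sgp_one[OF M(1)] by (auto simp: N_def)
  then obtain i where i: "N i \<noteq> {1}" "N (Suc i) = {1}"
    using ex_least_nat_less[of "\<lambda>i. N i = {1}", OF N7 N0] by blast
  have "1 \<in> N i" using sgp_one[OF M(1)] sgp_one[OF nrm_sgp[OF gam_normal[OF sgp]]] by (simp add: N_def)
  then obtain t where t: "t \<in> N i" "t \<noteq> 1" using i(1) by blast
  have tM: "t \<in> M" "t \<in> gam H i" using t by (simp_all add: N_def)
  have central: "t * h = h * t" if h: "h \<in> H" for h
  proof -
    have "cm t h \<in> M" using nrm_cm[OF M(4)] tM h by blast
    moreover have "cm t h \<in> gam H (Suc i)" using gam_cm_self[OF sgp tM(2) h] .
    ultimately have "cm t h = 1" using i(2) by (auto simp: N_def)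
    then show ?thesis by (simp add: cm_eq_one_iff)
  qed
  have "twist p H \<chi> t"
  proof
    fix g h assume gh: "g \<in> H" "h \<in> H"
    obtain m where m: "m \<in> M" "g = x ^ \<chi> g * m" using \<chi>[OF gh(1)] by blast
    obtain n where n: "n \<in> M" "h = x ^ \<chi> h * n" using \<chi>[OF gh(2)] by blast
    have "x ^ i * m * (x ^ j * n) = x ^ (i + j) * (cj (x ^ j) m * n)" for i j
      by (simp add: cj_def power_add mult.assoc)
    then have "g * h = x ^ (\<chi> g + \<chi> h) * (cj (x ^ \<chi> h) m * n)" using m(2) n(2) by metis
    moreover have "cj (x ^ \<chi> h) m * n \<in> M" using sgp_mult[OF M(1) cjM[OF closed(4)[OF x(1)] m(1)] n(1)] .
    ultimately show "\<chi> (g * h) = (\<chi> g + \<chi> h) mod p" by (rule \<chi>I)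
  next
    show "\<chi> t = 0" using \<chi>I[of t 0 t] tM by simp
    show "\<exists>h\<in>H. \<chi> h = 1" using \<chi>I[of x 1 1] x sgp_one[OF M(1)] p1 by auto
  qed (use p sgp fin tM t M(2) central exponent \<chi> in auto)
  then show ?thesis by (rule that)
qed

subsection \<open>A family of groups that are not Beauville groups\<close>

locale family =
  fixes p \<kappa> :: nat
  assumes p: "prime p" and p_odd: "odd p"
begin

abbreviation (input) P :: int where "P \<equiv> int p"

definition E :: "int \<Rightarrow> int \<Rightarrow> int \<Rightarrow> int \<times> int \<times> int" where
  "E i r c = (i mod P\<^sup>2, r mod P ^ 3, c mod P)"

text \<open>The exponent that \<open>Y\<close> acquires on being moved past the \<open>j\<close>-th
  power of \<open>X\<close>.\<close>

definition A :: "int \<Rightarrow> int" where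
  "A j = 1 + j * P + int \<kappa> * j\<^sup>2 * P\<^sup>2"

text \<open>Modulo \<open>P ^ 3\<close> the product \<open>A j * A k\<close> is
  \<open>A (j + k) - l * j * k * P\<^sup>2\<close>. The term with \<open>l\<close> in the
  multiplication of \<open>F\<close> compensates this defect and gives associativity.\<close>

abbreviation l :: int where "l \<equiv> 2 * int \<kappa> - 1"

text \<open>\<open>E i r c\<close> is the normal form \<open>X\<^sup>i Y\<^sup>r Z\<^sup>c\<close> with \<open>X = E 1 0 0\<close>, \<open>Y = E 0 1 0\<close> and \<open>Z = E 0 0 1\<close>;
  the parameter \<open>\<kappa>\<close> is recovered from \<open>[C, X] = Y ^ (2 * \<kappa> * p\<^sup>2)\<close>, where \<open>C = [Y, X]\<close>.\<close>

definition F :: "(int \<times> int \<times> int) monoid" where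
  "F = \<lparr>carrier = {0..<P\<^sup>2} \<times> {0..<P ^ 3} \<times> {0..<P},
        monoid.mult = (\<lambda>(i, r, c) (j, s, d). E (i + j) (r * A j + j * c * l * P\<^sup>2 + s) (j * r + c + d)),
        one = (0, 0, 0)\<rparr>"

lemma P_gt_0: "P > 0" and P_gt_1: "P > 1"
  using prime_gt_0_nat[OF p] prime_gt_1_nat[OF p] by auto

lemma p_gt_2: "p > 2"
  using prime_gt_1_nat[OF p] p_odd by (cases "p = 2") auto

lemma E_eq_iff: "E i r c = E j s d \<longleftrightarrow> [i = j] (mod P\<^sup>2) \<and> [r = s] (mod P ^ 3) \<and> [c = d] (mod P)"
  by (simp add: E_def cong_def)

lemma E_in_carrier [simp]: "E i r c \<in> carrier F"
  using P_gt_0 by (simp add: E_def F_def)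

lemma carrier_F: "g \<in> carrier F \<longleftrightarrow> (\<exists>i r c. g = E i r c)"
proof
  assume "g \<in> carrier F"
  then have "g = E (fst g) (fst (snd g)) (snd (snd g))"
    by (auto simp: F_def E_def)
  then show "\<exists>i r c. g = E i r c" by blast
qed auto

lemma one_F: "\<one>\<^bsub>F\<^esub> = E 0 0 0"
  by (simp add: F_def E_def)

lemma order_F: "order F = p ^ 6"
  using P_gt_0 by (simp add: order_def F_def card_cartesian_product nat_power_eq flip: power_add power_Suc2)

lemma cong_P: "[i = j] (mod P\<^sup>2) \<Longrightarrow> [i = j] (mod P)" "[r = s] (mod P ^ 3) \<Longrightarrow> [r = s] (mod P)"
  "[r = s] (mod P ^ 3) \<Longrightarrow> [r = s] (mod P\<^sup>2)"
  by (auto elim!: cong_dvd_modulus simp: le_imp_power_dvd)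

lemma A_cong: "[i = j] (mod P\<^sup>2) \<Longrightarrow> [A i = A j] (mod P ^ 3)"
proof -
  assume "[i = j] (mod P\<^sup>2)"
  then obtain q where q: "i = j + P\<^sup>2 * q" using cong_iff_lin[of j i "P\<^sup>2"] by (auto simp: cong_sym_eq)
  have "A i - A j = P ^ 3 * (q + int \<kappa> * P * q * (2 * j + P\<^sup>2 * q))"
    unfolding A_def q by (simp add: power_numeral_reduce algebra_simps)
  then show ?thesis by (simp add: cong_iff_dvd_diff)
qed

lemma mult_F [simp]:
  "E i r c \<otimes>\<^bsub>F\<^esub> E j s d = E (i + j) (r * A j + j * c * l * P\<^sup>2 + s) (j * r + c + d)"
proof -
  have 1: "[i mod P\<^sup>2 = i] (mod P\<^sup>2)" "[j mod P\<^sup>2 = j] (mod P\<^sup>2)" "[r mod P ^ 3 = r] (mod P ^ 3)"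
    "[s mod P ^ 3 = s] (mod P ^ 3)" "[c mod P = c] (mod P)" "[d mod P = d] (mod P)"
    by (simp_all add: cong_def)
  have "[(j mod P\<^sup>2) * (c mod P) * l = j * c * l] (mod P)"
    using 1 cong_P by (intro cong_mult) auto
  then have 2: "[(j mod P\<^sup>2) * (c mod P) * l * P\<^sup>2 = j * c * l * P\<^sup>2] (mod P ^ 3)"
    by (simp add: cong_iff_dvd_diff flip: left_diff_distrib) (simp add: power_numeral_reduce mult_dvd_mono)
  have 3: "[(r mod P ^ 3) * A (j mod P\<^sup>2) = r * A j] (mod P ^ 3)"
    by (intro cong_mult A_cong 1)
  have 4: "[(j mod P\<^sup>2) * (r mod P ^ 3) = j * r] (mod P)"
    by (rule cong_mult[OF cong_P(1)[OF 1(2)] cong_P(2)[OF 1(3)]])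
  have "E (i mod P\<^sup>2 + j mod P\<^sup>2)
      ((r mod P ^ 3) * A (j mod P\<^sup>2) + (j mod P\<^sup>2) * (c mod P) * l * P\<^sup>2 + s mod P ^ 3)
      ((j mod P\<^sup>2) * (r mod P ^ 3) + c mod P + d mod P)
    = E (i + j) (r * A j + j * c * l * P\<^sup>2 + s) (j * r + c + d)"
    unfolding E_eq_iff
    using cong_add[OF 1(1,2)] cong_add[OF cong_add[OF 3 2] 1(4)] cong_add[OF cong_add[OF 4 1(5)] 1(6)]
    by blast
  then show ?thesis by (simp add: F_def E_def)
qed

lemma group_F: "group F"
proof (rule groupI)
  fix x y z assume "x \<in> carrier F" "y \<in> carrier F" "z \<in> carrier F"
  then obtain i r c j s d k u e where xyz: "x = E i r c" "y = E j s d" "z = E k u e"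
    unfolding carrier_F by blast
  have "(r * A j + j * c * l * P\<^sup>2 + s) * A k + k * (j * r + c + d) * l * P\<^sup>2 + u
      - (r * A (j + k) + (j + k) * c * l * P\<^sup>2 + (s * A k + k * d * l * P\<^sup>2 + u))
      = P ^ 3 * (r * (int \<kappa> * j * k * (j + k) + int \<kappa> * int \<kappa> * j\<^sup>2 * k\<^sup>2 * P) + j * c * l * k * (1 + int \<kappa> * k * P))"
    unfolding A_def by (simp add: power_numeral_reduce algebra_simps)
  then have 1: "[(r * A j + j * c * l * P\<^sup>2 + s) * A k + k * (j * r + c + d) * l * P\<^sup>2 + u
      = r * A (j + k) + (j + k) * c * l * P\<^sup>2 + (s * A k + k * d * l * P\<^sup>2 + u)] (mod P ^ 3)"
    by (simp add: cong_iff_dvd_diff)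
  have "k * (r * A j + j * c * l * P\<^sup>2 + s) + (j * r + c + d) + e - ((j + k) * r + c + (k * s + d + e))
    = P * (k * r * (j + int \<kappa> * j\<^sup>2 * P) + k * j * c * l * P)"
    unfolding A_def by (simp add: power_numeral_reduce algebra_simps)
  then have 2: "[k * (r * A j + j * c * l * P\<^sup>2 + s) + (j * r + c + d) + e = (j + k) * r + c + (k * s + d + e)] (mod P)"
    by (simp add: cong_iff_dvd_diff)
  show "(x \<otimes>\<^bsub>F\<^esub> y) \<otimes>\<^bsub>F\<^esub> z = x \<otimes>\<^bsub>F\<^esub> (y \<otimes>\<^bsub>F\<^esub> z)"
    unfolding xyz mult_F E_eq_iff using 1 2 by (simp only: add.assoc cong_refl simp_thms)
next
  fix x assume "x \<in> carrier F"
  then obtain i r c where x: "x = E i r c" unfolding carrier_F by blast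
  define s where "s = A (- i) * (i * c * l * P\<^sup>2 - r)"
  have "s * A i + i * (- c - i * s) * l * P\<^sup>2 + r
    = (i * c * l * P\<^sup>2 - r) * (A (- i) * (A i - i\<^sup>2 * l * P\<^sup>2) - 1)"
    unfolding s_def by (simp add: power_numeral_reduce algebra_simps)
  also have "A (- i) * (A i - i\<^sup>2 * l * P\<^sup>2) - 1 = P ^ 3 * (i ^ 3 * l + int \<kappa> * int \<kappa> * i ^ 4 * P - int \<kappa> * i ^ 4 * l * P)"
    unfolding A_def by (simp add: power_numeral_reduce algebra_simps)
  finally have "[s * A i + i * (- c - i * s) * l * P\<^sup>2 + r = 0] (mod P ^ 3)"
    by (simp add: cong_iff_dvd_diff)
  then have "E (- i) s (- c - i * s) \<otimes>\<^bsub>F\<^esub> x = \<one>\<^bsub>F\<^esub>"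
    by (simp add: x one_F E_eq_iff)
  then show "\<exists>y\<in>carrier F. y \<otimes>\<^bsub>F\<^esub> x = \<one>\<^bsub>F\<^esub>" by (rule bexI) (rule E_in_carrier)
next
  fix x y assume "x \<in> carrier F" "y \<in> carrier F"
  then obtain i r c j s d where "x = E i r c" "y = E j s d" unfolding carrier_F by blast
  then show "x \<otimes>\<^bsub>F\<^esub> y \<in> carrier F" by simp
next
  fix x assume "x \<in> carrier F"
  then show "\<one>\<^bsub>F\<^esub> \<otimes>\<^bsub>F\<^esub> x = x" unfolding carrier_F one_F by (auto simp: A_def)
qed (simp add: one_F)

interpretation F: group F by (rule group_F)

lemma pow_r: "E 0 r c [^]\<^bsub>F\<^esub> (n::nat) = E 0 (int n * r) (int n * c)"
proof (induction n)
  case 0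
  show ?case using F.nat_pow_0 by (simp add: one_F)
qed (simp add: A_def algebra_simps)

lemma pow_i: "E i 0 0 [^]\<^bsub>F\<^esub> (n::nat) = E (int n * i) 0 0"
proof (induction n)
  case 0
  show ?case using F.nat_pow_0 by (simp add: one_F)
qed (simp add: A_def algebra_simps)

text \<open>The correction \<open>q\<close> may stay unspecified, since it disappears in the next
  \<open>p\<close>-th power.\<close>

lemma pow_p: "\<exists>q. E i r c [^]\<^bsub>F\<^esub> p = E (P * i) (P * r + P\<^sup>2 * q) 0"
proof -
  let ?T = "\<lambda>n. int (n choose 2)"
  have *: "\<exists>q q'. E i r c [^]\<^bsub>F\<^esub> n
      = E (int n * i) (r * (int n + i * P * ?T n) + P\<^sup>2 * q) (int n * c + i * r * ?T n + P * q')" for n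
  proof (induction n)
    case 0
    show ?case using F.nat_pow_0 by (auto simp: one_F numeral_2_eq_2 intro!: exI[of _ 0])
  next
    case (Suc n)
    then obtain q q' where IH: "E i r c [^]\<^bsub>F\<^esub> n
      = E (int n * i) (r * (int n + i * P * ?T n) + P\<^sup>2 * q) (int n * c + i * r * ?T n + P * q')" by blast
    have T: "?T (Suc n) = ?T n + int n" by (simp add: numeral_2_eq_2)
    define R where "R = r * (int n + i * P * ?T n) + P\<^sup>2 * q"
    define C where "C = int n * c + i * r * ?T n + P * q'"
    have "R * A i + i * C * l * P\<^sup>2 + r = r * (int (Suc n) + i * P * ?T (Suc n))
       + P\<^sup>2 * (q * (1 + i * P) + r * i\<^sup>2 * ?T n + R * int \<kappa> * i\<^sup>2 + i * C * l)"
      unfolding T R_def A_def of_nat_Suc by (simp add: power_numeral_reduce algebra_simps)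
    moreover have "i * R + C + c = int (Suc n) * c + i * r * ?T (Suc n)
       + P * (q' + i * (r * i * ?T n + P * q))"
      unfolding T R_def C_def of_nat_Suc by (simp add: power_numeral_reduce algebra_simps)
    moreover have "E i r c [^]\<^bsub>F\<^esub> Suc n = E (int n * i + i) (R * A i + i * C * l * P\<^sup>2 + r) (i * R + C + c)"
      by (simp add: IH R_def C_def)
    moreover have "int n * i + i = int (Suc n) * i" by (simp add: algebra_simps)
    ultimately show ?case by metis
  qed
  have "p dvd p choose 2" using dvd_binomial_prime_power[OF p, of 2 1] p_gt_2 by simp
  then obtain T where T: "p choose 2 = p * T" by blast
  obtain q q' where q: "E i r c [^]\<^bsub>F\<^esub> p
      = E (P * i) (r * (P + i * P * ?T p) + P\<^sup>2 * q) (P * c + i * r * ?T p + P * q')" using * by blast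
  have "r * (P + i * P * ?T p) + P\<^sup>2 * q = P * r + P\<^sup>2 * (r * i * int T + q)"
    unfolding T of_nat_mult by (simp add: power_numeral_reduce algebra_simps)
  moreover have "[P * c + i * r * ?T p + P * q' = 0] (mod P)"
    unfolding T by (simp add: cong_0_iff)
  ultimately show ?thesis unfolding q by (intro exI[of _ "r * i * int T + q"]) (simp add: E_eq_iff)
qed

text \<open>The \<open>p\<^sup>2\<close>-th powers thus form a group of order \<open>p\<close>,
  which is what rules out a Beauville structure.\<close>

lemma pow_p2: "E i r c [^]\<^bsub>F\<^esub> p\<^sup>2 = E 0 (P\<^sup>2 * r) 0"
proof -
  obtain q where q: "E i r c [^]\<^bsub>F\<^esub> p = E (P * i) (P * r + P\<^sup>2 * q) 0" using pow_p by blast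
  define s where "s = P * r + P\<^sup>2 * q"
  have *: "E (P * i) s 0 [^]\<^bsub>F\<^esub> n = E (int n * (P * i)) (int n * s) 0" for n
  proof (induction n)
    case 0
    show ?case using F.nat_pow_0 by (simp add: one_F)
  next
    case (Suc n)
    have "int n * s * A (P * i) + s - int (Suc n) * s = P ^ 3 * (int n * (r + P * q) * i * (1 + int \<kappa> * i * P\<^sup>2))"
      unfolding A_def s_def of_nat_Suc by (simp add: power_numeral_reduce algebra_simps)
    then have 1: "[int n * s * A (P * i) + s = int (Suc n) * s] (mod P ^ 3)" by (simp only: cong_iff_dvd_diff dvd_triv_left)
    have "E (P * i) s 0 [^]\<^bsub>F\<^esub> Suc n = E (int n * (P * i) + P * i) (int n * s * A (P * i) + s) (P * i * (int n * s))"
      by (simp add: Suc)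
    also have "\<dots> = E (int (Suc n) * (P * i)) (int (Suc n) * s) 0"
      unfolding E_eq_iff using 1 by (simp add: algebra_simps cong_0_iff)
    finally show ?case .
  qed
  have "E i r c [^]\<^bsub>F\<^esub> p\<^sup>2 = (E i r c [^]\<^bsub>F\<^esub> p) [^]\<^bsub>F\<^esub> p"
    by (simp add: F.nat_pow_pow power2_eq_square)
  also have "\<dots> = E (P * (P * i)) (P * s) 0" unfolding q s_def[symmetric] * ..
  also have "\<dots> = E 0 (P\<^sup>2 * r) 0"
    by (simp add: E_eq_iff s_def cong_iff_dvd_diff power2_eq_square power3_eq_cube algebra_simps)
  finally show ?thesis .
qed

lemma A_cong_1: "[A j = 1] (mod P)"
  by (simp add: A_def cong_iff_dvd_diff power2_eq_square)

text \<open>By \<open>pow_p2\<close> these are the elements whose \<open>p\<^sup>2\<close>-th power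
  is trivial.\<close>

lemma subgroup_r: "subgroup {E i r c |i r c. P dvd r} F"
proof (rule F.subgroupI)
  fix g assume "g \<in> {E i r c |i r c. P dvd r}"
  then obtain i r c where g: "g = E i r c" "P dvd r" by blast
  then obtain j s d where inv: "inv\<^bsub>F\<^esub> g = E j s d" using F.inv_closed[of g] unfolding carrier_F by auto
  have "E i r c \<otimes>\<^bsub>F\<^esub> E j s d = \<one>\<^bsub>F\<^esub>" using F.r_inv[of g] g(1) inv by (metis E_in_carrier)
  then have "[r * A j + j * c * l * P\<^sup>2 + s = 0] (mod P)"
    using cong_P(2) by (auto simp: one_F E_eq_iff)
  then have "P dvd s" using g(2) by (simp add: cong_0_iff dvd_add_right_iff power2_eq_square)
  then show "inv\<^bsub>F\<^esub> g \<in> {E i r c |i r c. P dvd r}" using inv by blast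
next
  fix g h assume "g \<in> {E i r c |i r c. P dvd r}" "h \<in> {E i r c |i r c. P dvd r}"
  then obtain i r c j s d where "g = E i r c" "h = E j s d" "P dvd r" "P dvd s" by blast
  moreover from this have "P dvd r * A j + j * c * l * P\<^sup>2 + s" by (simp add: power2_eq_square)
  ultimately show "g \<otimes>\<^bsub>F\<^esub> h \<in> {E i r c |i r c. P dvd r}" by (simp only: mult_F) blast
next
  have "E 0 0 0 \<in> {E i r c |i r c. P dvd r}" by blast
  then show "{E i r c |i r c. P dvd r} \<noteq> {}" by blast
qed auto

lemma generating_pair_unit:
  assumes "generating_pair F (E i r c) (E j s d)"
  shows "\<not> P dvd r \<or> \<not> P dvd s"
proof (rule ccontr)
  assume "\<not> ?thesis"
  then have "generate F {E i r c, E j s d} \<subseteq> {E i r c |i r c. P dvd r}"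
    by (intro F.generate_subgroup_incl[OF _ subgroup_r]) auto
  then have "E 0 1 0 \<in> {E i r c |i r c. P dvd r}"
    using assms E_in_carrier[of 0 1 0] unfolding generating_pair_def by blast
  then obtain r where "[1 = r] (mod P)" "P dvd r"
    using cong_P(2)[of 1] by (auto simp: E_eq_iff)
  then have "P dvd 1" using cong_dvd_iff by blast
  then show False using P_gt_1 by simp
qed

lemma generating_pair_F: "generating_pair F (E 1 0 0) (E 0 1 0)"
proof -
  let ?S = "generate F {E 1 0 0, E 0 1 0}"
  have S: "subgroup ?S F" by (intro F.generate_is_subgroup) simp
  have pow: "g [^]\<^bsub>F\<^esub> (n::nat) \<in> ?S" if "g \<in> ?S" for g n
    by (induction n) (use that subgroup.m_closed[OF S] subgroup.one_closed[OF S] F.nat_pow_Suc F.nat_pow_0 in simp_all)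
  have X: "E i 0 0 \<in> ?S" for i
  proof -
    have "E i 0 0 = E 1 0 0 [^]\<^bsub>F\<^esub> nat (i mod P\<^sup>2)"
      using P_gt_0 by (simp add: pow_i E_eq_iff cong_def)
    then show ?thesis using pow[of "E 1 0 0"] by (simp add: generate.incl)
  qed
  have Y: "E 0 r 0 \<in> ?S" for r
  proof -
    have "E 0 r 0 = E 0 1 0 [^]\<^bsub>F\<^esub> nat (r mod P ^ 3)"
      using P_gt_0 by (simp add: pow_r E_eq_iff cong_def)
    then show ?thesis using pow[of "E 0 1 0"] by (simp add: generate.incl)
  qed
  have XY: "E i r 0 \<in> ?S" for i r
    using subgroup.m_closed[OF S X Y, of i r] by (simp add: A_def)
  have "E 1 (A 1) 1 \<in> ?S"
    using subgroup.m_closed[OF S Y X, of 1 1] by simp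
  then have "inv\<^bsub>F\<^esub> (E 1 (A 1) 0) \<otimes>\<^bsub>F\<^esub> E 1 (A 1) 1 \<in> ?S"
    using XY S by (simp add: subgroup.m_closed subgroup.m_inv_closed)
  moreover have "E 1 (A 1) 1 = E 1 (A 1) 0 \<otimes>\<^bsub>F\<^esub> E 0 0 1" by (simp add: A_def)
  ultimately have Z1: "E 0 0 1 \<in> ?S"
    by (simp only: F.inv_solve_left'[symmetric] F.l_inv F.m_assoc[symmetric] F.l_one E_in_carrier F.inv_closed)
  have Z: "E 0 0 c \<in> ?S" for c
  proof -
    have "E 0 0 c = E 0 0 1 [^]\<^bsub>F\<^esub> nat (c mod P)"
      using P_gt_0 by (simp add: pow_r E_eq_iff cong_def)
    then show ?thesis using pow[OF Z1] by simp
  qed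
  have "E i r c \<in> ?S" for i r c
    using subgroup.m_closed[OF S XY Z, of i r c] by (simp add: A_def)
  then have "carrier F \<subseteq> ?S" unfolding subset_iff carrier_F by blast
  then show ?thesis
    unfolding generating_pair_def using subgroup.subset[OF S] E_in_carrier by blast
qed

lemma not_beauville_F: "\<not> beauville_group F"
proof (rule F.not_beauville_groupI)
  show "E 0 (P\<^sup>2) 0 \<noteq> \<one>\<^bsub>F\<^esub>"
    using P_gt_1 by (simp add: one_F E_eq_iff cong_0_iff zdvd_not_zless power_strict_increasing)
  fix g h assume gh: "generating_pair F g h"
  then obtain i r c j s d where E: "g = E i r c" "h = E j s d"
    unfolding generating_pair_def carrier_F by blast
  have unit: "\<exists>n::nat. E i r c [^]\<^bsub>F\<^esub> n = E 0 (P\<^sup>2) 0" if "\<not> P dvd r" for i r c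
  proof -
    have "coprime r P" using prime_imp_coprime[of P r] that p by (simp add: coprime_commute)
    then obtain m where m: "[r * m = 1] (mod P)" using cong_solve_coprime_int by blast
    define n where "n = nat (m mod P)"
    have "[int n = m] (mod P)" using P_gt_0 by (simp add: n_def cong_def)
    then have "[int n * r = 1] (mod P)" using m by (metis cong_scalar_right cong_trans mult.commute)
    then have "[int n * (P\<^sup>2 * r) = P\<^sup>2] (mod P ^ 3)"
    proof -
      assume "[int n * r = 1] (mod P)"
      then obtain q where q: "int n * r - 1 = P * q" by (auto simp: cong_iff_dvd_diff)
      have "int n * (P\<^sup>2 * r) - P\<^sup>2 = P\<^sup>2 * (int n * r - 1)" by (simp add: algebra_simps)
      also have "\<dots> = P ^ 3 * q" unfolding q by (simp add: power_numeral_reduce)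
      finally have "int n * (P\<^sup>2 * r) - P\<^sup>2 = P ^ 3 * q" .
      then show ?thesis by (simp add: cong_iff_dvd_diff)
    qed
    then have "E i r c [^]\<^bsub>F\<^esub> (p\<^sup>2 * n) = E 0 (P\<^sup>2) 0"
      by (simp add: pow_p2 pow_r E_eq_iff flip: F.nat_pow_pow)
    then show ?thesis by blast
  qed
  show "\<exists>u\<in>{g, h}. \<exists>n::nat. u [^]\<^bsub>F\<^esub> n = E 0 (P\<^sup>2) 0"
    using generating_pair_unit gh unit unfolding E by blast
qed

lemma relations_F:
  "E 1 0 0 [^]\<^bsub>F\<^esub> p\<^sup>2 = \<one>\<^bsub>F\<^esub>"
  "E 0 1 0 \<otimes>\<^bsub>F\<^esub> E 1 0 0 = E 1 0 0 \<otimes>\<^bsub>F\<^esub> E 0 1 0 \<otimes>\<^bsub>F\<^esub> E 0 (A 1 - 1) 1"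
  "E 0 (A 1 - 1) 1 [^]\<^bsub>F\<^esub> p = E 0 1 0 [^]\<^bsub>F\<^esub> p\<^sup>2"
  "E 0 (A 1 - 1) 1 \<otimes>\<^bsub>F\<^esub> E 1 0 0
    = E 1 0 0 \<otimes>\<^bsub>F\<^esub> E 0 (A 1 - 1) 1 \<otimes>\<^bsub>F\<^esub> (E 0 1 0 [^]\<^bsub>F\<^esub> p\<^sup>2) [^]\<^bsub>F\<^esub> (2 * \<kappa>)"
proof -
  show "E 1 0 0 [^]\<^bsub>F\<^esub> p\<^sup>2 = \<one>\<^bsub>F\<^esub>" by (simp add: pow_p2 one_F)
  show "E 0 1 0 \<otimes>\<^bsub>F\<^esub> E 1 0 0 = E 1 0 0 \<otimes>\<^bsub>F\<^esub> E 0 1 0 \<otimes>\<^bsub>F\<^esub> E 0 (A 1 - 1) 1"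
    by (simp add: A_def add.assoc)
  have "P * (A 1 - 1) - P\<^sup>2 = P ^ 3 * int \<kappa>"
    by (simp add: A_def power_numeral_reduce algebra_simps)
  then show "E 0 (A 1 - 1) 1 [^]\<^bsub>F\<^esub> p = E 0 1 0 [^]\<^bsub>F\<^esub> p\<^sup>2"
    by (simp add: pow_r E_eq_iff cong_iff_dvd_diff)
  have "(A 1 - 1) * A 1 + l * P\<^sup>2 - (A 1 - 1 + int (2 * \<kappa>) * P\<^sup>2) = P ^ 3 * (2 * int \<kappa> + int \<kappa> * int \<kappa> * P)"
    by (simp add: A_def power_numeral_reduce algebra_simps)
  moreover have "[A 1 - 1 + 1 = 1] (mod P)" using A_cong_1[of 1] by simp
  ultimately show "E 0 (A 1 - 1) 1 \<otimes>\<^bsub>F\<^esub> E 1 0 0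
    = E 1 0 0 \<otimes>\<^bsub>F\<^esub> E 0 (A 1 - 1) 1 \<otimes>\<^bsub>F\<^esub> (E 0 1 0 [^]\<^bsub>F\<^esub> p\<^sup>2) [^]\<^bsub>F\<^esub> (2 * \<kappa>)"
    by (simp add: pow_p2 pow_r E_eq_iff cong_iff_dvd_diff) (simp add: A_def)
qed

text \<open>Because \<open>g\<close> and \<open>h\<close> are an arbitrary generating pair, the
  parameter modulo \<open>p\<close> becomes an isomorphism invariant. The first relation makes
  \<open>r\<close> divisible by \<open>p\<close>, so \<open>s\<close> is a unit. The third fixes the
  \<open>Y\<close>-exponent of \<open>C\<close> modulo \<open>P\<^sup>2\<close>, which by the second
  forces \<open>i = 1\<close> modulo \<open>p\<close>. The fourth then compares
  \<open>2 * m * s\<close> with \<open>2 * \<kappa> * s\<close>.\<close>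

lemma relations_determine_parameter:
  fixes m :: nat
  assumes gp: "generating_pair F g h" and C: "C \<in> carrier F"
    and rel: "g [^]\<^bsub>F\<^esub> p\<^sup>2 = \<one>\<^bsub>F\<^esub>" "h \<otimes>\<^bsub>F\<^esub> g = g \<otimes>\<^bsub>F\<^esub> h \<otimes>\<^bsub>F\<^esub> C"
      "C [^]\<^bsub>F\<^esub> p = h [^]\<^bsub>F\<^esub> p\<^sup>2"
      "C \<otimes>\<^bsub>F\<^esub> g = g \<otimes>\<^bsub>F\<^esub> C \<otimes>\<^bsub>F\<^esub> (h [^]\<^bsub>F\<^esub> p\<^sup>2) [^]\<^bsub>F\<^esub> (2 * m)"
  shows "[m = \<kappa>] (mod p)"
proof -
  obtain i r c j s d where E: "g = E i r c" "h = E j s d"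
    using gp unfolding generating_pair_def carrier_F by blast
  obtain e u v where C': "C = E e u v" using C unfolding carrier_F by blast
  have P3: "P ^ 3 = P\<^sup>2 * P" by (simp add: power_numeral_reduce)
  have "P\<^sup>2 * P dvd P\<^sup>2 * r" using rel(1) by (simp add: E pow_p2 one_F E_eq_iff cong_0_iff P3)
  then obtain r' where r: "r = P * r'" using P_gt_0 by (auto elim!: dvdE)
  have s: "\<not> P dvd s" using generating_pair_unit[of i r c j s d] gp r E by simp
  have "[j + i = i + j + e] (mod P\<^sup>2)" using rel(2) by (simp add: E C' E_eq_iff)
  then have "P\<^sup>2 dvd e" using cong_iff_dvd_diff by (auto simp: cong_iff_dvd_diff add.commute dvd_minus_iff)
  then have C: "C = E 0 u v" by (simp add: C' E_eq_iff cong_0_iff)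
  have A0: "A 0 = 1" by (simp add: A_def)
  have 2: "[s * A i + i * d * l * P\<^sup>2 + r = r * A j + j * c * l * P\<^sup>2 + s + u] (mod P ^ 3)"
      "[i * s + d + c = j * r + c + d + v] (mod P)"
    using rel(2) by (simp_all add: E C E_eq_iff A0)
  have "[P * u = P\<^sup>2 * s] (mod P ^ 3)"
    using rel(3) by (simp add: E C pow_p2 pow_r E_eq_iff)
  then have "P * P\<^sup>2 dvd P * (u - P * s)"
    by (simp add: cong_iff_dvd_diff power_numeral_reduce algebra_simps)
  then obtain u' where "u - P * s = P\<^sup>2 * u'" using P_gt_0 by (auto elim!: dvdE)
  then have u: "u = P * s + P\<^sup>2 * u'" by simp
  have "P dvd i * s + d + c - (j * r + c + d + v)" using 2(2) by (simp add: cong_iff_dvd_diff)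
  then obtain v' where "i * s + d + c - (j * r + c + d + v) = P * v'" by blast
  then have v: "v = i * s - P * (j * r' + v')" by (simp add: r algebra_simps)
  obtain w where "s * A i + i * d * l * P\<^sup>2 + r - (r * A j + j * c * l * P\<^sup>2 + s + u) = P ^ 3 * w"
    using 2(1) by (auto simp: cong_iff_dvd_diff)
  then have "P * (s * (i - 1)) = P * (P * (P * w - s * int \<kappa> * i\<^sup>2 - i * d * l + r' * j * (1 + int \<kappa> * j * P) + j * c * l + u'))"
    by (simp add: A_def r u power_numeral_reduce algebra_simps)
  \<comment> \<open>This rigidity of \<open>i\<close> keeps the parameter from being
    rescaled.\<close>
  then have "P dvd s * (i - 1)" using P_gt_0 by simp
  then have "P dvd i - 1" using s p by (simp add: prime_dvd_mult_iff)
  then obtain i' where "i - 1 = P * i'" by blast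
  then have i: "i = 1 + P * i'" by simp
  have "[u * A i + i * v * l * P\<^sup>2 + r = r + u + int (2 * m) * (P\<^sup>2 * s)] (mod P ^ 3)"
    using rel(4) by (simp add: E C pow_p2 pow_r E_eq_iff A0)
  then obtain x where "u * A i + i * v * l * P\<^sup>2 + r - (r + u + int (2 * m) * (P\<^sup>2 * s)) = P ^ 3 * x"
    by (auto simp: cong_iff_dvd_diff)
  then have "P\<^sup>2 * (s * i + i * i * s * l - 2 * int m * s)
      = P\<^sup>2 * (P * (x - u' * i - (s + P * u') * int \<kappa> * i\<^sup>2 + i * (j * r' + v') * l))"
    by (simp add: A_def u v power_numeral_reduce algebra_simps)
  then have "s * i + i * i * s * l - 2 * int m * s
      = P * (x - u' * i - (s + P * u') * int \<kappa> * i\<^sup>2 + i * (j * r' + v') * l)" using P_gt_0 by simp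
  moreover have "s * i + i * i * s * l - 2 * int m * s = 2 * (s * (int \<kappa> - int m)) + P * (s * i' + s * l * (2 * i' + P * i' * i'))"
    by (simp add: i algebra_simps)
  ultimately have "2 * (s * (int \<kappa> - int m)) = P * (x - u' * i - (s + P * u') * int \<kappa> * i\<^sup>2 + i * (j * r' + v') * l
      - (s * i' + s * l * (2 * i' + P * i' * i')))" by (simp add: right_diff_distrib)
  then have "P dvd 2 * (s * (int \<kappa> - int m))" by simp
  moreover have "\<not> P dvd 2" using p_gt_2 by (auto dest: zdvd_imp_le)
  ultimately have "P dvd int \<kappa> - int m" using s p by (simp add: prime_dvd_mult_iff)
  then show ?thesis by (simp add: cong_iff_dvd_diff cong_sym_eq flip: cong_int_iff)
qed

end

lemma family_not_iso:
  assumes "prime p" "odd p" "\<kappa> < p" "\<kappa>' < p" and iso: "family.F p \<kappa> \<cong> family.F p \<kappa>'"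
  shows "\<kappa> = \<kappa>'"
proof -
  interpret A: family p \<kappa> using assms by unfold_locales
  interpret B: family p \<kappa>' using assms by unfold_locales
  interpret A: group A.F by (rule A.group_F)
  interpret B: group B.F by (rule B.group_F)
  obtain f where f: "f \<in> iso A.F B.F" using iso by (auto simp: is_iso_def)
  then have bij: "bij_betw f (carrier A.F) (carrier B.F)" and "f \<in> hom A.F B.F" by (simp_all add: iso_def)
  then interpret f: group_hom A.F B.F f by (simp add: group_hom_def group_hom_axioms_def A.group_F B.group_F)
  let ?X = "A.E 1 0 0" and ?Y = "A.E 0 1 0" and ?C = "A.E 0 (A.A 1 - 1) 1"
  have "generate B.F (f ` {?X, ?Y}) = f ` generate A.F {?X, ?Y}"
    by (rule f.generate_img) simp
  then have "generating_pair B.F (f ?X) (f ?Y)"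
    using A.generating_pair_F bij by (simp add: generating_pair_def bij_betw_def)
  moreover note r = A.relations_F[THEN arg_cong[where f = f]]
  ultimately have "[\<kappa> = \<kappa>'] (mod p)"
    by (intro B.relations_determine_parameter[of "f ?X" "f ?Y" "f ?C"])
       (use r A.nat_pow_closed in \<open>simp_all add: f.hom_nat_pow del: A.mult_F\<close>)
  then show ?thesis using assms by (simp add: cong_def)
qed

subsection \<open>Counting isomorphism classes\<close>

abbreviation iso_rel :: "nat monoid set \<Rightarrow> nat monoid rel" where
  "iso_rel S \<equiv> {(G, H). G \<in> S \<and> H \<in> S \<and> G \<cong> H}"

lemma equiv_iso_rel: "S \<subseteq> Collect group \<Longrightarrow> equiv S (iso_rel S)"
  by (rule equivI) (auto simp: refl_on_def sym_def trans_def intro: group.iso_sym iso_trans)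

text \<open>\<open>P d G\<close> reads as: \<open>d\<close> is a label of \<open>G\<close>. A group
  may have several labels; one is chosen for each class, and a common label forces
  isomorphism.\<close>

lemma num_iso_classes_le:
  assumes S: "S \<subseteq> Collect group" and D: "finite D"
    and ex: "\<And>G. G \<in> S \<Longrightarrow> \<exists>d\<in>D. P d G"
    and iso: "\<And>d G H. d \<in> D \<Longrightarrow> G \<in> S \<Longrightarrow> H \<in> S \<Longrightarrow> P d G \<Longrightarrow> P d H \<Longrightarrow> G \<cong> H"
  shows "finite (S // iso_rel S)" "num_iso_classes S \<le> card D"
proof -
  note eq = equiv_iso_rel[OF S]
  define f where "f C = (SOME d. d \<in> D \<and> (\<exists>G\<in>C. P d G))" for C
  have CS: "C \<subseteq> S" "C \<noteq> {}" if "C \<in> S // iso_rel S" for C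
    using in_quotient_imp_subset[OF eq that] in_quotient_imp_non_empty[OF eq that] by simp_all
  have f: "f C \<in> D \<and> (\<exists>G\<in>C. P (f C) G)" if C: "C \<in> S // iso_rel S" for C
    unfolding f_def by (rule someI_ex) (use CS[OF C] ex in blast)
  have inj: "inj_on f (S // iso_rel S)"
  proof (rule inj_onI)
    fix C C' assume C: "C \<in> S // iso_rel S" "C' \<in> S // iso_rel S" "f C = f C'"
    obtain G where G: "G \<in> C" "P (f C) G" using f[OF C(1)] by blast
    obtain H where H: "H \<in> C'" "P (f C) H" using f[OF C(2)] C(3) by auto
    have "G \<in> S" "H \<in> S" using G H CS C by blast+
    then have "(G, H) \<in> iso_rel S" using iso f[OF C(1)] G H by blast
    then show "C = C'" using quotient_eq_iff[OF eq C(1,2) G(1) H(1)] by blast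
  qed
  have img: "f ` (S // iso_rel S) \<subseteq> D" using f by blast
  show "finite (S // iso_rel S)" using inj_on_finite[OF inj img D] .
  show "num_iso_classes S \<le> card D"
    unfolding num_iso_classes_def by (rule card_inj_on_le[OF inj img D])
qed

lemma groups_of_order_groups: "groups_of_order n \<subseteq> Collect group"
  by (auto simp: groups_of_order_def)

text \<open>The labels are multiplication tables on \<open>{..<n}\<close>, of which there are
  finitely many.\<close>

lemma finite_iso_classes:
  assumes S: "S \<subseteq> groups_of_order n" and "n > 0"
  shows "finite (S // iso_rel S)"
proof -
  define P where "P d G \<longleftrightarrow> (\<exists>f. bij_betw f (carrier G) {..<n} \<and>
      (\<forall>x\<in>carrier G. \<forall>y\<in>carrier G. f (x \<otimes>\<^bsub>G\<^esub> y) = d (f x, f y)))"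
    for d :: "nat \<times> nat \<Rightarrow> nat" and G :: "nat monoid"
  let ?D = "({..<n} \<times> {..<n}) \<rightarrow>\<^sub>E {..<n}"
  show ?thesis
  proof (rule num_iso_classes_le[of S ?D P])
    show "S \<subseteq> Collect group" using S groups_of_order_groups by blast
    show "finite ?D" by (intro finite_PiE) auto
    show "\<exists>d\<in>?D. P d G" if "G \<in> S" for G
    proof -
      have G: "group G" "card (carrier G) = n" using that S by (auto simp: groups_of_order_def order_def)
      then have "finite (carrier G)" using \<open>n > 0\<close> card_gt_0_iff by blast
      then obtain f where f: "bij_betw f (carrier G) {..<n}"
        using ex_bij_betw_finite_nat G(2) by (metis atLeast0LessThan)
      let ?g = "inv_into (carrier G) f"
      define d where "d = restrict (\<lambda>(a, b). f (?g a \<otimes>\<^bsub>G\<^esub> ?g b)) ({..<n} \<times> {..<n})"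
      have g: "?g a \<in> carrier G" if "a \<in> {..<n}" for a
        using f that by (metis bij_betw_imp_surj_on inv_into_into)
      have fc: "f x \<in> {..<n}" if "x \<in> carrier G" for x using f that by (rule bij_betwE[rule_format])
      have gf: "?g (f x) = x" if "x \<in> carrier G" for x using f that by (rule bij_betw_inv_into_left)
      have "d \<in> ?D" using g fc G(1) by (auto simp: d_def group.is_monoid monoid.m_closed)
      moreover have "P d G" unfolding P_def
        using f fc gf by (intro exI[of _ f]) (simp add: d_def)
      ultimately show ?thesis by blast
    qed
    show "G \<cong> H" if "H \<in> S" "P d G" "P d H" for d G H
    proof -
      obtain f where f: "bij_betw f (carrier G) {..<n}"
        "\<And>x y. x \<in> carrier G \<Longrightarrow> y \<in> carrier G \<Longrightarrow> f (x \<otimes>\<^bsub>G\<^esub> y) = d (f x, f y)"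
        using \<open>P d G\<close> unfolding P_def by blast
      obtain g where g: "bij_betw g (carrier H) {..<n}"
        "\<And>x y. x \<in> carrier H \<Longrightarrow> y \<in> carrier H \<Longrightarrow> g (x \<otimes>\<^bsub>H\<^esub> y) = d (g x, g y)"
        using \<open>P d H\<close> unfolding P_def by blast
      let ?h = "inv_into (carrier H) g \<circ> f"
      have bij: "bij_betw ?h (carrier G) (carrier H)"
        by (rule bij_betw_trans[OF f(1) bij_betw_inv_into[OF g(1)]])
      have gh: "g (?h x) = f x" if "x \<in> carrier G" for x
        using bij_betw_inv_into_right[OF g(1)] bij_betwE[OF f(1)] that by simp
      have hH: "?h x \<in> carrier H" if "x \<in> carrier G" for x using bij that by (rule bij_betwE[rule_format])
      have "?h (x \<otimes>\<^bsub>G\<^esub> y) = ?h x \<otimes>\<^bsub>H\<^esub> ?h y" if xy: "x \<in> carrier G" "y \<in> carrier G" for x y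
      proof -
        have "monoid H" using that(1) \<open>H \<in> S\<close> S by (auto simp: groups_of_order_def group.is_monoid)
        have "f (x \<otimes>\<^bsub>G\<^esub> y) = g (?h x \<otimes>\<^bsub>H\<^esub> ?h y)"
          using f(2)[OF xy] g(2)[OF hH hH, OF xy] xy by (simp only: gh)
        then show ?thesis
          using bij_betw_inv_into_left[OF g(1)] monoid.m_closed[OF \<open>monoid H\<close> hH hH, OF xy] by simp
      qed
      then have "?h \<in> iso G H" using bij hH by (auto simp: iso_def hom_def)
      then show ?thesis by (auto simp: is_iso_def)
    qed
  qed
qed

lemma card_le_num_iso_classes:
  assumes S: "S \<subseteq> Collect group" "finite (S // iso_rel S)"
    and f: "\<And>d. d \<in> D \<Longrightarrow> f d \<in> S" "\<And>d d'. d \<in> D \<Longrightarrow> d' \<in> D \<Longrightarrow> f d \<cong> f d' \<Longrightarrow> d = d'"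
  shows "card D \<le> num_iso_classes S"
  unfolding num_iso_classes_def
proof (rule card_inj_on_le[OF _ _ S(2)])
  show "(\<lambda>d. iso_rel S `` {f d}) ` D \<subseteq> S // iso_rel S"
    by (rule image_subsetI) (rule quotientI[OF f(1)])
  show "inj_on (\<lambda>d. iso_rel S `` {f d}) D"
    using eq_equiv_class_iff[OF equiv_iso_rel[OF S(1)]] f by (intro inj_onI) blast
qed

lemma num_iso_classes_Un:
  assumes S: "S \<subseteq> groups_of_order n" and T: "T \<subseteq> groups_of_order n" and "n > 0"
    and no: "\<And>G H. G \<in> S \<Longrightarrow> H \<in> T \<Longrightarrow> \<not> G \<cong> H"
  shows "num_iso_classes (S \<union> T) = num_iso_classes S + num_iso_classes T"
proof -
  have no': "\<not> H \<cong> G" if "G \<in> S" "H \<in> T" for G H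
    using no[OF that] that T group.iso_sym by (auto simp: groups_of_order_def)
  have "S \<inter> T = {}" using no by force
  then have imS: "iso_rel (S \<union> T) `` {G} = iso_rel S `` {G}" if "G \<in> S" for G
    using that no by auto
  have imT: "iso_rel (S \<union> T) `` {G} = iso_rel T `` {G}" if "G \<in> T" for G
    using that no' \<open>S \<inter> T = {}\<close> by auto
  have "(S \<union> T) // iso_rel (S \<union> T) = S // iso_rel S \<union> T // iso_rel T"
    using imS imT by (auto simp: quotient_def)
  moreover have "S // iso_rel S \<inter> T // iso_rel T = {}"
  proof -
    have eS: "equiv S (iso_rel S)" and eT: "equiv T (iso_rel T)"
      using S T groups_of_order_groups[of n] by (simp_all add: equiv_iso_rel)
    have "C \<subseteq> S" "C \<subseteq> T" "C \<noteq> {}" if "C \<in> S // iso_rel S" "C \<in> T // iso_rel T" for C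
      using in_quotient_imp_subset[OF eS that(1)] in_quotient_imp_subset[OF eT that(2)]
        in_quotient_imp_non_empty[OF eS that(1)] by simp_all
    then show ?thesis using \<open>S \<inter> T = {}\<close> by blast
  qed
  ultimately show ?thesis
    unfolding num_iso_classes_def
    using finite_iso_classes[OF S \<open>n > 0\<close>] finite_iso_classes[OF T \<open>n > 0\<close>] by (simp add: card_Un_disjoint)
qed

lemma (in group) nat_copy:
  assumes "order G > 0"
  obtains H :: "nat monoid" where "H \<in> groups_of_order (order G)" "G \<cong> H"
proof -
  have fin: "finite (carrier G)" using assms by (simp add: order_gt_0_iff_finite)
  obtain f where f: "bij_betw f (carrier G) {..<order G}"
    using ex_bij_betw_finite_nat[OF fin] by (auto simp: order_def atLeast0LessThan)
  let ?g = "inv_into (carrier G) f"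
  define H where "H = \<lparr>carrier = {..<order G}, monoid.mult = (\<lambda>a b. f (?g a \<otimes> ?g b)), one = f \<one>\<rparr>"
  have fH: "bij_betw f (carrier G) (carrier H)" using f by (simp add: H_def)
  have "f (x \<otimes> y) = f x \<otimes>\<^bsub>H\<^esub> f y" if "x \<in> carrier G" "y \<in> carrier G" for x y
    using that bij_betw_inv_into_left[OF f] by (simp add: H_def)
  then have iso: "f \<in> iso G H" using fH bij_betwE[OF fH] by (simp add: iso_def hom_def)
  then have "group (H\<lparr>one := f \<one>\<rparr>)" by (rule iso_imp_img_group)
  then have "group H" by (simp add: H_def)
  then show ?thesis using iso by (intro that[of H]) (auto simp: groups_of_order_def order_def H_def is_iso_def)
qed

subsection \<open>Isomorphism invariance\<close>

lemma generating_pair_iso: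
  assumes "group G" "group H" and f: "f \<in> iso G H" and g: "generating_pair G x y"
  shows "generating_pair H (f x) (f y)"
proof -
  have bij: "bij_betw f (carrier G) (carrier H)" and "f \<in> hom G H" using f by (simp_all add: iso_def)
  then interpret f: group_hom G H f using assms by (simp add: group_hom_def group_hom_axioms_def)
  have "generate H (f ` {x, y}) = f ` generate G {x, y}"
    using g by (intro f.generate_img) (simp add: generating_pair_def)
  then show ?thesis using g bij by (simp add: generating_pair_def bij_betw_def)
qed

lemma beauville_Sigma_iso:
  assumes "group G" "group H" and f: "f \<in> iso G H" and xy: "x \<in> carrier G" "y \<in> carrier G"
  shows "beauville_Sigma H (f x) (f y) = f ` beauville_Sigma G x y"
proof -
  have bij: "bij_betw f (carrier G) (carrier H)" and "f \<in> hom G H" using f by (simp_all add: iso_def)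
  then interpret f: group_hom G H f using assms by (simp add: group_hom_def group_hom_axioms_def)
  have ord: "order H = order G" using bij_betw_same_card[OF bij] by (simp add: order_def)
  have cH: "carrier H = f ` carrier G" using bij by (simp add: bij_betw_def)
  have conj: "conjugate H (f u [^]\<^bsub>H\<^esub> i) (f g) = f (conjugate G (u [^]\<^bsub>G\<^esub> i) g)"
    if "u \<in> carrier G" "g \<in> carrier G" for u g and i :: nat
    using that by (simp add: conjugate_def f.hom_nat_pow)
  have m: "f x \<otimes>\<^bsub>H\<^esub> f y = f (x \<otimes>\<^bsub>G\<^esub> y)" using xy by simp
  show ?thesis
    unfolding beauville_Sigma_def ord cH m image_UN
    using xy by (intro SUP_cong refl) (simp add: conj del: f.hom_mult)
qed

lemma beauville_group_iso:
  assumes G: "beauville_group G" and H: "group H" and iso: "G \<cong> H"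
  shows "beauville_group H"
proof -
  obtain f where f: "f \<in> iso G H" using iso by (auto simp: is_iso_def)
  have gG: "group G" using G by (simp add: beauville_group_def)
  have bij: "bij_betw f (carrier G) (carrier H)" using f by (simp add: iso_def)
  obtain x1 y1 x2 y2 where g: "generating_pair G x1 y1" "generating_pair G x2 y2"
    and S: "beauville_Sigma G x1 y1 \<inter> beauville_Sigma G x2 y2 = {\<one>\<^bsub>G\<^esub>}"
    using G by (auto simp: beauville_group_def beauville_structure_def)
  have sub: "beauville_Sigma G x y \<subseteq> carrier G" if "generating_pair G x y" for x y
  proof -
    interpret group G by (rule gG)
    show ?thesis using that unfolding beauville_Sigma_def generating_pair_def conjugate_def by auto
  qed
  have S_eq: "beauville_Sigma H (f x) (f y) = f ` beauville_Sigma G x y" if "generating_pair G x y" for x y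
    using that by (intro beauville_Sigma_iso[OF gG H f]) (simp_all add: generating_pair_def)
  have "f ` beauville_Sigma G x1 y1 \<inter> f ` beauville_Sigma G x2 y2
      = f ` (beauville_Sigma G x1 y1 \<inter> beauville_Sigma G x2 y2)"
    using bij sub[OF g(1)] sub[OF g(2)] by (intro inj_on_image_Int[symmetric]) (auto simp: bij_betw_def)
  also have "\<dots> = {\<one>\<^bsub>H\<^esub>}"
    using hom_one[of f G H] f gG H by (simp add: S iso_def)
  finally have "beauville_structure H (f x1) (f y1) (f x2) (f y2)"
    using g generating_pair_iso[OF gG H f] by (simp add: beauville_structure_def S_eq)
  moreover have "finite (carrier H)" using G bij bij_betw_finite by (auto simp: beauville_group_def)
  ultimately show ?thesis using H by (auto simp: beauville_group_def)
qed

lemma two_generated_iso: "two_generated G \<Longrightarrow> group G \<Longrightarrow> group H \<Longrightarrow> G \<cong> H \<Longrightarrow> two_generated H"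
  unfolding two_generated_def is_iso_def ex_in_conv[symmetric] by (metis generating_pair_iso)

lemma gen_of_generating_pair:
  assumes H: "sgp H" and g: "generating_pair (mon H) x y"
  shows "gen {x, y} = H"
proof
  have xy: "{x, y} \<subseteq> H" using g by (simp add: generating_pair_def)
  then show "gen {x, y} \<subseteq> H" using H by (rule gen_subset)
  have "subgroup (gen {x, y}) (mon H)" using xy H by (intro subgroup_mon gen_subset) auto
  then have "generate (mon H) {x, y} \<subseteq> gen {x, y}"
    by (intro group.generate_subgroup_incl[OF group_mon[OF H]] gen_superset)
  then show "H \<subseteq> gen {x, y}" using g by (simp add: generating_pair_def)
qed

lemma weakly_beauville_of_beauville_group:
  assumes H: "sgp H" and B: "beauville_group (mon H)"
  shows "weakly_beauville H"
proof -
  interpret group "mon H" using H by (rule group_mon)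
  obtain x1 y1 x2 y2 where fin: "finite H"
    and g: "generating_pair (mon H) x1 y1" "generating_pair (mon H) x2 y2"
    and S: "beauville_Sigma (mon H) x1 y1 \<inter> beauville_Sigma (mon H) x2 y2 = {1}"
    using B by (auto simp: beauville_group_def beauville_structure_def)
  have "u ^ i \<in> beauville_Sigma (mon H) x y" if "generating_pair (mon H) x y" "u \<in> {x, y}" for x y u i
    using power_in_beauville_Sigma[of u x y i] that fin by (simp add: generating_pair_def pow_mon)
  then have "u ^ i = 1" if "u \<in> {x1, y1}" "v \<in> {x2, y2}" "u ^ i = v ^ j" for u v i j
    using that g S by (metis IntI singletonD)
  then have "\<forall>u\<in>{x1, y1}. \<forall>v\<in>{x2, y2}. \<forall>i j. u ^ i = v ^ j \<longrightarrow> u ^ i = 1" by (intro ballI allI impI)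
  then show ?thesis
    unfolding weakly_beauville_def using g[THEN gen_of_generating_pair[OF H]] by (intro exI conjI)
qed

context odd_regular_pgrp
begin

text \<open>\<open>pw_card_ge\<close> with \<open>i = Suc e\<close> is used twice: for
  \<open>c = p ^ 2\<close> it gives \<open>e \<le> 2\<close>, and for \<open>e = 1\<close> with
  \<open>c\<close> the number of \<open>p\<close>-th powers it leaves only \<open>p ^ 2\<close> and
  \<open>p ^ 3\<close> for that number.\<close>

lemma weakly_beauville_cases:
  assumes k6: "k = 6" and wb: "weakly_beauville H" and n0: "square_class p n0"
  shows "(\<forall>g\<in>H. g ^ p = 1) \<or> (\<exists>(a, b, c, d)\<in>normal2 n0. data2 p H a b c d) \<or>
    (\<exists>(a, b, c, d, f)\<in>normal3 n0. data3 p H a b c d f) \<or> (\<exists>m\<in>normal4. data4 p H m)"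
proof -
  obtain x y where g: "gen {x, y} = H" using wb by (auto simp: weakly_beauville_def)
  obtain e where e: "\<And>g. g \<in> H \<Longrightarrow> g ^ p ^ Suc e = 1" "p\<^sup>2 \<le> card (pw (p ^ e) H)"
    using weakly_beauville_power_card[OF wb] k6 by auto
  have "pw 1 H = H" by (simp add: pw_def)
  then have ge: "c ^ Suc e \<le> p ^ 6" if "c \<le> card (pw (p ^ e) H)" for c
    using pw_card_ge[OF e(1) that, of "Suc e"] card k6 by simp
  have "p ^ (2 * Suc e) \<le> p ^ 6" using ge[OF e(2)] by (simp only: power_mult)
  then have "2 * Suc e \<le> 6" using p_gt_1 power_le_imp_le_exp by blast
  then have "e = 0 \<or> e = 1 \<or> e = 2" by arith
  then consider "e = 0" | "e = 1" | "e = 2" by blast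
  then show ?thesis
  proof cases
    case 1
    then show ?thesis using e(1) by simp
  next
    case 2
    have e2: "(g ^ p) ^ p = 1" if "g \<in> H" for g
      using e(1)[OF that] 2 by (simp add: power2_eq_square flip: power_mult)
    have P: "sgp (pw p H)" "pw p H \<subseteq> H" using sgp_pw[of 1] pw_subset by simp_all
    obtain j where j: "pgrp p j (pw p H)" using pgrp_subgroup[OF pgrp P] .
    then have c: "card (pw p H) = p ^ j" by (simp add: pgrp_def)
    have "2 \<le> j" using e(2) 2 c p_gt_1 power_le_imp_le_exp[of p 2 j] by simp
    moreover have "j \<le> 3"
    proof -
      have "(p ^ j) ^ Suc e \<le> p ^ 6" using 2 c by (intro ge) simp
      then have "p ^ (j * 2) \<le> p ^ 6" using 2 by (simp add: power_mult power2_eq_square)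
      then have "j * 2 \<le> 6" using p_gt_1 power_le_imp_le_exp by blast
      then show ?thesis by simp
    qed
    ultimately have "j = 2 \<or> j = 3" by arith
    then consider "j = 2" | "j = 3" by blast
    then show ?thesis
    proof cases
      case 1
      then obtain a b c d where "data2 p H a b c d" using case2_data[OF k6 g e2] c by blast
      then show ?thesis using data2_normal[OF n0] by blast
    next
      case 2
      then obtain a b c d f where "rel3 p x y a b c d f" using case3_structure[OF k6 g e2] c by blast
      then have "data3 p H a b c d f" using g unfolding data3_def by blast
      then show ?thesis using data3_normal[OF n0] by blast
    qed
  next
    case 3
    then have "g ^ p ^ 3 = 1" if "g \<in> H" for g using e(1)[OF that] by (simp add: numeral_3_eq_3)
    moreover have "p\<^sup>2 \<le> card (pw (p\<^sup>2) H)" using e(2) 3 by simp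
    ultimately obtain m where "data4 p H m" using case4_structure[OF k6 g] by blast
    then show ?thesis using data4_normal by blast
  qed
qed

end

definition nonbeauville :: "nat \<Rightarrow> nat monoid set" where
  "nonbeauville n = {G \<in> groups_of_order n. two_generated G \<and> \<not> beauville_group G}"

lemma nonbeauville_copy:
  assumes "group K" "order K = n" "n > 0" "two_generated K" "\<not> beauville_group K"
  obtains G where "G \<in> nonbeauville n" "K \<cong> G"
proof -
  obtain G where G: "G \<in> groups_of_order n" "K \<cong> G" using group.nat_copy assms by metis
  have "group G" using G(1) by (simp add: groups_of_order_def)
  then have "two_generated G" "\<not> beauville_group G"
    using two_generated_iso[OF assms(4,1) _ G(2)] beauville_group_iso[of G K] G(2) assms(1,5)
      group.iso_sym by blast+
  then show ?thesis using that G by (auto simp: nonbeauville_def)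
qed

lemma nonbeauville_ge:
  assumes "prime p" "odd p"
  shows "p \<le> num_iso_classes (nonbeauville (p ^ 6))"
proof -
  have p0: "p ^ 6 > 0" using prime_gt_0_nat[OF assms(1)] by simp
  have "\<exists>G\<in>nonbeauville (p ^ 6). family.F p \<kappa> \<cong> G" for \<kappa>
  proof -
    interpret family p \<kappa> using assms by unfold_locales
    show ?thesis
      using nonbeauville_copy[OF group_F order_F p0 _ not_beauville_F] generating_pair_F
      unfolding two_generated_def by blast
  qed
  then obtain f where f: "\<And>\<kappa>. f \<kappa> \<in> nonbeauville (p ^ 6)" "\<And>\<kappa>. family.F p \<kappa> \<cong> f \<kappa>" by metis
  have "card {..<p} \<le> num_iso_classes (nonbeauville (p ^ 6))"
  proof (rule card_le_num_iso_classes[where f = f])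
    show "nonbeauville (p ^ 6) \<subseteq> Collect group" by (auto simp: nonbeauville_def groups_of_order_def)
    show "finite (nonbeauville (p ^ 6) // iso_rel (nonbeauville (p ^ 6)))"
      by (rule finite_iso_classes[OF _ p0]) (auto simp: nonbeauville_def)
    fix \<kappa> \<kappa>' assume "\<kappa> \<in> {..<p}" "\<kappa>' \<in> {..<p}" and iso: "f \<kappa> \<cong> f \<kappa>'"
    have gr: "group (family.F p \<kappa>')" using assms by (intro family.group_F) unfold_locales
    have "family.F p \<kappa> \<cong> family.F p \<kappa>'"
      by (rule iso_trans[OF iso_trans[OF f(2) iso] group.iso_sym[OF gr f(2)]])
    then show "\<kappa> = \<kappa>'" using family_not_iso[OF assms] \<open>\<kappa> \<in> {..<p}\<close> \<open>\<kappa>' \<in> {..<p}\<close> by simp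
  qed (rule f)
  then show ?thesis by simp
qed

text \<open>The constant 15 adds the six, seven and two one-parameter families of normal forms; the
  groups of exponent \<open>p\<close> are counted injectively by the classes of
  \<open>nonbeauville (p ^ 6)\<close>.\<close>

lemma beauville_le:
  assumes p: "prime p" "p > 6"
  defines "B \<equiv> {G \<in> groups_of_order (p ^ 6). beauville_group G}"
  shows "num_iso_classes B \<le> num_iso_classes (nonbeauville (p ^ 6)) + 15 * p"
proof (cases "B = {}")
  case True
  then show ?thesis by (simp add: num_iso_classes_def)
next
  case False
  have p0: "p ^ 6 > 0" using p by simp
  have odd: "odd p" using prime_odd_nat[OF p(1)] p(2) by simp
  obtain n0 where n0: "square_class p n0" using square_class_exists[OF p(1)] p(2) by auto
  define N where "N = nonbeauville (p ^ 6)"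
  have N: "N \<subseteq> Collect group" by (auto simp: N_def nonbeauville_def groups_of_order_def)
  have B: "group G" "order G = p ^ 6" "beauville_group G" if "G \<in> B" for G
    using that by (auto simp: B_def groups_of_order_def)
  have rep: "\<exists>H :: nat symm set. mon H \<cong> G \<and> odd_regular_pgrp p 6 H \<and> weakly_beauville H" if "G \<in> B" for G
  proof -
    interpret group G using B[OF that] by simp
    obtain H :: "nat symm set" and f where H: "sgp H" "f \<in> iso G (mon H)" by (rule cayley)
    then have iso: "G \<cong> mon H" by (auto simp: is_iso_def)
    have "card H = p ^ 6" using iso_same_card[OF iso] B[OF that] by (simp add: order_def)
    then have "odd_regular_pgrp p 6 H" using p odd H by unfold_locales (simp_all add: pgrp_def)
    moreover have "weakly_beauville H"
      by (rule weakly_beauville_of_beauville_group[OF H(1) beauville_group_iso[OF B(3)[OF that] group_mon[OF H(1)] iso]])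
    ultimately show ?thesis using iso_sym[OF iso] by blast
  qed
  \<comment> \<open>The sets of normal forms are defined inside locales about a
    \<open>p\<close>-group but depend at most on \<open>p\<close> and \<open>n0\<close>. Any one
    group gives access to them, which is why an empty \<open>B\<close> is treated apart.\<close>
  obtain H0 :: "nat symm set" where "odd_regular_pgrp p 6 H0" using False rep by blast
  then interpret R: odd_regular_pgrp p 6 H0 .
  \<comment> \<open>Groups of exponent \<open>p\<close> are labelled by the class of a twist, all others by a normal form of
    their presentation.\<close>
  define P :: "nat monoid set + (int \<times> int \<times> int \<times> int) + (int \<times> int \<times> int \<times> int \<times> int) + int \<Rightarrow> nat monoid \<Rightarrow> bool"
    where "P l G \<longleftrightarrow> (\<exists>H :: nat symm set. mon H \<cong> G \<and> sgp H \<and> card H = p ^ 6 \<and>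
      (case l of
        Inl C \<Rightarrow> \<exists>\<chi> t. twist p H \<chi> t \<and> (\<exists>K\<in>C. twist.K p H \<chi> t \<cong> K)
      | Inr (Inl (a, b, c, d)) \<Rightarrow> data2 p H a b c d
      | Inr (Inr (Inl (a, b, c, d, f))) \<Rightarrow> data3 p H a b c d f
      | Inr (Inr (Inr m)) \<Rightarrow> data4 p H m))" for l G
  define D where "D = N // iso_rel N <+> R.normal2 n0 <+> R.normal3 n0 <+> R.normal4"
  have finN: "finite (N // iso_rel N)"
    by (rule finite_iso_classes[OF _ p0]) (auto simp: N_def nonbeauville_def)
  have "num_iso_classes B \<le> card D"
  proof (rule num_iso_classes_le(2)[where P = P])
    show "B \<subseteq> Collect group" using B by blast
    show "finite D"
      using finN R.card_normal2 R.card_normal3 R.card_normal4 by (simp add: D_def)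
    show "\<exists>l\<in>D. P l G" if GB: "G \<in> B" for G
    proof -
      obtain H :: "nat symm set" where H: "mon H \<cong> G" "odd_regular_pgrp p 6 H" "weakly_beauville H"
        using rep[OF GB] by blast
      interpret H: odd_regular_pgrp p 6 H by (rule H(2))
      consider "\<forall>g\<in>H. g ^ p = 1"
        | a b c d where "(a, b, c, d) \<in> R.normal2 n0" "data2 p H a b c d"
        | a b c d f where "(a, b, c, d, f) \<in> R.normal3 n0" "data3 p H a b c d f"
        | m where "m \<in> R.normal4" "data4 p H m"
        using H.weakly_beauville_cases[OF refl H(3) n0] by auto
      then show ?thesis
      proof cases
        case 1
        then obtain \<chi> t where tw: "twist p H \<chi> t" using twist_exists[OF H.pgrp] by auto
        then interpret twist p H \<chi> t .
        obtain x y where "gen {x, y} = H" using H(3) by (auto simp: weakly_beauville_def)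
        then obtain K' where K': "K' \<in> N" "K \<cong> K'"
          using nonbeauville_copy[OF group_K _ p0 two_generated_K not_beauville_K] H.card
          unfolding N_def by (auto simp: order_def)
        have "K' \<in> iso_rel N `` {K'}" using K' by auto
        then have "\<exists>\<chi> t. twist p H \<chi> t \<and> (\<exists>L\<in>iso_rel N `` {K'}. twist.K p H \<chi> t \<cong> L)"
          using tw K'(2) by blast
        then have "P (Inl (iso_rel N `` {K'})) G"
          unfolding P_def sum.case using H.sgp H.card H(1) by blast
        moreover have "Inl (iso_rel N `` {K'}) \<in> D" unfolding D_def by (rule InlI[OF quotientI[OF K'(1)]])
        ultimately show ?thesis by blast
      next
        case 2
        then show ?thesis using H.sgp H.card H(1)
          by (intro bexI[of _ "Inr (Inl (a, b, c, d))"]) (auto simp: P_def D_def)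
      next
        case 3
        then show ?thesis using H.sgp H.card H(1)
          by (intro bexI[of _ "Inr (Inr (Inl (a, b, c, d, f)))"]) (auto simp: P_def D_def)
      next
        case 4
        then show ?thesis using H.sgp H.card H(1)
          by (intro bexI[of _ "Inr (Inr (Inr m))"]) (auto simp: P_def D_def)
      qed
    qed
    show "G \<cong> G'" if l: "l \<in> D" and "G \<in> B" "G' \<in> B" and P: "P l G" "P l G'" for l G G'
    proof -
      have by_iso: "G \<cong> G'" if "mon H \<cong> G" "mon H' \<cong> G'" "sgp H" "mon H \<cong> mon H'" for H H' :: "nat symm set"
        by (rule iso_trans[OF iso_trans[OF group.iso_sym[OF group_mon[OF that(3)] that(1)] that(4)] that(2)])
      consider C where "l = Inl C" "C \<in> N // iso_rel N" | a b c d where "l = Inr (Inl (a, b, c, d))"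
        | a b c d f where "l = Inr (Inr (Inl (a, b, c, d, f)))" | m where "l = Inr (Inr (Inr m))"
        using l unfolding D_def by (auto elim!: PlusE)
      then show ?thesis
      proof cases
        case 1
        obtain H :: "nat symm set" and \<chi> t K where H: "mon H \<cong> G" "sgp H" "twist p H \<chi> t" "K \<in> C" "twist.K p H \<chi> t \<cong> K"
          using P(1) unfolding P_def 1 by auto
        obtain H' :: "nat symm set" and \<chi>' t' K' where H': "mon H' \<cong> G'" "sgp H'" "twist p H' \<chi>' t'" "K' \<in> C" "twist.K p H' \<chi>' t' \<cong> K'"
          using P(2) unfolding P_def 1 by auto
        have "K \<cong> K'" using quotient_eq_iff[OF equiv_iso_rel[OF N] 1(2,2) H(4) H'(4)] by simp
        then have "twist.K p H \<chi> t \<cong> twist.K p H' \<chi>' t'"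
          by (rule iso_trans[OF iso_trans[OF H(5)] group.iso_sym[OF twist.group_K[OF H'(3)] H'(5)]])
        then show ?thesis by (rule by_iso[OF H(1) H'(1) H(2) twist_untwist[OF H(3) H'(3)]])
      next
        case 2
        obtain H :: "nat symm set" where H: "mon H \<cong> G" "sgp H" "card H = p ^ 6" "data2 p H a b c d"
          using P(1) unfolding P_def 2 by auto
        obtain H' :: "nat symm set" where H': "mon H' \<cong> G'" "sgp H'" "card H' = p ^ 6" "data2 p H' a b c d"
          using P(2) unfolding P_def 2 by auto
        have "mon H \<cong> mon H'" using H H' R.p_gt_1 rel2_iso[of p _ _ a b c d H _ _ H'] by (auto simp: data2_def)
        then show ?thesis by (rule by_iso[OF H(1) H'(1) H(2)])
      next
        case 3
        obtain H :: "nat symm set" where H: "mon H \<cong> G" "sgp H" "card H = p ^ 6" "data3 p H a b c d f"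
          using P(1) unfolding P_def 3 by auto
        obtain H' :: "nat symm set" where H': "mon H' \<cong> G'" "sgp H'" "card H' = p ^ 6" "data3 p H' a b c d f"
          using P(2) unfolding P_def 3 by auto
        have "mon H \<cong> mon H'" using H H' odd rel3_iso[of p _ _ a b c d f H _ _ H'] by (auto simp: data3_def)
        then show ?thesis by (rule by_iso[OF H(1) H'(1) H(2)])
      next
        case 4
        obtain H :: "nat symm set" where H: "mon H \<cong> G" "sgp H" "card H = p ^ 6" "data4 p H m"
          using P(1) unfolding P_def 4 by auto
        obtain H' :: "nat symm set" where H': "mon H' \<cong> G'" "sgp H'" "card H' = p ^ 6" "data4 p H' m"
          using P(2) unfolding P_def 4 by auto
        have "mon H \<cong> mon H'" using H H' R.p_gt_1 rel4_iso[of p _ _ m H _ _ H'] by (auto simp: data4_def)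
        then show ?thesis by (rule by_iso[OF H(1) H'(1) H(2)])
      qed
    qed
  qed
  also have "card D \<le> num_iso_classes N + 15 * p"
    using finN R.card_normal2[of n0] R.card_normal3[of n0] R.card_normal4
    by (simp add: D_def card_Plus num_iso_classes_def)
  finally show ?thesis by (simp add: N_def)
qed

lemma beauville_proportion_le:
  assumes p: "prime p" "p > 6"
  shows "beauville_proportion (p ^ 6) \<le> 16 / 17"
proof -
  let ?B = "{G \<in> groups_of_order (p ^ 6). beauville_group G}" and ?N = "nonbeauville (p ^ 6)"
  have odd: "odd p" using prime_odd_nat[OF p(1)] p(2) by simp
  have p0: "p ^ 6 > 0" using p by simp
  have "two_generated G" if "beauville_group G" for G :: "nat monoid"
    using that by (auto simp: beauville_group_def beauville_structure_def two_generated_def)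
  then have "{G \<in> groups_of_order (p ^ 6). two_generated G} = ?B \<union> ?N" by (auto simp: nonbeauville_def)
  moreover have "num_iso_classes (?B \<union> ?N) = num_iso_classes ?B + num_iso_classes ?N"
    by (rule num_iso_classes_Un[OF _ _ p0])
       (use beauville_group_iso in \<open>auto simp: nonbeauville_def groups_of_order_def\<close>)
  moreover have "num_iso_classes ?B \<le> 16 * num_iso_classes ?N"
    using beauville_le[OF p] nonbeauville_ge[OF p(1) odd] by linarith
  moreover have "num_iso_classes ?N > 0" using nonbeauville_ge[OF p(1) odd] p by linarith
  ultimately show ?thesis
    by (simp add: beauville_proportion_def field_simps)
qed

theorem corollary7:
  "\<not> ((\<lambda>p::nat. beauville_proportion (p ^ 6)) \<longlongrightarrow> 1)
       (inf at_top (principal {p. prime p}))"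
proof
  assume "((\<lambda>p::nat. beauville_proportion (p ^ 6)) \<longlongrightarrow> 1) (inf at_top (principal {p. prime p}))"
  then have "\<forall>\<^sub>F p in inf at_top (principal {p. prime p}). beauville_proportion (p ^ 6) > 16 / 17"
    by (rule order_tendstoD) simp
  then obtain n where n: "\<And>p. p \<ge> n \<Longrightarrow> prime p \<Longrightarrow> beauville_proportion (p ^ 6) > 16 / 17"
    by (auto simp: eventually_inf_principal eventually_at_top_linorder)
  obtain p where p: "prime p" "p > max n 6" using bigger_prime by blast
  then show False using n[of p] beauville_proportion_le[of p] by simp
qed

end
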